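(* Let $e\ge 1$, $\ell\ge 1$, $n\ge 1$, let $\boldsymbol\rho=(\rho_1,\dots,\rho_\ell)\in(\mathbb Z/(e+1)\mathbb Z)^\ell$ and let $\boldsymbol\kappa\in\mathbb Z^\ell$ be an asymptotic charge. Let $\boldsymbol\lambda$ be an $\ell$-partition of $n$, let $1_{\boldsymbol\lambda}$ be its idempotent diagram (type $A^{(1)}_e$, unit ghost shifts), let $1_{\boldsymbol\lambda}^{+}:=S_{t,\epsilon}(1_{\boldsymbol\lambda})$ be its image under the subdivision map at the edge $0\to 1$, and let $\boldsymbol\lambda^+$ be the $\ell$-partition obtained from $\boldsymbol\lambda$ and $\boldsymbol\rho$ by the box construction. Then, as idempotent diagrams of type $A^{(1)}_{e+1}$ with red labels $\boldsymbol\rho^+$, $$1_{\boldsymbol\lambda}^{+}=1_{\boldsymbol\lambda^{+}} .$$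
   Context: **Residues.** Put $e'=e+1$, $I=\mathbb Z/e'\mathbb Z=\{0,\dots,e\}$. A node of an $\ell$-partition $\boldsymbol\lambda=(\lambda^{(1)},\dots,\lambda^{(\ell)})$ is $(m,r,c)$ with $1\le m\le \ell$, $1\le c\le\lambda^{(m)}_r$; its residue is $c-r+\rho_m \bmod e'$. An $i$-node is a node of residue $i$. **Idempotent diagrams.** Consider the cyclic quiver on $\mathbb Z/p\mathbb Z$ with edges $i\to i+1$ (type $A^{(1)}_{p-1}$), the edge $i\to i+1$ carrying a ghost shift $\sigma_i>0$. An idempotent diagram consists of vertical strings: finitely many solid strings at real positions, each with a residue; for each solid $i$-string at position $x$ a ghost $i$-string at position $x+\sigma_i$; red strings at positions $\kappa_1<\dots<\kappa_\ell$ with given residues. All positions are pairwise distinct. It represents an idempotent of the weighted KLRW algebra. Convention of equality: two idempotent diagrams are identified if one is obtained from the other by moving solid strings (together with their ghosts) horizontally, where any two strings may pass through each other except: two solid strings of equal residue; a ghost $i$-string and a solid $(i+1)$-string; a solid $i$-string and a red $i$-string. (Equivalently, they are joined by an undotted KLRW diagram $D$ with only such harmless crossings, so that $D^\star D$ and $DD^\star$ are the two idempotents, where $D^\star$ is $D$ reflected in a horizontal line.) **The diagram $1_{\boldsymbol\lambda}$.** "Asymptotic" means $\kappa_{m+1}-\kappa_m>4n+2$ for all $m$. Put $\hat\ell=\ell+n(e+1)$ and fix $0<\delta<\frac1{2n\hat\ell}$. In type $A^{(1)}_e$ all ghost shifts are $1$. For each node $(m,r,c)$ of $\boldsymbol\lambda$,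 $1_{\boldsymbol\lambda}$ has a solid string of residue $c-r+\rho_m$ at position $\kappa_m+(c-r)-\frac{m}{\hat\ell}-(c+r)\delta$, its ghost $1$ unit to the right, and it has red strings of residue $\rho_m$ at $\kappa_m$. **Subdivision map on $1_{\boldsymbol\lambda}$.** A close $(0,1)$-tuple is a sequence of strings, alternately ghost $0$-strings and solid $1$-strings, with consecutive members at distance $\delta$ (a single ghost $0$-string or solid $1$-string is allowed); it is maximal if it cannot be extended. Its starting residue is the residue ($0$ or $1$) of its rightmost string. Fix $0<\epsilon<t\ll 1$ with $t+\epsilon$ smaller than the distance between any two distinct strings. $S_{t,\epsilon}(1_{\boldsymbol\lambda})$ is obtained as follows: every residue $j\in\{1,\dots,e\}$ of a solid, ghost or red string is replaced by $j+1$, and $0$ is kept; then for each ghost $0$-string one adds a new solid $1$-string, at distance $t$ to the left of it if its maximal close tuple has starting residue $0$, and at distance $t$ to the right of it if the starting residue is $1$; each new solid $1$-string gets a ghost $1$-string at distance $\epsilon$ to its right. The result is an idempotent diagram of type $A^{(1)}_{e+1}$ (residues mod $e+2$), with ghost shift $1$ for all edges except $1\to2$, whose ghost shift is $\epsilon$, and with red labels $\boldsymbol\rho^+$, where $\rho_m^+=0$ if $\rho_m=0$ and $\rho_m^+=\rho_m+1$ otherwise. **Idempotent $1_{\boldsymbol\nu}$ in the subdivided setting.** For a nonempty $\ell$-partition $\boldsymbol\nu$, put $\hat\ell_{\boldsymbol\nu}=\ell+|\boldsymbol\nu|(e+2)$ and fix $0<\delta_{\boldsymbol\nu}<\frac1{2|\boldsymbol\nu|\hat\ell_{\boldsymbol\nu}}$.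 Let first $1^{\mathrm{unit}}_{\boldsymbol\nu}$ be the idempotent diagram of type $A^{(1)}_{e+1}$ with all ghost shifts $1$ which has, for each node $(m,r,c)$ of $\boldsymbol\nu$, a solid string of residue $c-r+\rho^+_m\bmod (e+2)$ at position $\kappa_m+(c-r)-\frac{m}{\hat\ell_{\boldsymbol\nu}}-(c+r)\delta_{\boldsymbol\nu}$, its ghost $1$ unit to the right, and which has red strings of residue $\rho^+_m$ at $\kappa_m$. Then $1_{\boldsymbol\nu}$ is the idempotent diagram with ghost shift $\epsilon$ on $1\to 2$ and $1$ on the other edges, whose solid, ghost and red strings occur in the same left-to-right order (with the same residues) as those of $1^{\mathrm{unit}}_{\boldsymbol\nu}$. **The $\ell$-partition $\boldsymbol\lambda^+$.** It is computed component by component; for a component $\lambda$ with residues given by $\rho\in I$: a strip is a nonempty finite sequence of nodes $(A_1,\dots,A_k)$ of $\lambda$ with residues in $\{0,1\}$ such that if $A_j=(r,c)$ has residue $0$ then $A_{j+1}=(r,c+1)$, and if $A_j=(r,c)$ has residue $1$ then $A_{j+1}=(r+1,c)$; it starts with the residue of $A_1$; it is maximal if it is not part of a longer strip. Simultaneously for all maximal strips: if the strip starts with $0$, then for each of its $0$-nodes a new node is inserted immediately to the right, pushing the nodes to the right of it in its row one step right; if the strip starts with $1$, then for each of its $0$-nodes a new node is inserted immediately above it, pushing it and all nodes below it in its column one step down. Explicitly, an old node $(r,c)$ moves to $(r+a,c+b)$, where $a$ is the number of $0$-nodes $(r',c)$, $r'\le r$, in maximal strips starting with $1$, and $b$ is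 the number of $0$-nodes $(r,c')$, $c'<c$, in maximal strips starting with $0$; the new node attached to a $0$-node is immediately right of (resp. immediately above) the new place of that $0$-node if its strip starts with $0$ (resp. $1$). The resulting boxes form the diagram of $\lambda^+$. *)

theory Defs
  imports Complex_Main
begin

section \<open>Multipartitions, nodes and residues\<close>

text \<open>
  A partition is the function sending \<open>r \<ge> 1\<close> to its \<open>r\<close>-th part, with value 0 past the last part
  and at the unused index 0.  Components of an \<open>l\<close>-partition are indexed by \<open>1..l\<close>; the components at
  other indices are required to be empty, so that equal multipartitions are equal functions.
\<close>

definition partition :: "(nat \<Rightarrow> nat) \<Rightarrow> bool" where
  "partition mu \<longleftrightarrow> mu 0 = 0 \<and> (\<forall>r\<ge>1. mu (Suc r) \<le> mu r) \<and> finite {r. mu r \<noteq> 0}"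

definition multipartition :: "nat \<Rightarrow> (nat \<Rightarrow> nat \<Rightarrow> nat) \<Rightarrow> bool" where
  "multipartition l lam \<longleftrightarrow>
     (\<forall>m\<in>{1..l}. partition (lam m)) \<and> (\<forall>m. m \<notin> {1..l} \<longrightarrow> lam m = (\<lambda>_. 0))"

definition msize :: "nat \<Rightarrow> (nat \<Rightarrow> nat \<Rightarrow> nat) \<Rightarrow> nat" where
  "msize l lam = (\<Sum>m = 1..l. \<Sum>r | lam m r \<noteq> 0. lam m r)"

definition boxes :: "(nat \<Rightarrow> nat) \<Rightarrow> (nat \<times> nat) set" where
  "boxes mu = {(r, c). 1 \<le> r \<and> 1 \<le> c \<and> c \<le> mu r}"

definition nodes :: "nat \<Rightarrow> (nat \<Rightarrow> nat \<Rightarrow> nat) \<Rightarrow> (nat \<times> nat \<times> nat) set" where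
  "nodes l lam = {(m, r, c). 1 \<le> m \<and> m \<le> l \<and> (r, c) \<in> boxes (lam m)}"

text \<open>Elements of \<open>\<int>/p\<int>\<close> are represented by the integers \<open>0, \<dots>, p - 1\<close> throughout.\<close>

definition box_res :: "nat \<Rightarrow> int \<Rightarrow> nat \<times> nat \<Rightarrow> int" where
  "box_res p a = (\<lambda>(r, c). (int c - int r + a) mod int p)"


section \<open>Idempotent diagrams\<close>

text \<open>
  A solid or red string is a pair (position, residue).  \<open>shift D i\<close> is the ghost shift of the edge
  \<open>i \<rightarrow> i + 1\<close>; the ghosts are determined by the solid strings.
\<close>

record diagram =
  modulus :: nat
  shift :: "int \<Rightarrow> real"
  solids :: "(real \<times> int) set"
  reds :: "(real \<times> int) set"

datatype kind = Solid | Ghost | Red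

text \<open>All strings, as (position, kind, residue).\<close>

definition strands :: "diagram \<Rightarrow> (real \<times> kind \<times> int) set" where
  "strands D =
     {(x, Solid, i) | x i. (x, i) \<in> solids D} \<union>
     {(x + shift D i, Ghost, i) | x i. (x, i) \<in> solids D} \<union>
     {(x, Red, i) | x i. (x, i) \<in> reds D}"

definition idempotent_diagram :: "diagram \<Rightarrow> bool" where
  "idempotent_diagram D \<longleftrightarrow>
     2 \<le> modulus D \<and>
     (\<forall>i\<in>{0..<int (modulus D)}. shift D i > 0) \<and>
     finite (solids D) \<and> snd ` solids D \<subseteq> {0..<int (modulus D)} \<and>
     finite (reds D) \<and> snd ` reds D \<subseteq> {0..<int (modulus D)} \<and>
     inj_on fst (strands D)"

text \<open>
  Equality of idempotent diagrams: \<open>\<gamma> s u\<close> is the position at time \<open>u\<close> of the solid string that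
  starts as \<open>s\<close>.  The three inequalities are the forbidden collisions; everything else may cross.
\<close>

definition same_idempotent :: "diagram \<Rightarrow> diagram \<Rightarrow> bool" where
  "same_idempotent D D' \<longleftrightarrow>
     idempotent_diagram D \<and> idempotent_diagram D' \<and>
     modulus D' = modulus D \<and>
     (\<forall>i\<in>{0..<int (modulus D)}. shift D' i = shift D i) \<and>
     reds D' = reds D \<and>
     (\<exists>\<gamma> :: real \<times> int \<Rightarrow> real \<Rightarrow> real.
        (\<forall>s\<in>solids D. continuous_on {0..1} (\<gamma> s) \<and> \<gamma> s 0 = fst s) \<and>
        bij_betw (\<lambda>s. (\<gamma> s 1, snd s)) (solids D) (solids D') \<and>
        (\<forall>u\<in>{0..1}.
           (\<forall>s\<in>solids D. \<forall>s'\<in>solids D. s \<noteq> s' \<and> snd s = snd s' \<longrightarrow> \<gamma> s u \<noteq> \<gamma> s' u) \<and>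
           (\<forall>s\<in>solids D. \<forall>s'\<in>solids D. snd s' = (snd s + 1) mod int (modulus D) \<longrightarrow>
              \<gamma> s u + shift D (snd s) \<noteq> \<gamma> s' u) \<and>
           (\<forall>s\<in>solids D. \<forall>q\<in>reds D. snd q = snd s \<longrightarrow> \<gamma> s u \<noteq> fst q)))"

definition same_order :: "diagram \<Rightarrow> diagram \<Rightarrow> bool" where
  "same_order D D' \<longleftrightarrow>
     (\<exists>f. bij_betw f (strands D) (strands D') \<and>
          (\<forall>s\<in>strands D. snd (f s) = snd s) \<and>
          (\<forall>s\<in>strands D. \<forall>s'\<in>strands D. fst s < fst s' \<longleftrightarrow> fst (f s) < fst (f s')))"


section \<open>The diagram of a multipartition\<close>

definition asymptotic :: "nat \<Rightarrow> nat \<Rightarrow> (nat \<Rightarrow> int) \<Rightarrow> bool" where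
  "asymptotic n l \<kappa> \<longleftrightarrow> (\<forall>m. 1 \<le> m \<and> m < l \<longrightarrow> \<kappa> (Suc m) - \<kappa> m > 4 * int n + 2)"

definition lhat :: "nat \<Rightarrow> nat \<Rightarrow> (nat \<Rightarrow> nat \<Rightarrow> nat) \<Rightarrow> nat" where
  "lhat p l lam = l + msize l lam * p"

definition node_pos ::
    "nat \<Rightarrow> nat \<Rightarrow> (nat \<Rightarrow> int) \<Rightarrow> real \<Rightarrow> (nat \<Rightarrow> nat \<Rightarrow> nat) \<Rightarrow> nat \<times> nat \<times> nat \<Rightarrow> real" where
  "node_pos p l \<kappa> \<delta> lam = (\<lambda>(m, r, c).
     real_of_int (\<kappa> m) + (real c - real r) - real m / real (lhat p l lam) - (real c + real r) * \<delta>)"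

definition unit_diagram ::
    "nat \<Rightarrow> nat \<Rightarrow> (nat \<Rightarrow> int) \<Rightarrow> (nat \<Rightarrow> int) \<Rightarrow> real \<Rightarrow> (nat \<Rightarrow> nat \<Rightarrow> nat) \<Rightarrow> diagram" where
  "unit_diagram p l \<kappa> \<rho> \<delta> lam =
     \<lparr> modulus = p,
       shift = (\<lambda>_. 1),
       solids = (\<lambda>(m, r, c). (node_pos p l \<kappa> \<delta> lam (m, r, c), box_res p (\<rho> m) (r, c))) ` nodes l lam,
       reds = (\<lambda>m. (real_of_int (\<kappa> m), \<rho> m)) ` {1..l} \<rparr>"

text \<open>The admissible range of \<open>\<delta>\<close>.\<close>

definition small_delta :: "nat \<Rightarrow> nat \<Rightarrow> (nat \<Rightarrow> nat \<Rightarrow> nat) \<Rightarrow> real \<Rightarrow> bool" where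
  "small_delta p l lam \<delta> \<longleftrightarrow> 0 < \<delta> \<and> \<delta> < 1 / (2 * real (msize l lam) * real (lhat p l lam))"


section \<open>The subdivision map at the edge from 0 to 1\<close>

text \<open>
  Close tuples are listed from right to left, so that the starting residue is that of the head.
  Listing in a fixed direction also excludes going back and forth between two strings.
\<close>

definition close_tuple :: "real \<Rightarrow> diagram \<Rightarrow> (real \<times> kind \<times> int) list \<Rightarrow> bool" where
  "close_tuple \<delta> D ss \<longleftrightarrow>
     ss \<noteq> [] \<and>
     (\<forall>s\<in>set ss. s \<in> strands D \<and> (snd s = (Ghost, 0) \<or> snd s = (Solid, 1))) \<and>
     (\<forall>j. Suc j < length ss \<longrightarrow>
        snd (ss ! Suc j) \<noteq> snd (ss ! j) \<and> fst (ss ! j) - fst (ss ! Suc j) = \<delta>)"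

definition maximal_close_tuple :: "real \<Rightarrow> diagram \<Rightarrow> (real \<times> kind \<times> int) list \<Rightarrow> bool" where
  "maximal_close_tuple \<delta> D ss \<longleftrightarrow>
     close_tuple \<delta> D ss \<and> (\<forall>us vs. close_tuple \<delta> D (us @ ss @ vs) \<longrightarrow> us = [] \<and> vs = [])"

text \<open>Positions of the ghost 0-strings whose maximal close tuple has starting residue \<open>i\<close>.\<close>

definition ghosts0 :: "real \<Rightarrow> diagram \<Rightarrow> int \<Rightarrow> real set" where
  "ghosts0 \<delta> D i =
     {x. (x, Ghost, 0) \<in> strands D \<and>
         (\<exists>ss. maximal_close_tuple \<delta> D ss \<and> (x, Ghost, 0) \<in> set ss \<and> snd (snd (hd ss)) = i)}"

definition raise_res :: "int \<Rightarrow> int" where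
  "raise_res j = (if j = 0 then 0 else j + 1)"

definition subdiv_shift :: "real \<Rightarrow> int \<Rightarrow> real" where
  "subdiv_shift \<epsilon> i = (if i = 1 then \<epsilon> else 1)"

text \<open>Only meant for diagrams with unit ghost shifts.\<close>

definition subdivide :: "real \<Rightarrow> real \<Rightarrow> real \<Rightarrow> diagram \<Rightarrow> diagram" where
  "subdivide \<delta> t \<epsilon> D =
     \<lparr> modulus = modulus D + 1,
       shift = subdiv_shift \<epsilon>,
       solids = (\<lambda>(x, i). (x, raise_res i)) ` solids D \<union>
                (\<lambda>x. (x - t, 1)) ` ghosts0 \<delta> D 0 \<union>
                (\<lambda>x. (x + t, 1)) ` ghosts0 \<delta> D 1,
       reds = (\<lambda>(x, i). (x, raise_res i)) ` reds D \<rparr>"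

text \<open>
  \<open>D\<close> is a diagram \<open>1\<^sub>\<nu>\<close> in the subdivided setting with modulus \<open>p\<close>.  The actual
  positions are not prescribed, only the order of the strings; hence a predicate.
\<close>

definition subdivided_idempotent ::
    "nat \<Rightarrow> nat \<Rightarrow> (nat \<Rightarrow> int) \<Rightarrow> (nat \<Rightarrow> int) \<Rightarrow> real \<Rightarrow> real \<Rightarrow> (nat \<Rightarrow> nat \<Rightarrow> nat) \<Rightarrow> diagram \<Rightarrow> bool" where
  "subdivided_idempotent p l \<kappa> \<rho> \<epsilon> \<delta> nu D \<longleftrightarrow>
     idempotent_diagram D \<and>
     modulus D = p \<and>
     shift D = subdiv_shift \<epsilon> \<and>
     reds D = reds (unit_diagram p l \<kappa> \<rho> \<delta> nu) \<and>
     same_order (unit_diagram p l \<kappa> \<rho> \<delta> nu) D"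


section \<open>The box construction\<close>

definition strip :: "nat \<Rightarrow> int \<Rightarrow> (nat \<Rightarrow> nat) \<Rightarrow> (nat \<times> nat) list \<Rightarrow> bool" where
  "strip p a mu As \<longleftrightarrow>
     As \<noteq> [] \<and>
     (\<forall>A\<in>set As. A \<in> boxes mu \<and> box_res p a A \<in> {0, 1}) \<and>
     (\<forall>j. Suc j < length As \<longrightarrow>
        As ! Suc j = (case As ! j of (r, c) \<Rightarrow>
          if box_res p a (r, c) = 0 then (r, Suc c) else (Suc r, c)))"

definition maximal_strip :: "nat \<Rightarrow> int \<Rightarrow> (nat \<Rightarrow> nat) \<Rightarrow> (nat \<times> nat) list \<Rightarrow> bool" where
  "maximal_strip p a mu As \<longleftrightarrow>
     strip p a mu As \<and> (\<forall>Us Vs. strip p a mu (Us @ As @ Vs) \<longrightarrow> Us = [] \<and> Vs = [])"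

text \<open>The 0-nodes lying in maximal strips that start with the residue \<open>i\<close>.\<close>

definition zero_nodes :: "nat \<Rightarrow> int \<Rightarrow> (nat \<Rightarrow> nat) \<Rightarrow> int \<Rightarrow> (nat \<times> nat) set" where
  "zero_nodes p a mu i =
     {A. box_res p a A = 0 \<and>
         (\<exists>As. maximal_strip p a mu As \<and> A \<in> set As \<and> box_res p a (hd As) = i)}"

definition new_place :: "nat \<Rightarrow> int \<Rightarrow> (nat \<Rightarrow> nat) \<Rightarrow> nat \<times> nat \<Rightarrow> nat \<times> nat" where
  "new_place p a mu = (\<lambda>(r, c).
     (r + card {r'. r' \<le> r \<and> (r', c) \<in> zero_nodes p a mu 1},
      c + card {c'. c' < c \<and> (r, c') \<in> zero_nodes p a mu 0}))"

definition plus_boxes :: "nat \<Rightarrow> int \<Rightarrow> (nat \<Rightarrow> nat) \<Rightarrow> (nat \<times> nat) set" where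
  "plus_boxes p a mu =
     new_place p a mu ` boxes mu \<union>
     (\<lambda>A. case new_place p a mu A of (r, c) \<Rightarrow> (r, c + 1)) ` zero_nodes p a mu 0 \<union>
     (\<lambda>A. case new_place p a mu A of (r, c) \<Rightarrow> (r - 1, c)) ` zero_nodes p a mu 1"

text \<open>
  The multipartition is read off from its boxes by row lengths.  That the boxes really form the
  diagram of a partition is not built in.
\<close>

definition lam_plus ::
    "nat \<Rightarrow> (nat \<Rightarrow> int) \<Rightarrow> (nat \<Rightarrow> nat \<Rightarrow> nat) \<Rightarrow> nat \<Rightarrow> nat \<Rightarrow> nat" where
  "lam_plus p \<rho> lam m r = card {c. (r, c) \<in> plus_boxes p (\<rho> m) (lam m)}"

end

theory Submission
  imports Defs
begin

text \<open>
  Everything is read in diagonal coordinates.  A box \<open>(r, c)\<close> is determined by its content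
  \<open>d = c - r\<close> and by \<open>q = min r c\<close>, its place on the diagonal of that content, and
  \<open>r + c = 2 q + \<bar>d\<bar>\<close>.

  A strip zigzags along two neighbouring diagonals, of contents \<open>j\<close> and \<open>j + 1\<close> with \<open>j\<close> of
  residue 0.  Since a Young diagram is closed upwards and to the left, a maximal strip begins on its
  border: in the first row, hence with residue 0, if \<open>j \<ge> 0\<close>, and in the first column, hence with
  residue 1, if \<open>j < 0\<close> (\<open>zero_nodes_content\<close>).  So the displacement of a box depends on its
  content alone, and the box construction fixes every \<open>q\<close> and only relabels diagonals: behind each
  diagonal of residue 0 it inserts a copy of that diagonal (\<open>plus_boxes_source\<close>).  The relabelling
  of contents grows in steps of 0 or 1 and fixes 0 and -1, which makes the new set of boxes the
  diagram of a partition (\<open>plus_boxes_partition\<close>).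

  In the diagram of a multipartition the strings gather in columns.  Column \<open>k\<close> of component \<open>m\<close>
  lies in the unit interval to the left of \<open>\<kappa> m + k\<close>; it consists of the solid strings of content \<open>k\<close> and the
  ghosts of content \<open>k - 1\<close>, sorted by decreasing \<open>r + c\<close>, and the red string separates column 0
  from column 1.  Thus the order of the strings is the lexicographic order of component, column and
  \<open>- (r + c)\<close> (\<open>string_less_iff\<close>).  Close tuples are the traces of the strips in a column, so a
  new solid string appears to the left of its ghost if the content of the node is nonnegative, and to the
  right otherwise (\<open>ghosts0_iff\<close>); this agrees with the new box being to the right of its 0-node,
  with larger \<open>r + c\<close>, in the first case, and above it, with smaller \<open>r + c\<close>, in the second.

  Two idempotent diagrams are equal as soon as a bijection of solid strings respects the
  residues and the order of the pairs that must not cross: moving every string at constant speed to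
  its goal then never makes such a pair meet, because a convex combination of two numbers of the
  same sign is not zero (\<open>same_idempotent_by_interpolation\<close>).  Both diagrams are indexed by the
  nodes of the enlarged multipartition.  The order of the pairs in question is computed from diagonal
  coordinates in \<open>new_solid_order\<close>, \<open>new_ghost_order\<close> and \<open>new_red_order\<close> for the subdivided diagram
  and in \<open>layout_order\<close> for the unit diagram, with the same result.  The displacement by \<open>t\<close>
  is harmless because \<open>t + \<epsilon> < \<delta>\<close> as soon as the component has two boxes
  (\<open>t_less_delta\<close>).

  Finally, the unit diagram of the enlarged multipartition can be deformed to the required ghost
  shifts by pushing every column of residue 2 to distance \<open>\<epsilon>\<close> of the column of residue 1 before it; the
  columns stay in order, hence so do the strings (\<open>subdivided_idempotent_exists\<close>).
\<close>

section \<open>Relabelling residues on the integers\<close>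

text \<open>
  The strictly increasing lift to the integers of the relabelling \<open>raise_res\<close> of residues modulo
  \<open>p\<close> by residues modulo \<open>p + 1\<close>; it misses exactly the integers of residue 1.
\<close>

definition stretch :: "nat \<Rightarrow> int \<Rightarrow> int" where
  "stretch p N = N div int p * int (p + 1) + raise_res (N mod int p)"

text \<open>
  The left inverse of \<open>stretch\<close> that gives an integer of residue 1 the value of its predecessor:
  it stands still after residue 0 and has slope 1 elsewhere.
\<close>

definition squeeze :: "nat \<Rightarrow> int \<Rightarrow> int" where
  "squeeze p M = M div int (p + 1) * int p + max 0 (M mod int (p + 1) - 1)"

lemma div_mod_Suc:
  fixes M q :: int
  assumes "q > 0"
  shows "(M + 1) div q = (if M mod q = q - 1 then M div q + 1 else M div q)"
    and "(M + 1) mod q = (if M mod q = q - 1 then 0 else M mod q + 1)"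
proof -
  have b: "0 \<le> M mod q" "M mod q < q" using assms by auto
  have M: "M = q * (M div q) + M mod q" by simp
  have *: "(M + 1) div q = (if M mod q = q - 1 then M div q + 1 else M div q) \<and>
     (M + 1) mod q = (if M mod q = q - 1 then 0 else M mod q + 1)"
  proof (cases "M mod q = q - 1")
    case True
    then have "M + 1 = q * (M div q + 1) + 0" using M by (simp only: distrib_left)
    then show ?thesis using int_div_pos_eq[of "M + 1" q _ 0] int_mod_pos_eq[of "M + 1" q _ 0]
        True assms by simp
  next
    case False
    then have "M mod q + 1 < q" using b by linarith
    moreover have "M + 1 = q * (M div q) + (M mod q + 1)" using M by linarith
    ultimately show ?thesis
      using int_div_pos_eq[of "M + 1" q "M div q" "M mod q + 1"]
        int_mod_pos_eq[of "M + 1" q "M div q" "M mod q + 1"] False b by simp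
  qed
  show "(M + 1) div q = (if M mod q = q - 1 then M div q + 1 else M div q)"
    and "(M + 1) mod q = (if M mod q = q - 1 then 0 else M mod q + 1)"
    using * by blast+
qed

lemma squeeze_Suc:
  assumes "p \<ge> 1"
  shows "squeeze p (M + 1) = squeeze p M + (if M mod int (p + 1) = 0 then 0 else 1)"
proof -
  define q where "q = int (p + 1)"
  have q: "q > 0" "int p = q - 1" "q \<ge> 2" using assms by (auto simp: q_def)
  have b: "M mod q = 0 \<or> 1 \<le> M mod q" using pos_mod_sign[of q M] q by linarith
  show ?thesis
    unfolding squeeze_def q_def[symmetric] div_mod_Suc[OF q(1), of M]
    using q b by (auto simp: algebra_simps max_def)
qed

lemma squeeze_period: "squeeze p (M + k * int (p + 1)) = squeeze p M + k * int p"
proof -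
  have "int (p + 1) \<noteq> 0" by simp
  then have "(M + k * int (p + 1)) div int (p + 1) = k + M div int (p + 1)"
    by (rule div_mult_self1)
  moreover have "(M + k * int (p + 1)) mod int (p + 1) = M mod int (p + 1)"
    by (rule mod_mult_self1)
  ultimately show ?thesis unfolding squeeze_def by (simp only: distrib_right)
qed

lemma squeeze_mono:
  assumes "p \<ge> 1" "M \<le> M'"
  shows "squeeze p M \<le> squeeze p M'"
  using assms(2)
proof (induction rule: int_ge_induct)
  case (step i) then show ?case using squeeze_Suc[OF assms(1), of i] by (auto split: if_splits)
qed simp

lemma stretch_div_mod:
  assumes "p \<ge> 1"
  shows "stretch p N mod int (p + 1) = raise_res (N mod int p)"
    and "stretch p N div int (p + 1) = N div int p"
proof -
  have b: "0 \<le> N mod int p" "N mod int p < int p" using assms by auto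
  have r: "0 \<le> raise_res (N mod int p)" "raise_res (N mod int p) < int (p + 1)"
    using b by (auto simp: raise_res_def)
  have e: "stretch p N = int (p + 1) * (N div int p) + raise_res (N mod int p)"
    by (simp add: stretch_def algebra_simps)
  show "stretch p N mod int (p + 1) = raise_res (N mod int p)" 
    using int_mod_pos_eq[OF e r] .
  show "stretch p N div int (p + 1) = N div int p"
    using int_div_pos_eq[OF e r] .
qed

lemma squeeze_stretch:
  assumes "p \<ge> 1"
  shows "squeeze p (stretch p N) = N"
proof -
  have b: "0 \<le> N mod int p" using assms by auto
  have "max 0 (raise_res (N mod int p) - 1) = N mod int p" using b by (auto simp: raise_res_def)
  then show ?thesis unfolding squeeze_def stretch_div_mod[OF assms] by simp
qed

lemma squeeze_div_mod:
  assumes "p \<ge> 1"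
  shows "squeeze p M div int p = M div int (p + 1)"
    and "squeeze p M mod int p = max 0 (M mod int (p + 1) - 1)"
proof -
  have b: "0 \<le> M mod int (p + 1)" "M mod int (p + 1) < int (p + 1)" by auto
  have r: "0 \<le> max 0 (M mod int (p + 1) - 1)" "max 0 (M mod int (p + 1) - 1) < int p"
    using b assms by (auto simp del: pos_mod_bound pos_mod_sign)
  have e: "squeeze p M = int p * (M div int (p + 1)) + max 0 (M mod int (p + 1) - 1)"
    by (simp add: squeeze_def algebra_simps)
  show "squeeze p M mod int p = max 0 (M mod int (p + 1) - 1)"
    using int_mod_pos_eq[OF e r] .
  show "squeeze p M div int p = M div int (p + 1)"
    using int_div_pos_eq[OF e r] .
qed

lemma stretch_squeeze:
  assumes "p \<ge> 1"
  shows "stretch p (squeeze p M) = (if M mod int (p + 1) = 1 then M - 1 else M)"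
proof -
  have b: "M mod int (p + 1) = 0 \<or> 1 \<le> M mod int (p + 1)"
    using pos_mod_sign[of "int (p + 1)" M] by linarith
  have M: "M = M div int (p + 1) * int (p + 1) + M mod int (p + 1)" by (metis div_mult_mod_eq)
  have "raise_res (max 0 (M mod int (p + 1) - 1)) =
      (if M mod int (p + 1) = 1 then 0 else M mod int (p + 1))"
    using b by (auto simp: raise_res_def max_def)
  then show ?thesis unfolding stretch_def squeeze_div_mod[OF assms] using M by auto
qed

lemma stretch_Suc:
  assumes "p \<ge> 1"
  shows "stretch p (N + 1) = stretch p N + 1 + (if N mod int p = 0 then 1 else 0)"
proof -
  have b: "0 \<le> N mod int p" "N mod int p < int p" using assms by auto
  have q: "int p > 0" using assms by simp
  show ?thesis
    unfolding stretch_def div_mod_Suc[OF q] raise_res_def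
    using assms b by (auto simp: algebra_simps)
qed

lemma stretch_small: "0 \<le> a \<Longrightarrow> a < int p \<Longrightarrow> stretch p a = raise_res a"
  by (simp add: stretch_def)

section \<open>Diagonal coordinates of boxes\<close>

definition content :: "nat \<times> nat \<Rightarrow> int" where
  "content = (\<lambda>(r, c). int c - int r)"

definition diag_box :: "nat \<Rightarrow> int \<Rightarrow> nat \<times> nat" where
  "diag_box q d = (q + nat (- d), q + nat d)"

lemma content_diag_box [simp]: "content (diag_box q d) = d"
  by (simp add: content_def diag_box_def)

lemma min_diag_box [simp]: "min (fst (diag_box q d)) (snd (diag_box q d)) = q"
  by (auto simp: diag_box_def min_def)

lemma diag_box_coords [simp]: "diag_box (min (fst A) (snd A)) (content A) = A"
  by (cases A) (auto simp: diag_box_def content_def min_def)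

lemma box_res_content: "box_res p a A = (content A + a) mod int p"
  by (cases A) (simp add: box_res_def content_def)

lemma finite_boxes:
  assumes "partition mu"
  shows "finite (boxes mu)"
proof -
  have "boxes mu \<subseteq> Sigma {r. mu r \<noteq> 0} (\<lambda>r. {..mu r})" by (auto simp: boxes_def)
  moreover have "finite (Sigma {r. mu r \<noteq> 0} (\<lambda>r. {..mu r}))"
    using assms by (auto simp: partition_def)
  ultimately show ?thesis by (rule finite_subset)
qed

lemma partition_antimono:
  assumes "partition mu" "1 \<le> r" "r \<le> r'"
  shows "mu r' \<le> mu r"
  using assms(3)
proof (induction rule: dec_induct)
  case (step k) then show ?case using assms(1,2) unfolding partition_def
    by (meson le_trans)
qed simp

lemma boxes_down_closed:
  assumes "partition mu" "(r', c') \<in> boxes mu" "1 \<le> r" "r \<le> r'" "1 \<le> c" "c \<le> c'"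
  shows "(r, c) \<in> boxes mu"
  using partition_antimono[OF assms(1,3,4)] assms by (auto simp: boxes_def)

text \<open>
  Down-closedness only has to be tested for single steps to the left and upwards.
\<close>

lemma boxes_of_down_closed_set:
  fixes S :: "(nat \<times> nat) set"
  assumes fin: "finite S" and pos: "\<And>r c. (r, c) \<in> S \<Longrightarrow> 1 \<le> r \<and> 1 \<le> c"
    and left: "\<And>r c. (r, Suc c) \<in> S \<Longrightarrow> 1 \<le> c \<Longrightarrow> (r, c) \<in> S"
    and up: "\<And>r c. (Suc r, c) \<in> S \<Longrightarrow> 1 \<le> r \<Longrightarrow> (r, c) \<in> S"
  shows "partition (\<lambda>r. card {c. (r, c) \<in> S})"
    and "boxes (\<lambda>r. card {c. (r, c) \<in> S}) = S"
proof -
  have finr: "finite {c. (r, c) \<in> S}" for r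
  proof -
    have "{c. (r, c) \<in> S} = Pair r -` S" by auto
    then show ?thesis using finite_vimageI[OF fin, of "Pair r"] by (simp add: inj_on_def)
  qed
  have left': "(r, c) \<in> S" if "(r, c') \<in> S" "1 \<le> c" "c \<le> c'" for r c c'
    using that(3,1)
  proof (induction rule: dec_induct)
    case (step k) then show ?case using left[of r k] that(2) by auto
  qed simp
  have row: "{c. (r, c) \<in> S} = {1..card {c. (r, c) \<in> S}}" for r
  proof (cases "{c. (r, c) \<in> S} = {}")
    case True then show ?thesis by simp
  next
    case False
    define M where "M = Max {c. (r, c) \<in> S}"
    \<comment> \<open>A nonempty row is an initial segment, so its length is its last column.\<close>
    have M: "(r, M) \<in> S" using Max_in[OF finr False] by (simp add: M_def)
    have "c \<le> M" if "(r, c) \<in> S" for c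
      unfolding M_def using that finr by (intro Max_ge) auto
    then have "c \<in> {1..M}" if "(r, c) \<in> S" for c using pos[OF that] that by simp
    moreover have "(r, c) \<in> S" if "c \<in> {1..M}" for c
      using left'[OF M] that by simp
    ultimately have "{c. (r, c) \<in> S} = {1..M}" by blast
    then show ?thesis by simp
  qed
  show "boxes (\<lambda>r. card {c. (r, c) \<in> S}) = S"
  proof -
    have "(r, c) \<in> boxes (\<lambda>r. card {c. (r, c) \<in> S}) \<longleftrightarrow> (r, c) \<in> S" for r c
    proof -
      have "(r, c) \<in> boxes (\<lambda>r. card {c. (r, c) \<in> S}) \<longleftrightarrow> 1 \<le> r \<and> c \<in> {1..card {c. (r, c) \<in> S}}"
        by (auto simp: boxes_def)
      also have "\<dots> \<longleftrightarrow> (r, c) \<in> S" using row[of r] pos[of r c] by blast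
      finally show ?thesis .
    qed
    then show ?thesis by auto
  qed
  show "partition (\<lambda>r. card {c. (r, c) \<in> S})"
    unfolding partition_def
  proof (intro conjI allI impI)
    have "{c. (0, c) \<in> S} = {}" using pos[of 0] by auto
    then show "card {c. (0, c) \<in> S} = 0" by simp
    show "card {c. (Suc r, c) \<in> S} \<le> card {c. (r, c) \<in> S}" if "1 \<le> r" for r
      using up that by (intro card_mono finr) auto
    have "{r. card {c. (r, c) \<in> S} \<noteq> 0} \<subseteq> fst ` S"
    proof
      fix r assume "r \<in> {r. card {c. (r, c) \<in> S} \<noteq> 0}"
      then obtain c where "(r, c) \<in> S" by (auto simp: card_eq_0_iff)
      then show "r \<in> fst ` S" by (rule image_eqI[rotated]) simp
    qed
    then show "finite {r. card {c. (r, c) \<in> S} \<noteq> 0}" using fin finite_subset by blast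
  qed
qed

section \<open>How a maximal chain starts\<close>

text \<open>
  Strips and close tuples are instances of one notion, with the set of admissible members as \<open>S\<close>.
\<close>

definition chain :: "('a \<Rightarrow> 'a \<Rightarrow> bool) \<Rightarrow> 'a set \<Rightarrow> 'a list \<Rightarrow> bool" where
  "chain R S xs \<longleftrightarrow> xs \<noteq> [] \<and> set xs \<subseteq> S \<and> (\<forall>j. Suc j < length xs \<longrightarrow> R (xs ! j) (xs ! Suc j))"

definition maximal_chain :: "('a \<Rightarrow> 'a \<Rightarrow> bool) \<Rightarrow> 'a set \<Rightarrow> 'a list \<Rightarrow> bool" where
  "maximal_chain R S xs \<longleftrightarrow>
     chain R S xs \<and> (\<forall>us vs. chain R S (us @ xs @ vs) \<longrightarrow> us = [] \<and> vs = [])"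

text \<open>
  A function that increases along links excludes repetitions; this is what makes maximal chains exist.
\<close>

lemma chain_length_le:
  fixes f :: "'a \<Rightarrow> real"
  assumes "finite S" and mono: "\<And>x y. x \<in> S \<Longrightarrow> y \<in> S \<Longrightarrow> R x y \<Longrightarrow> f x < f y"
    and "chain R S xs"
  shows "length xs \<le> card S"
proof -
  have sub: "set xs \<subseteq> S" using assms(3) by (simp add: chain_def)
  have step: "f (xs ! j) < f (xs ! Suc j)" if "Suc j < length xs" for j
  proof (rule mono)
    show "xs ! j \<in> S" "xs ! Suc j \<in> S" using sub that by (auto simp: subset_iff)
    show "R (xs ! j) (xs ! Suc j)" using assms(3) that by (simp add: chain_def)
  qed
  have less: "f (xs ! i) < f (xs ! (i + Suc k))" if "i + Suc k < length xs" for i k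
    using that
  proof (induction k)
    case 0 then show ?case using step[of i] by simp
  next
    case (Suc k) then show ?case using step[of "i + Suc k"] by simp
  qed
  have ne: "xs ! i \<noteq> xs ! j" if "i < j" "j < length xs" for i j
    using less[of i "j - Suc i"] that by auto
  have "distinct xs" unfolding distinct_conv_nth
  proof (intro allI impI)
    fix i j assume "i < length xs" "j < length xs" "i \<noteq> j"
    then show "xs ! i \<noteq> xs ! j" using ne[of i j] ne[of j i] by (cases "i < j") auto
  qed
  then have "card (set xs) = length xs" by (rule distinct_card)
  then show ?thesis using card_mono[OF assms(1) sub] by simp
qed

text \<open>
  A property \<open>I\<close> that is invariant under links can be read off at the head of a maximal chain, and
  nothing precedes the head; \<open>T\<close> is the shape that \<open>I\<close> takes at such an initial element.  For strips
  and close tuples, \<open>T\<close> says that the head has residue 0 and \<open>I\<close> that the chain runs along the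
  diagonals of contents \<open>j\<close> and \<open>j + 1\<close> for some \<open>j \<ge> 0\<close>.
\<close>

lemma start_of_maximal_chain:
  fixes f :: "'a \<Rightarrow> real"
  assumes fin: "finite S" and mono: "\<And>x y. x \<in> S \<Longrightarrow> y \<in> S \<Longrightarrow> R x y \<Longrightarrow> f x < f y"
    and inv: "\<And>x y. x \<in> S \<Longrightarrow> y \<in> S \<Longrightarrow> R x y \<Longrightarrow> I x \<longleftrightarrow> I y"
    and start: "\<And>x. x \<in> S \<Longrightarrow> (\<And>y. y \<in> S \<Longrightarrow> \<not> R y x) \<Longrightarrow> I x \<longleftrightarrow> T x"
    and x: "x \<in> S"
  shows "(\<exists>xs. maximal_chain R S xs \<and> x \<in> set xs \<and> (T (hd xs) \<longleftrightarrow> b)) \<longleftrightarrow> (I x \<longleftrightarrow> b)"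
proof -
  have same: "T (hd xs) \<longleftrightarrow> I x" if m: "maximal_chain R S xs" and xs: "x \<in> set xs" for xs
  proof -
    have ch: "chain R S xs" using m by (simp add: maximal_chain_def)
    then have ne: "xs \<noteq> []" and sub: "set xs \<subseteq> S" and
      steps: "\<And>j. Suc j < length xs \<Longrightarrow> R (xs ! j) (xs ! Suc j)"
      unfolding chain_def by simp_all
    have maxl: "us = [] \<and> vs = []" if "chain R S (us @ xs @ vs)" for us vs
      using m that unfolding maximal_chain_def by simp
    have hS: "hd xs \<in> S" using hd_in_set[OF ne] sub by (rule subsetD[rotated])
    have "\<not> R y (hd xs)" if y: "y \<in> S" for y
    proof
      assume R: "R y (hd xs)"
      have "R ((y # xs) ! j) ((y # xs) ! Suc j)" if "Suc j < length (y # xs)" for j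
        using that R steps ne by (cases j) (simp_all add: hd_conv_nth)
      then have "chain R S ([y] @ xs @ [])" using y sub by (simp add: chain_def)
      from maxl[OF this] show False by simp
    qed
    then have 1: "I (hd xs) \<longleftrightarrow> T (hd xs)" by (rule start[OF hS])
    have 2: "I (xs ! j) \<longleftrightarrow> I (hd xs)" if "j < length xs" for j
      using that
    proof (induction j)
      case 0 then show ?case using ne by (simp add: hd_conv_nth)
    next
      case (Suc j)
      then have "xs ! j \<in> S" "xs ! Suc j \<in> S" using sub by (simp_all add: subset_iff)
      then have "I (xs ! j) \<longleftrightarrow> I (xs ! Suc j)" using steps[OF Suc.prems] by (rule inv)
      then show ?case using Suc by simp
    qed
    obtain j where "j < length xs" "x = xs ! j" using xs by (auto simp: in_set_conv_nth)
    then show ?thesis using 1 2 by simp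
  qed
  have "\<exists>xs. maximal_chain R S xs \<and> x \<in> set xs"
  proof -
    define P where "P xs \<longleftrightarrow> chain R S xs \<and> x \<in> set xs" for xs
    have P0: "P [x]" using x by (simp add: P_def chain_def)
    have bound: "\<forall>ys. P ys \<longrightarrow> length ys < Suc (card S)"
    proof (intro allI impI)
      fix ys assume "P ys"
      then have "chain R S ys" by (simp add: P_def)
      with fin mono have "length ys \<le> card S" by (rule chain_length_le[where f = f and R = R])
      then show "length ys < Suc (card S)" by simp
    qed
    obtain xs where xs: "P xs" "\<And>ys. P ys \<Longrightarrow> length ys \<le> length xs"
      using ex_has_greatest_nat[of P "[x]" length "Suc (card S)", OF P0 bound] by auto
    have "us = [] \<and> vs = []" if "chain R S (us @ xs @ vs)" for us vs
      using xs(2)[of "us @ xs @ vs"] that xs(1) by (simp add: P_def)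
    then have "maximal_chain R S xs" "x \<in> set xs"
      using xs(1) by (simp_all add: maximal_chain_def P_def)
    then show ?thesis by (intro exI conjI)
  qed
  then obtain xs where "maximal_chain R S xs" "x \<in> set xs" by blast
  then show ?thesis using same by metis
qed

section \<open>The box construction in diagonal coordinates\<close>

text \<open>
  The relabelling of diagonals of one component with charge \<open>a\<close>, from contents after to contents
  before the construction.  The translations by \<open>a\<close> and \<open>raise_res a\<close> turn contents into representatives of
  residues.
\<close>

definition old_content :: "nat \<Rightarrow> int \<Rightarrow> int \<Rightarrow> int" where
  "old_content p a D = squeeze p (D + raise_res a) - a"

text \<open>
  Where a box of the enlarged diagram comes from: itself moved back if it is old, its 0-node if it is
  new.
\<close>

definition source_box :: "nat \<Rightarrow> int \<Rightarrow> nat \<times> nat \<Rightarrow> nat \<times> nat" where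
  "source_box p a B = diag_box (min (fst B) (snd B)) (old_content p a (content B))"

definition new_content :: "nat \<Rightarrow> int \<Rightarrow> int \<Rightarrow> int" where
  "new_content p a d = stretch p (d + a) - raise_res a"

definition kept_box :: "nat \<Rightarrow> int \<Rightarrow> nat \<times> nat \<Rightarrow> nat \<times> nat" where
  "kept_box p a A = diag_box (min (fst A) (snd A)) (new_content p a (content A))"

definition added_box :: "nat \<Rightarrow> int \<Rightarrow> nat \<times> nat \<Rightarrow> nat \<times> nat" where
  "added_box p a A = diag_box (min (fst A) (snd A)) (new_content p a (content A) + 1)"

locale component =
  fixes p :: nat and a :: int
  assumes p2: "p \<ge> 2" and a0: "0 \<le> a" and ap: "a < int p"
begin

abbreviation "zero_contents x y \<equiv> {j. x \<le> j \<and> j < y \<and> (j + a) mod int p = 0}"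

lemma p1: "p \<ge> 1" using p2 by simp

lemma old_content_0 [simp]: "old_content p a 0 = 0"
  using squeeze_stretch[OF p1, of a] stretch_small[OF a0 ap] by (simp add: old_content_def)

lemma old_content_Suc:
  "old_content p a (D + 1) = old_content p a D + (if (D + raise_res a) mod int (p + 1) = 0 then 0 else 1)"
  using squeeze_Suc[OF p1, of "D + raise_res a"] by (simp add: old_content_def algebra_simps)

lemma raise_res_range: "0 \<le> raise_res a" "raise_res a < int p + 1" "raise_res a \<noteq> 1"
  using a0 ap by (auto simp: raise_res_def)

text \<open>
  Together with the value 0 at 0, this says that the relabelling respects the sign of contents, so that
  the parts of the diagram on both sides of the main diagonal can be treated separately.
\<close>

lemma old_content_m1: "old_content p a (- 1) = - 1"
proof -
  have "(raise_res a - 1) mod int (p + 1) \<noteq> 0"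
  proof (cases "raise_res a = 0")
    case True
    have "(- 1) mod int (p + 1) = int p" by (simp add: zmod_minus1)
    then show ?thesis using True p2 by simp
  next
    case False
    then show ?thesis using raise_res_range by simp
  qed
  then show ?thesis using old_content_Suc[of "- 1"] by (simp split: if_splits)
qed

lemma old_content_mono: "D \<le> D' \<Longrightarrow> old_content p a D \<le> old_content p a D'"
  using squeeze_mono[OF p1] by (simp add: old_content_def)

lemma old_content_period: "old_content p a (D + k * int (p + 1)) = old_content p a D + k * int p"
  using squeeze_period[of p "D + raise_res a" k] by (simp add: old_content_def algebra_simps)

lemma old_content_nonneg: "0 \<le> old_content p a D \<longleftrightarrow> 0 \<le> D"
  using old_content_mono[of 0 D] old_content_mono[of D "- 1"] old_content_m1 by force

lemma old_content_new [simp]: "old_content p a (new_content p a d) = d"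
  by (simp add: old_content_def new_content_def squeeze_stretch[OF p1])

lemma new_content_res:
  "(new_content p a d + raise_res a) mod int (p + 1) = raise_res ((d + a) mod int p)"
  using stretch_div_mod(1)[OF p1, of "d + a"] by (simp add: new_content_def)

lemma new_old_content:
  "new_content p a (old_content p a D) =
    (if (D + raise_res a) mod int (p + 1) = 1 then D - 1 else D)"
  using stretch_squeeze[OF p1, of "D + raise_res a"] by (simp add: new_content_def old_content_def)

lemma old_content_res:
  "(old_content p a D + a) mod int p = max 0 ((D + raise_res a) mod int (p + 1) - 1)"
  using squeeze_div_mod(2)[OF p1, of "D + raise_res a"] by (simp add: old_content_def)

lemma new_content_0 [simp]: "new_content p a 0 = 0"
  by (simp add: new_content_def stretch_small[OF a0 ap])

lemma new_content_Suc:
  "new_content p a (d + 1) = new_content p a d + 1 + (if (d + a) mod int p = 0 then 1 else 0)"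
  using stretch_Suc[OF p1, of "d + a"] by (simp add: new_content_def algebra_simps)

lemma old_content_Suc_new:
  "(d + a) mod int p = 0 \<Longrightarrow> old_content p a (new_content p a d + 1) = d"
  using old_content_Suc[of "new_content p a d"] new_content_res[of d] by (simp add: raise_res_def)

lemma new_content_nonneg: "0 \<le> new_content p a d \<longleftrightarrow> 0 \<le> d"
  using old_content_nonneg[of "new_content p a d"] by simp

text \<open>
  The number of diagonals of residue 0 between the main diagonal and \<open>d\<close> is the displacement that
  the box construction gives to a box of content \<open>d\<close>.
\<close>

lemma new_content_count_right:
  assumes "0 \<le> d"
  shows "new_content p a d = d + int (card (zero_contents 0 d))"
  using assms
proof (induction rule: int_ge_induct)
  case base
  have "zero_contents 0 0 = {}" by auto
  then show ?case by (simp only: card.empty) simp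
next
  case (step d)
  have "zero_contents 0 (d + 1) =
      (if (d + a) mod int p = 0 then insert d else id) (zero_contents 0 d)"
    using step.hyps by (auto simp: order.order_iff_strict)
  moreover have "finite (zero_contents 0 d)"
    by (rule finite_subset[of _ "{0..<d}"]) auto
  ultimately show ?case using step.IH new_content_Suc[of d] by simp
qed

lemma new_content_count_left:
  assumes "d \<le> 0"
  shows "new_content p a d = d - int (card (zero_contents d 0))"
  using assms
proof (induction rule: int_le_induct)
  case base
  have "zero_contents 0 0 = {}" by auto
  then show ?case by (simp only: card.empty) simp
next
  case (step d)
  have "zero_contents (d - 1) 0 =
      (if (d - 1 + a) mod int p = 0 then insert (d - 1) else id)
        (zero_contents d 0)"
    using step.hyps by (auto simp: order.order_iff_strict)
  moreover have "finite (zero_contents d 0)"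
    by (rule finite_subset[of _ "{d..<0}"]) auto
  ultimately show ?case using step.IH new_content_Suc[of "d - 1"] by (simp split: if_splits)
qed

end

lemma strip_chain:
  "strip p a mu As \<longleftrightarrow>
    chain (\<lambda>A B. B = (case A of (r, c) \<Rightarrow> if box_res p a (r, c) = 0 then (r, Suc c) else (Suc r, c)))
      {A \<in> boxes mu. box_res p a A \<in> {0, 1}} As"
  by (auto simp: strip_def chain_def)

lemma maximal_strip_chain:
  "maximal_strip p a mu As \<longleftrightarrow>
    maximal_chain (\<lambda>A B. B = (case A of (r, c) \<Rightarrow> if box_res p a (r, c) = 0 then (r, Suc c) else (Suc r, c)))
      {A \<in> boxes mu. box_res p a A \<in> {0, 1}} As"
  unfolding maximal_strip_def maximal_chain_def strip_chain by simp

context component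
begin

lemma res_next:
  "(x + a) mod int p = 0 \<Longrightarrow> (x + 1 + a) mod int p = 1"
  "(x + a) mod int p = 1 \<Longrightarrow> (x - 1 + a) mod int p = 0"
proof -
  have q: "int p > 0" "int p \<ge> 2" using p2 by auto
  show "(x + a) mod int p = 0 \<Longrightarrow> (x + 1 + a) mod int p = 1"
    using div_mod_Suc(2)[OF q(1), of "x + a"] q by (simp add: algebra_simps)
  show "(x + a) mod int p = 1 \<Longrightarrow> (x - 1 + a) mod int p = 0"
    using div_mod_Suc(2)[OF q(1), of "x - 1 + a"] q
      pos_mod_sign[OF q(1), of "x - 1 + a"] by (simp add: algebra_simps split: if_splits)
qed

text \<open>
  The content of the 0-nodes is constant along a strip and one less than that of its 1-nodes; so the
  content minus the residue is the invariant.  A maximal strip starting with residue 0 cannot be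
  extended upwards, so it starts in row 1 and the invariant is nonnegative; one starting with residue 1
  cannot be extended to the left, so it starts in column 1 and the invariant is negative.
\<close>

lemma zero_nodes_content:
  assumes mu: "partition mu"
  shows "zero_nodes p a mu 0 = {A \<in> boxes mu. box_res p a A = 0 \<and> 0 \<le> content A}" (is ?Z0)
    and "zero_nodes p a mu 1 = {A \<in> boxes mu. box_res p a A = 0 \<and> content A < 0}" (is ?Z1)
proof -
  define R where "R A B \<longleftrightarrow> B = (case A of (r, c) \<Rightarrow>
    if box_res p a (r, c) = 0 then (r, Suc c) else (Suc r, c))" for A B :: "nat \<times> nat"
  define S where "S = {A \<in> boxes mu. box_res p a A \<in> {0, 1}}"
  define I where "I A \<longleftrightarrow> 0 \<le> content A - box_res p a A" for A
  have max: "maximal_strip p a mu As \<longleftrightarrow> maximal_chain R S As" for As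
    unfolding maximal_strip_chain R_def S_def ..
  have main: "(\<exists>As. maximal_chain R S As \<and> A \<in> set As \<and> (box_res p a (hd As) = 0 \<longleftrightarrow> b)) \<longleftrightarrow> (I A \<longleftrightarrow> b)"
    if "A \<in> S" for A b
  proof (rule start_of_maximal_chain[where f = "\<lambda>(r, c). real r + real c"])
    show "finite S" using finite_boxes[OF mu] by (simp add: S_def)
    show "A \<in> S" by fact
    show "(case A of (r, c) \<Rightarrow> real r + real c) < (case B of (r, c) \<Rightarrow> real r + real c)"
      if "R A B" for A B using that by (auto simp: R_def split: prod.splits)
    show "I A \<longleftrightarrow> I B" if AS: "A \<in> S" and "B \<in> S" and AB: "R A B" for A B
    proof -
      obtain r c where A: "A = (r, c)" by (cases A)
      consider "box_res p a A = 0" "B = (r, Suc c)" | "box_res p a A = 1" "B = (Suc r, c)"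
        using AS AB A by (auto simp: R_def S_def split: if_splits)
      then show ?thesis
      proof cases
        case 1
        then have "box_res p a B = 1" using res_next(1)[of "content A"]
          by (simp add: A box_res_content content_def algebra_simps)
        then show ?thesis using 1 by (simp add: I_def A content_def)
      next
        case 2
        then have "box_res p a B = 0" using res_next(2)[of "content A"]
          by (simp add: A box_res_content content_def algebra_simps)
        then show ?thesis using 2 by (simp add: I_def A content_def) linarith
      qed
    qed
    show "I A \<longleftrightarrow> box_res p a A = 0" if A: "A \<in> S" and first: "\<And>B. B \<in> S \<Longrightarrow> \<not> R B A" for A
    proof -
      obtain r c where rc: "A = (r, c)" by (cases A)
      have b: "(r, c) \<in> boxes mu" "1 \<le> r" "1 \<le> c" using A by (auto simp: S_def boxes_def rc)
      consider "box_res p a A = 0" | "box_res p a A = 1" using A by (auto simp: S_def)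
      then show ?thesis
      proof cases
        case 1
        have "r = 1"
        proof (rule ccontr)
          assume "r \<noteq> 1"
          then obtain r' where r': "r = Suc r'" "1 \<le> r'" using b(2) by (cases r) auto
          have res: "box_res p a (r', c) = 1" using res_next(1)[of "content A"] 1
            by (simp add: rc r' box_res_content content_def algebra_simps)
          have "(r', c) \<in> S" using boxes_down_closed[OF mu b(1), of r' c] b r' res by (simp add: S_def)
          then show False using first[of "(r', c)"] by (simp add: R_def res rc r')
        qed
        then show ?thesis using 1 b by (simp add: I_def rc content_def)
      next
        case 2
        have "c = 1"
        proof (rule ccontr)
          assume "c \<noteq> 1"
          then obtain c' where c': "c = Suc c'" "1 \<le> c'" using b(3) by (cases c) auto
          have res: "box_res p a (r, c') = 0" using res_next(2)[of "content A"] 2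
            by (simp add: rc c' box_res_content content_def algebra_simps)
          have "(r, c') \<in> S" using boxes_down_closed[OF mu b(1), of r c'] b c' res by (simp add: S_def)
          then show False using first[of "(r, c')"] by (simp add: R_def res rc c')
        qed
        then show ?thesis using 2 b by (simp add: I_def rc content_def)
      qed
    qed
  qed
  have S: "As \<noteq> [] \<and> set As \<subseteq> S" if "maximal_chain R S As" for As
    using that by (simp add: maximal_chain_def chain_def)
  have hd1: "box_res p a (hd As) = 1 \<longleftrightarrow> (box_res p a (hd As) = 0 \<longleftrightarrow> False)" if "maximal_chain R S As" for As
  proof -
    have "hd As \<in> S" using S[OF that] hd_in_set[of As] by blast
    then show ?thesis by (auto simp: S_def)
  qed
  have mem: "A \<in> S" if "maximal_chain R S As" "A \<in> set As" for A As
    using S[OF that(1)] that(2) by auto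
  have Z: "A \<in> zero_nodes p a mu 0 \<longleftrightarrow> box_res p a A = 0 \<and> A \<in> S \<and> (I A \<longleftrightarrow> True)" for A
  proof (cases "A \<in> S")
    case True
    then show ?thesis unfolding main[OF True, of True, symmetric]
      by (simp add: zero_nodes_def max)
  next
    case False
    then have "A \<notin> set As" if "maximal_chain R S As" for As using mem[OF that] by blast
    then show ?thesis using False by (auto simp: zero_nodes_def max)
  qed
  have Z': "A \<in> zero_nodes p a mu 1 \<longleftrightarrow> box_res p a A = 0 \<and> A \<in> S \<and> (I A \<longleftrightarrow> False)" for A
  proof (cases "A \<in> S")
    case True
    then show ?thesis unfolding main[OF True, of False, symmetric]
      using hd1 by (auto simp: zero_nodes_def max)
  next
    case False
    then have "A \<notin> set As" if "maximal_chain R S As" for As using mem[OF that] by blast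
    then show ?thesis using False by (auto simp: zero_nodes_def max)
  qed
  show ?Z0 using Z by (auto simp: I_def S_def)
  show ?Z1 using Z' by (auto simp: I_def S_def)
qed

text \<open>
  A box of nonnegative content is only pushed to the right and keeps its row, one of negative content is
  only pushed down and keeps its column; in both cases \<open>min r c\<close> survives.  The 0-nodes counted in its row
  (or column) are those of the diagonals between the main diagonal and its own.
\<close>

lemma new_place_diag:
  assumes mu: "partition mu" and A: "A \<in> boxes mu"
  shows "new_place p a mu A = diag_box (min (fst A) (snd A)) (new_content p a (content A))"
proof -
  obtain r c where rc: "A = (r, c)" by (cases A)
  have b: "1 \<le> r" "1 \<le> c" "(r, c) \<in> boxes mu" using A by (auto simp: boxes_def rc)
  define d where "d = content A"
  have d: "d = int c - int r" by (simp add: d_def content_def rc)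
  have right: "{c'. c' < c \<and> (r, c') \<in> zero_nodes p a mu 0} =
      (\<lambda>j. nat (j + int r)) ` (zero_contents 0 d)" (is "?L = ?R")
  proof
    show "?L \<subseteq> ?R"
    proof
      fix c' assume "c' \<in> ?L"
      then have c': "c' < c" "(r, c') \<in> zero_nodes p a mu 0" by simp_all
      then have "0 \<le> int c' - int r" "(int c' - int r + a) mod int p = 0"
        unfolding zero_nodes_content[OF mu] box_res_content content_def by simp_all
      then have "int c' - int r \<in> zero_contents 0 d"
        using c'(1) d by simp
      then have "c' = nat ((int c' - int r) + int r)"
        "int c' - int r \<in> zero_contents 0 d" by simp_all
      then show "c' \<in> ?R" by (rule image_eqI)
    qed
    show "?R \<subseteq> ?L"
    proof
      fix c' assume "c' \<in> ?R"
      then obtain j where "c' = nat (j + int r)" "j \<in> zero_contents 0 d"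
        by (rule imageE)
      then have j: "c' = nat (j + int r)" "0 \<le> j" "j < d" "(j + a) mod int p = 0" by simp_all
      then have c': "int c' = j + int r" by simp
      then have "1 \<le> c'" "c' < c" using j b d by linarith+
      moreover from this have "(r, c') \<in> boxes mu" by (intro boxes_down_closed[OF mu b(3)]) (use b in auto)
      ultimately show "c' \<in> ?L"
        using j by (simp add: zero_nodes_content[OF mu] box_res_content content_def c')
    qed
  qed
  have down: "{r'. r' \<le> r \<and> (r', c) \<in> zero_nodes p a mu 1} =
      (\<lambda>j. nat (int c - j)) ` (zero_contents d 0)" (is "?L = ?R")
  proof
    show "?L \<subseteq> ?R"
    proof
      fix r' assume "r' \<in> ?L"
      then have r': "r' \<le> r" "(r', c) \<in> zero_nodes p a mu 1" by simp_all
      then have "int c - int r' < 0" "(int c - int r' + a) mod int p = 0"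
        unfolding zero_nodes_content[OF mu] box_res_content content_def by simp_all
      then have "int c - int r' \<in> zero_contents d 0"
        using r'(1) d by simp
      then have "r' = nat (int c - (int c - int r'))"
        "int c - int r' \<in> zero_contents d 0" by simp_all
      then show "r' \<in> ?R" by (rule image_eqI)
    qed
    show "?R \<subseteq> ?L"
    proof
      fix r' assume "r' \<in> ?R"
      then obtain j where "r' = nat (int c - j)" "j \<in> zero_contents d 0"
        by (rule imageE)
      then have j: "r' = nat (int c - j)" "d \<le> j" "j < 0" "(j + a) mod int p = 0" by simp_all
      then have r': "int r' = int c - j" by simp
      then have "1 \<le> r'" "r' \<le> r" using j b d by linarith+
      moreover from this have "(r', c) \<in> boxes mu" by (intro boxes_down_closed[OF mu b(3)]) (use b in auto)
      ultimately show "r' \<in> ?L"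
        using j by (simp add: zero_nodes_content[OF mu] box_res_content content_def r')
    qed
  qed
  have injr: "inj_on (\<lambda>j. nat (j + int r)) (zero_contents 0 d)"
  proof (rule inj_onI)
    fix j k assume "j \<in> zero_contents 0 d"
      "k \<in> zero_contents 0 d" "nat (j + int r) = nat (k + int r)"
    then show "j = k" by (simp add: eq_nat_nat_iff)
  qed
  have injd: "inj_on (\<lambda>j. nat (int c - j)) (zero_contents d 0)"
  proof (rule inj_onI)
    fix j k assume "j \<in> zero_contents d 0"
      "k \<in> zero_contents d 0" "nat (int c - j) = nat (int c - k)"
    then show "j = k" by (simp add: eq_nat_nat_iff)
  qed
  define K where "K = card (zero_contents 0 d)"
  define L where "L = card (zero_contents d 0)"
  have np: "new_place p a mu A = (r + L, c + K)"
    unfolding new_place_def rc prod.case right down card_image[OF injr] card_image[OF injd] K_def L_def ..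
  show ?thesis
  proof (cases "0 \<le> d")
    case True
    then have "zero_contents d 0 = {}" by auto
    then have "L = 0" unfolding L_def by (simp only: card.empty)
    moreover have "new_content p a d = d + int K"
      unfolding K_def by (rule new_content_count_right[OF True])
    moreover have "min r c = r" "nat (- (d + int K)) = 0" "r + nat (d + int K) = c + K"
      using True d by linarith+
    ultimately show ?thesis
      unfolding np d_def[symmetric] diag_box_def by (simp only: rc fst_conv snd_conv add_0_right)
  next
    case False
    then have "zero_contents 0 d = {}" "d \<le> 0" by auto
    then have "K = 0" unfolding K_def by (simp only: card.empty)
    moreover have "new_content p a d = d - int L"
      unfolding L_def by (rule new_content_count_left) fact
    moreover have "min r c = c" "nat (d - int L) = 0" "c + nat (- (d - int L)) = r + L"
      using False d by linarith+
    ultimately show ?thesis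
      unfolding np d_def[symmetric] diag_box_def by (simp only: rc fst_conv snd_conv add_0_right)
  qed
qed

lemma source_kept_box [simp]: "source_box p a (kept_box p a A) = A"
  by (simp add: source_box_def kept_box_def)

lemma source_added_box: "box_res p a A = 0 \<Longrightarrow> source_box p a (added_box p a A) = A"
  by (simp add: source_box_def added_box_def box_res_content old_content_Suc_new del: mod_eq_0_iff_dvd)

lemma kept_box_res: "box_res (p + 1) (raise_res a) (kept_box p a A) = raise_res (box_res p a A)"
  using new_content_res[of "content A"] by (simp add: kept_box_def box_res_content)

lemma added_box_res:
  assumes "box_res p a A = 0"
  shows "box_res (p + 1) (raise_res a) (added_box p a A) = 1"
proof -
  have q: "int (p + 1) > 0" "int (p + 1) > 2" using p2 by auto
  have "(new_content p a (content A) + raise_res a) mod int (p + 1) = 0"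
    using new_content_res[of "content A"] assms by (simp add: box_res_content raise_res_def)
  then have "(new_content p a (content A) + raise_res a + 1) mod int (p + 1) = 1"
    using div_mod_Suc(2)[OF q(1), of "new_content p a (content A) + raise_res a"] q by simp
  then show ?thesis by (simp add: added_box_def box_res_content algebra_simps)
qed

lemma source_box_res:
  "box_res p a (source_box p a B) = max 0 (box_res (p + 1) (raise_res a) B - 1)"
  using old_content_res[of "content B"] by (simp add: source_box_def box_res_content)

lemma source_box_coords:
  "content (source_box p a B) = old_content p a (content B)"
  "min (fst (source_box p a B)) (snd (source_box p a B)) = min (fst B) (snd B)"
  by (simp_all add: source_box_def)

text \<open>
  Old boxes reach the contents that \<open>new_content\<close> takes, and a new box ends up with the content
  of its 0-node plus one, whichever side it is inserted at.  These exhaust all contents, which leaves the single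
  condition that the source is a box.
\<close>

lemma plus_boxes_source:
  assumes mu: "partition mu"
  shows "plus_boxes p a mu = {B. source_box p a B \<in> boxes mu}"
proof -
  have right: "(case diag_box q D of (r, c) \<Rightarrow> (r, c + 1)) = diag_box q (D + 1)" if "0 \<le> D" for q D
    using that by (simp add: diag_box_def)
  have up: "(case diag_box q D of (r, c) \<Rightarrow> (r - 1, c)) = diag_box q (D + 1)" if "D < 0" for q D
    using that by (simp add: diag_box_def nat_diff_distrib)
  have "plus_boxes p a mu = kept_box p a ` boxes mu \<union> added_box p a ` zero_nodes p a mu 0 \<union> added_box p a ` zero_nodes p a mu 1"
    unfolding plus_boxes_def
  proof (intro arg_cong2[of _ _ _ _ "(\<union>)"] image_cong refl)
    fix A assume A: "A \<in> boxes mu"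
    show "new_place p a mu A = kept_box p a A" using new_place_diag[OF mu A] by (simp add: kept_box_def)
  next
    fix A assume "A \<in> zero_nodes p a mu 0"
    then have A: "A \<in> boxes mu" "0 \<le> content A" by (auto simp: zero_nodes_content[OF mu])
    show "(case new_place p a mu A of (r, c) \<Rightarrow> (r, c + 1)) = added_box p a A"
      unfolding new_place_diag[OF mu A(1)] added_box_def by (rule right) (simp add: new_content_nonneg A)
  next
    fix A assume "A \<in> zero_nodes p a mu 1"
    then have A: "A \<in> boxes mu" "content A < 0" by (auto simp: zero_nodes_content[OF mu])
    have "\<not> 0 \<le> new_content p a (content A)" using A(2) by (simp only: new_content_nonneg not_le)
    then show "(case new_place p a mu A of (r, c) \<Rightarrow> (r - 1, c)) = added_box p a A"
      unfolding new_place_diag[OF mu A(1)] added_box_def by (intro up) simp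
  qed
  also have "\<dots> = kept_box p a ` boxes mu \<union> added_box p a ` {A \<in> boxes mu. box_res p a A = 0}"
  proof -
    have "{A \<in> boxes mu. box_res p a A = 0} = zero_nodes p a mu 0 \<union> zero_nodes p a mu 1"
      unfolding zero_nodes_content[OF mu] by auto
    then show ?thesis by (simp only: image_Un Un_assoc)
  qed
  also have "\<dots> = {B. source_box p a B \<in> boxes mu}"
  proof (intro equalityI subsetI)
    fix B assume "B \<in> kept_box p a ` boxes mu \<union> added_box p a ` {A \<in> boxes mu. box_res p a A = 0}"
    then consider A where "A \<in> boxes mu" "B = kept_box p a A"
      | A where "A \<in> boxes mu" "box_res p a A = 0" "B = added_box p a A" by blast
    then show "B \<in> {B. source_box p a B \<in> boxes mu}"
      by cases (simp_all add: kept_box_def added_box_def source_box_def box_res_content old_content_Suc_new del: mod_eq_0_iff_dvd)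
  next
    fix B assume "B \<in> {B. source_box p a B \<in> boxes mu}"
    then have A: "source_box p a B \<in> boxes mu" by simp
    have q: "min (fst (source_box p a B)) (snd (source_box p a B)) = min (fst B) (snd B)"
      "content (source_box p a B) = old_content p a (content B)"
      by (simp_all add: source_box_def)
    show "B \<in> kept_box p a ` boxes mu \<union> added_box p a ` {A \<in> boxes mu. box_res p a A = 0}"
    proof (cases "(content B + raise_res a) mod int (p + 1) = 1")
      case True
      then have "added_box p a (source_box p a B) = B" "box_res p a (source_box p a B) = 0"
        unfolding added_box_def q box_res_content by (simp_all add: new_old_content old_content_res)
      then show ?thesis using A by force
    next
      case False
      then have "kept_box p a (source_box p a B) = B"
        unfolding kept_box_def q by (simp add: new_old_content)
      then show ?thesis using A by force
    qed
  qed
  finally show ?thesis .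
qed

text \<open>
  The factor 2 bounds the size of the enlarged multipartition, which is why the asymptotic condition on
  the charge for \<open>n\<close> boxes still separates its components.
\<close>

lemma finite_card_plus_boxes:
  assumes mu: "partition mu"
  shows "finite (plus_boxes p a mu)" "card (plus_boxes p a mu) \<le> 2 * card (boxes mu)"
    "card (boxes mu) \<le> card (plus_boxes p a mu)"
proof -
  have f: "finite (boxes mu)" by (rule finite_boxes[OF mu])
  have Z: "zero_nodes p a mu 0 \<union> zero_nodes p a mu 1 \<subseteq> boxes mu"
    "zero_nodes p a mu 0 \<inter> zero_nodes p a mu 1 = {}"
    by (auto simp: zero_nodes_content[OF mu])
  then have fz: "finite (zero_nodes p a mu 0)" "finite (zero_nodes p a mu 1)"
    using f by (auto intro: finite_subset)
  show fin: "finite (plus_boxes p a mu)" using f fz by (simp add: plus_boxes_def)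
  have c: "card (zero_nodes p a mu 0) + card (zero_nodes p a mu 1) \<le> card (boxes mu)"
    using card_mono[OF f Z(1)] card_Un_disjoint[OF fz Z(2)] by simp
  have im: "card (f1 ` X \<union> f2 ` Y \<union> f3 ` W) \<le> card X + card Y + card W"
    if "finite X" "finite Y" "finite W" for f1 f2 f3 :: "nat \<times> nat \<Rightarrow> nat \<times> nat" and X Y W
    by (meson add_mono card_Un_le card_image_le order_trans that)
  show "card (plus_boxes p a mu) \<le> 2 * card (boxes mu)"
    unfolding plus_boxes_def by (rule order_trans[OF im[OF f fz]]) (use c in linarith)
  have "inj_on (new_place p a mu) (boxes mu)"
  proof (rule inj_onI)
    fix A B assume *: "A \<in> boxes mu" "B \<in> boxes mu" "new_place p a mu A = new_place p a mu B"
    then have eq: "diag_box (min (fst A) (snd A)) (new_content p a (content A)) =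
        diag_box (min (fst B) (snd B)) (new_content p a (content B))"
      by (simp add: new_place_diag[OF mu])
    have "min (fst A) (snd A) = min (fst B) (snd B)"
      using arg_cong[OF eq, of "\<lambda>A. min (fst A) (snd A)"] by simp
    moreover have "content A = content B"
      using arg_cong[OF eq, of "\<lambda>A. old_content p a (content A)"] by simp
    ultimately show "A = B" by (metis diag_box_coords)
  qed
  then show "card (boxes mu) \<le> card (plus_boxes p a mu)"
    using card_inj_on_le[of "new_place p a mu" "boxes mu" "plus_boxes p a mu"] fin
    by (auto simp: plus_boxes_def)
qed

text \<open>
  One step to the left or upwards changes the content by one, hence the content of the source by at
  most one; the source therefore moves at most one step in the same direction.  Only across the main
  diagonal are the values at 0 and -1 needed.
\<close>

lemma plus_boxes_partition:
  assumes mu: "partition mu"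
  shows "partition (\<lambda>r. card {c. (r, c) \<in> plus_boxes p a mu})"
    and "boxes (\<lambda>r. card {c. (r, c) \<in> plus_boxes p a mu}) = plus_boxes p a mu"
proof -
  define S where "S = plus_boxes p a mu"
  have S: "B \<in> S \<longleftrightarrow> source_box p a B \<in> boxes mu" for B
    by (simp add: S_def plus_boxes_source[OF mu])
  have step: "old_content p a D \<le> old_content p a (D + 1) \<and> old_content p a (D + 1) \<le> old_content p a D + 1" for D
    by (simp add: old_content_Suc)
  have pos: "1 \<le> r \<and> 1 \<le> c" if "(r, c) \<in> S" for r c
  proof -
    have "1 \<le> min (fst (source_box p a (r, c))) (snd (source_box p a (r, c)))"
      using that[unfolded S] by (auto simp: boxes_def)
    then show ?thesis by (simp add: source_box_def)
  qed
  have src: "source_box p a (r, c) = (if r \<le> c then (r, nat (int r + old_content p a (int c - int r)))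
      else (nat (int c - old_content p a (int c - int r)), c))" for r c
    using old_content_nonneg[of "int c - int r"]
    by (auto simp: source_box_def diag_box_def content_def nat_add_distrib nat_diff_distrib)
  have left: "(r, c) \<in> S" if "(r, Suc c) \<in> S" "1 \<le> c" for r c
  proof -
    define D where "D = int c - int r"
    have D: "int (Suc c) - int r = D + 1" by (simp add: D_def)
    have r: "1 \<le> r" using pos[OF that(1)] by simp
    have b: "source_box p a (r, Suc c) \<in> boxes mu" using that(1) by (simp add: S)
    consider "r \<le> c" | "r = Suc c" | "Suc c < r" by linarith
    then show ?thesis
    proof cases
      case 1
      then have "old_content p a D \<ge> 0" unfolding old_content_nonneg by (simp add: D_def)
      then have I: "1 \<le> nat (int r + old_content p a D)"
        "nat (int r + old_content p a D) \<le> nat (int r + old_content p a (D + 1))"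
        using step[of D] r by linarith+
      have B: "(r, nat (int r + old_content p a (D + 1))) \<in> boxes mu"
        using b 1 unfolding src D by (simp only: le_SucI if_True)
      have "(r, nat (int r + old_content p a D)) \<in> boxes mu"
        by (rule boxes_down_closed[OF mu B r order_refl I])
      then show ?thesis using 1 unfolding S src D_def by simp
    next
      case 2
      then have "D = - 1" by (simp add: D_def)
      then have B: "(r, r) \<in> boxes mu" and e: "nat (int c - old_content p a D) = r"
        using b 2 unfolding src D by (simp_all add: old_content_m1 nat_add_distrib)
      have "(r, c) \<in> boxes mu" using 2 that(2)
        by (intro boxes_down_closed[OF mu B r order_refl]) auto
      then show ?thesis using 2 e unfolding S src D_def by simp
    next
      case 3
      then have "old_content p a (D + 1) < 0" using old_content_nonneg[of "D + 1"] by (simp add: D_def)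
      then have I: "1 \<le> nat (int c - old_content p a D)"
        "nat (int c - old_content p a D) \<le> nat (int (Suc c) - old_content p a (D + 1))"
        using step[of D] that(2) by linarith+
      have B: "(nat (int (Suc c) - old_content p a (D + 1)), Suc c) \<in> boxes mu"
        using b 3[folded not_le] unfolding src D by (simp only: if_False)
      have "(nat (int c - old_content p a D), c) \<in> boxes mu"
        using that(2) by (intro boxes_down_closed[OF mu B I]) auto
      then show ?thesis using 3 unfolding S src D_def by simp
    qed
  qed
  have up: "(r, c) \<in> S" if "(Suc r, c) \<in> S" "1 \<le> r" for r c
  proof -
    define D where "D = int c - int (Suc r)"
    have D: "int c - int r = D + 1" by (simp add: D_def)
    have c: "1 \<le> c" using pos[OF that(1)] by simp
    have b: "source_box p a (Suc r, c) \<in> boxes mu" using that(1) by (simp add: S)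
    consider "Suc r \<le> c" | "r = c" | "c < r" by linarith
    then show ?thesis
    proof cases
      case 1
      then have "old_content p a D \<ge> 0" unfolding old_content_nonneg by (simp add: D_def)
      then have I: "1 \<le> nat (int r + old_content p a (D + 1))"
        "nat (int r + old_content p a (D + 1)) \<le> nat (int (Suc r) + old_content p a D)"
        using step[of D] that(2) by linarith+
      have B: "(Suc r, nat (int (Suc r) + old_content p a D)) \<in> boxes mu"
        using b 1 unfolding src D_def[symmetric] by (simp only: if_True)
      have "(r, nat (int r + old_content p a (D + 1))) \<in> boxes mu"
        using that(2) by (intro boxes_down_closed[OF mu B _ _ I]) auto
      then show ?thesis using 1 unfolding S src D by simp
    next
      case 2
      then have "D = - 1" by (simp add: D_def)
      then have B: "(Suc c, c) \<in> boxes mu"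
        using b 2 unfolding src D_def[symmetric] by (simp add: old_content_m1 nat_add_distrib)
      have "(c, c) \<in> boxes mu" using c by (intro boxes_down_closed[OF mu B]) auto
      then show ?thesis using 2 unfolding S src by simp
    next
      case 3
      then have "old_content p a (D + 1) < 0" using old_content_nonneg[of "D + 1"] by (simp add: D_def)
      then have I: "1 \<le> nat (int c - old_content p a (D + 1))"
        "nat (int c - old_content p a (D + 1)) \<le> nat (int c - old_content p a D)"
        using step[of D] c by linarith+
      have B: "(nat (int c - old_content p a D), c) \<in> boxes mu"
        using b 3 unfolding src D_def[symmetric] by simp
      have "(nat (int c - old_content p a (D + 1)), c) \<in> boxes mu"
        by (rule boxes_down_closed[OF mu B I c order_refl])
      then show ?thesis using 3 unfolding S src D by simp
    qed
  qed
  have fin: "finite S" unfolding S_def by (rule finite_card_plus_boxes[OF mu])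
  show "partition (\<lambda>r. card {c. (r, c) \<in> plus_boxes p a mu})"
    and "boxes (\<lambda>r. card {c. (r, c) \<in> plus_boxes p a mu}) = plus_boxes p a mu"
    using boxes_of_down_closed_set[OF fin pos left up] unfolding S_def by blast+
qed

end

section \<open>Order criteria for equality of idempotent diagrams\<close>

lemma strands_iff [simp]:
  "(x, Solid, i) \<in> strands D \<longleftrightarrow> (x, i) \<in> solids D"
  "(x, Ghost, i) \<in> strands D \<longleftrightarrow> (x - shift D i, i) \<in> solids D"
  "(x, Red, i) \<in> strands D \<longleftrightarrow> (x, i) \<in> reds D"
  by (auto simp: strands_def) (metis diff_add_cancel)+

text \<open>
  The form of convexity used for pairs of strings that may not meet.
\<close>

lemma segment_avoids_zero:
  fixes p q u :: real
  assumes "p < 0 \<longleftrightarrow> q < 0" "p \<noteq> 0" "q \<noteq> 0" "0 \<le> u" "u \<le> 1"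
  shows "(1 - u) * p + u * q \<noteq> 0"
proof (cases "p < 0")
  case True
  have "(1 - u) * p \<le> 0" "u * q \<le> 0" using assms True by (auto intro: mult_nonneg_nonpos)
  moreover have "(1 - u) * p < 0 \<or> u * q < 0"
    using assms True by (cases "u = 0") (auto intro: mult_pos_neg)
  ultimately show ?thesis by linarith
next
  case False
  then have "p > 0" "q > 0" using assms by auto
  have "(1 - u) * p \<ge> 0" "u * q \<ge> 0" using \<open>p > 0\<close> \<open>q > 0\<close> assms by auto
  moreover have "(1 - u) * p > 0 \<or> u * q > 0"
    using \<open>p > 0\<close> \<open>q > 0\<close> assms by (cases "u = 0") auto
  ultimately show ?thesis by linarith
qed

text \<open>
  Each forbidden collision is a linear equation in the positions.  If the difference of the two
  sides has the same sign at both ends of the motion, it has this sign throughout; at the ends it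
  does not vanish because the positions in an idempotent diagram are distinct.
\<close>

lemma same_idempotent_by_interpolation:
  fixes x y :: "'a \<Rightarrow> real" and res :: "'a \<Rightarrow> int"
  assumes D: "idempotent_diagram D" and E: "idempotent_diagram E"
    and modulus: "modulus E = modulus D" and shift: "shift E = shift D" and reds: "reds E = reds D"
    and sD: "solids D = (\<lambda>N. (x N, res N)) ` X" and injD: "inj_on (\<lambda>N. (x N, res N)) X"
    and sE: "solids E = (\<lambda>N. (y N, res N)) ` X" and injE: "inj_on (\<lambda>N. (y N, res N)) X"
    and equal: "\<And>N N'. N \<in> X \<Longrightarrow> N' \<in> X \<Longrightarrow> res N = res N' \<Longrightarrow> x N < x N' \<longleftrightarrow> y N < y N'"
    and ghost: "\<And>N N'. N \<in> X \<Longrightarrow> N' \<in> X \<Longrightarrow> res N' = (res N + 1) mod int (modulus D) \<Longrightarrow>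
      x N + shift D (res N) < x N' \<longleftrightarrow> y N + shift D (res N) < y N'"
    and red: "\<And>N z. N \<in> X \<Longrightarrow> (z, res N) \<in> reds D \<Longrightarrow> x N < z \<longleftrightarrow> y N < z"
  shows "same_idempotent D E"
proof -
  define g where "g = inv_into X (\<lambda>N. (x N, res N))"
  have g: "g (x N, res N) = N" if "N \<in> X" for N
    unfolding g_def using inv_into_f_f[OF injD that] by simp
  define \<gamma> where "\<gamma> s u = (1 - u) * x (g s) + u * y (g s)" for s u
  have \<gamma>: "\<gamma> (x N, res N) u = (1 - u) * x N + u * y N" if "N \<in> X" for N u
    by (simp add: \<gamma>_def g[OF that])
  have neD: "fst s \<noteq> fst s'" if "s \<in> strands D" "s' \<in> strands D" "snd s \<noteq> snd s'" for s s'
    using D that unfolding idempotent_diagram_def inj_on_def by blast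
  have neE: "fst s \<noteq> fst s'" if "s \<in> strands E" "s' \<in> strands E" "snd s \<noteq> snd s'" for s s'
    using E that unfolding idempotent_diagram_def inj_on_def by blast
  have solD: "(x N, res N) \<in> solids D" if "N \<in> X" for N using that by (auto simp: sD)
  have solE: "(y N, res N) \<in> solids E" if "N \<in> X" for N using that by (auto simp: sE)
  have ends: "\<forall>s\<in>solids D. continuous_on {0..1} (\<gamma> s) \<and> \<gamma> s 0 = fst s"
  proof
    fix s assume "s \<in> solids D"
    then obtain N where N: "N \<in> X" "s = (x N, res N)" by (auto simp: sD)
    show "continuous_on {0..1} (\<gamma> s) \<and> \<gamma> s 0 = fst s"
      unfolding N(2) \<gamma>[OF N(1)] by (auto intro!: continuous_intros)
  qed
  have bij: "bij_betw (\<lambda>s. (\<gamma> s 1, snd s)) (solids D) (solids E)"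
  proof -
    have b1: "bij_betw g (solids D) X"
      unfolding g_def sD by (rule bij_betw_inv_into[OF inj_on_imp_bij_betw[OF injD]])
    have b2: "bij_betw (\<lambda>N. (y N, res N)) X (solids E)"
      unfolding sE by (rule inj_on_imp_bij_betw[OF injE])
    have "bij_betw ((\<lambda>N. (y N, res N)) \<circ> g) (solids D) (solids E)"
      by (rule bij_betw_trans[OF b1 b2])
    moreover have "((\<lambda>N. (y N, res N)) \<circ> g) s = (\<gamma> s 1, snd s)" if "s \<in> solids D" for s
      using that by (auto simp: sD \<gamma>_def g)
    ultimately show ?thesis by (subst bij_betw_cong[symmetric])
  qed
  have avoid: "\<forall>u\<in>{0..1}.
     (\<forall>s\<in>solids D. \<forall>s'\<in>solids D. s \<noteq> s' \<and> snd s = snd s' \<longrightarrow> \<gamma> s u \<noteq> \<gamma> s' u) \<and>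
     (\<forall>s\<in>solids D. \<forall>s'\<in>solids D. snd s' = (snd s + 1) mod int (modulus D) \<longrightarrow>
        \<gamma> s u + shift D (snd s) \<noteq> \<gamma> s' u) \<and>
     (\<forall>s\<in>solids D. \<forall>q\<in>reds D. snd q = snd s \<longrightarrow> \<gamma> s u \<noteq> fst q)"
  proof (intro ballI conjI impI)
    fix u :: real and s s'
    assume u: "u \<in> {0..1}" and "s \<in> solids D" "s' \<in> solids D" and ss: "s \<noteq> s' \<and> snd s = snd s'"
    then obtain N N' where N: "N \<in> X" "s = (x N, res N)" "N' \<in> X" "s' = (x N', res N')"
      by (auto simp: sD)
    have r: "res N = res N'" and ne: "N \<noteq> N'" using ss N by auto
    have "x N \<noteq> x N'" "y N \<noteq> y N'"
      using injD injE N(1,3) r ne by (auto dest: inj_onD)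
    then have "(1 - u) * (x N - x N') + u * (y N - y N') \<noteq> 0"
      using u equal[OF N(1,3) r] by (intro segment_avoids_zero) auto
    then show "\<gamma> s u \<noteq> \<gamma> s' u" unfolding N(2,4) \<gamma>[OF N(1)] \<gamma>[OF N(3)]
      by (simp add: algebra_simps)
  next
    fix u :: real and s s'
    assume u: "u \<in> {0..1}" and "s \<in> solids D" "s' \<in> solids D"
      and ss: "snd s' = (snd s + 1) mod int (modulus D)"
    then obtain N N' where N: "N \<in> X" "s = (x N, res N)" "N' \<in> X" "s' = (x N', res N')"
      by (auto simp: sD)
    have r: "res N' = (res N + 1) mod int (modulus D)" using ss N by simp
    define h where "h = shift D (res N)"
    have "x N + h \<noteq> x N'"
      using neD[of "(x N + h, Ghost, res N)" "(x N', Solid, res N')"] solD N by (simp add: h_def)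
    moreover have "y N + h \<noteq> y N'"
      using neE[of "(y N + h, Ghost, res N)" "(y N', Solid, res N')"] solE N
      by (simp add: h_def shift)
    ultimately have "(1 - u) * (x N + h - x N') + u * (y N + h - y N') \<noteq> 0"
      using u ghost[OF N(1,3) r] unfolding h_def by (intro segment_avoids_zero) auto
    then show "\<gamma> s u + shift D (snd s) \<noteq> \<gamma> s' u" unfolding N(2,4) \<gamma>[OF N(1)] \<gamma>[OF N(3)]
      by (simp add: algebra_simps h_def)
  next
    fix u :: real and s z
    assume u: "u \<in> {0..1}" and "s \<in> solids D" and z: "z \<in> reds D" and ss: "snd z = snd s"
    then obtain N where N: "N \<in> X" "s = (x N, res N)" by (auto simp: sD)
    obtain w where w: "z = (w, res N)" using ss N by (cases z) auto
    have "x N \<noteq> w"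
      using neD[of "(x N, Solid, res N)" "(w, Red, res N)"] solD N z w by auto
    moreover have "y N \<noteq> w"
      using neE[of "(y N, Solid, res N)" "(w, Red, res N)"] solE N z w reds by auto
    ultimately have "(1 - u) * (x N - w) + u * (y N - w) \<noteq> 0"
      using u red[of N w] N z w by (intro segment_avoids_zero) auto
    then show "\<gamma> s u \<noteq> fst z" unfolding N(2) \<gamma>[OF N(1)] w
      by (simp add: algebra_simps)
  qed
  show ?thesis unfolding same_idempotent_def
    using D E modulus shift reds ends bij avoid by (intro conjI exI[of _ \<gamma>]) auto
qed

text \<open>
  An increasing bijection preserves the number of smaller elements.
\<close>

lemma strict_mono_bij_unique:
  fixes A B :: "real set"
  assumes fin: "finite A"
    and f: "bij_betw f A B" "\<And>x y. x \<in> A \<Longrightarrow> y \<in> A \<Longrightarrow> x < y \<longleftrightarrow> f x < (f y :: real)"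
    and g: "bij_betw g A B" "\<And>x y. x \<in> A \<Longrightarrow> y \<in> A \<Longrightarrow> x < y \<longleftrightarrow> g x < (g y :: real)"
    and x: "x \<in> A"
  shows "f x = g x"
proof -
  have finB: "finite B" using fin f(1) bij_betw_finite by blast
  have rank: "card {b \<in> B. b < h x} = card {a \<in> A. a < x}"
    if h: "bij_betw h A B" "\<And>x y. x \<in> A \<Longrightarrow> y \<in> A \<Longrightarrow> x < y \<longleftrightarrow> h x < (h y :: real)" for h
  proof -
    have "{b \<in> B. b < h x} = h ` {a \<in> A. a < x}"
      using h(1) h(2)[OF _ x] unfolding bij_betw_def by auto
    moreover have "inj_on h {a \<in> A. a < x}"
      using h(1) unfolding bij_betw_def by (auto intro: inj_on_subset)
    ultimately show ?thesis by (simp add: card_image)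
  qed
  have less: False if "b < c" "b \<in> B" "card {a \<in> B. a < b} = card {a \<in> B. a < c}" for b c :: real
  proof -
    have "{a \<in> B. a < b} \<subset> {a \<in> B. a < c}" using that by auto
    then have "card {a \<in> B. a < b} < card {a \<in> B. a < c}"
      using finB by (intro psubset_card_mono) simp_all
    then show False using that(3) by simp
  qed
  have "f x \<in> B" "g x \<in> B" using f(1) g(1) x by (auto simp: bij_betw_def)
  then show ?thesis using less[of "f x" "g x"] less[of "g x" "f x"] rank[OF f] rank[OF g]
    by (cases "f x" "g x" rule: linorder_cases) auto
qed

text \<open>
  An order isomorphism of all strings need not a priori send the ghost of a solid string to the
  ghost of its image.  It does: for a fixed residue the ghosts are a translate of the solid strings, and
  there is only one increasing bijection between two finite sets of reals.  The same argument shows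
  that every red string stays in its place.
\<close>

lemma same_order_positions:
  fixes u :: "'a \<Rightarrow> real" and res :: "'a \<Rightarrow> int"
  assumes order: "same_order U E" and E: "idempotent_diagram E" and reds: "reds E = reds U"
    and sU: "solids U = (\<lambda>N. (u N, res N)) ` X" and injU: "inj_on (\<lambda>N. (u N, res N)) X"
    and finX: "finite X"
  obtains y where "solids E = (\<lambda>N. (y N, res N)) ` X" "inj_on (\<lambda>N. (y N, res N)) X"
    "\<And>N N'. N \<in> X \<Longrightarrow> N' \<in> X \<Longrightarrow> u N < u N' \<longleftrightarrow> y N < y N'"
    "\<And>N N'. N \<in> X \<Longrightarrow> N' \<in> X \<Longrightarrow>
      u N + shift U (res N) < u N' \<longleftrightarrow> y N + shift E (res N) < y N'"
    "\<And>N z i. N \<in> X \<Longrightarrow> (z, i) \<in> reds U \<Longrightarrow> u N < z \<longleftrightarrow> y N < z"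
proof -
  obtain f where f: "bij_betw f (strands U) (strands E)"
    and snd_f: "\<And>s. s \<in> strands U \<Longrightarrow> snd (f s) = snd s"
    and mono: "\<And>s s'. s \<in> strands U \<Longrightarrow> s' \<in> strands U \<Longrightarrow> fst s < fst s' \<longleftrightarrow> fst (f s) < fst (f s')"
    using order unfolding same_order_def by blast
  define h where "h k i x = fst (f (x, k, i))" for k i x
  have f_h: "f (x, k, i) = (h k i x, k, i)" if "(x, k, i) \<in> strands U" for x k i
    using snd_f[OF that] by (simp add: h_def prod_eq_iff)
  have bij: "bij_betw (h k i) {x. (x, k, i) \<in> strands U} {x. (x, k, i) \<in> strands E}" for k i
    unfolding bij_betw_def
  proof
    show "inj_on (h k i) {x. (x, k, i) \<in> strands U}"
    proof (rule inj_onI)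
      fix x y assume *: "x \<in> {x. (x, k, i) \<in> strands U}" "y \<in> {x. (x, k, i) \<in> strands U}" "h k i x = h k i y"
      then have "f (x, k, i) = f (y, k, i)" by (simp add: f_h)
      then have "(x, k, i) = (y, k, i)"
        using * f unfolding bij_betw_def by (auto dest: inj_onD)
      then show "x = y" by simp
    qed
    show "h k i ` {x. (x, k, i) \<in> strands U} = {x. (x, k, i) \<in> strands E}"
    proof (intro equalityI subsetI)
      fix z assume "z \<in> h k i ` {x. (x, k, i) \<in> strands U}"
      then obtain x where "z = h k i x" "(x, k, i) \<in> strands U" by auto
      then show "z \<in> {x. (x, k, i) \<in> strands E}"
        using f f_h[of x k i] unfolding bij_betw_def by force
    next
      fix z assume "z \<in> {x. (x, k, i) \<in> strands E}"
      then have "(z, k, i) \<in> f ` strands U" using f by (simp add: bij_betw_def)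
      then obtain s where s: "s \<in> strands U" "f s = (z, k, i)" by auto
      then have "snd s = (k, i)" using snd_f[OF s(1)] by simp
      then have "s = (fst s, k, i)" by (simp add: prod_eq_iff)
      then show "z \<in> h k i ` {x. (x, k, i) \<in> strands U}"
        using s by (intro image_eqI[of _ _ "fst s"]) (auto simp: h_def)
    qed
  qed
  have hmono: "x < x' \<longleftrightarrow> h k i x < h k' i' x'"
    if "(x, k, i) \<in> strands U" "(x', k', i') \<in> strands U" for x k i x' k' i'
    using mono[OF that] by (simp add: h_def)
  define y where "y N = h Solid (res N) (u N)" for N
  have sol: "(u N, res N) \<in> solids U" if "N \<in> X" for N using that by (simp add: sU)
  have finU: "finite {x. (x, i) \<in> solids U}" for i
  proof -
    have "{x. (x, i) \<in> solids U} \<subseteq> u ` X" by (auto simp: sU)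
    then show ?thesis using finX by (auto intro: finite_subset)
  qed
  have ghost: "h Ghost i (x + shift U i) = h Solid i x + shift E i" if "(x, i) \<in> solids U" for x i
  proof -
    let ?A = "{x. (x, i) \<in> solids U}" and ?B = "{x. (x, i) \<in> solids E}"
    have "h Ghost i (x + shift U i) - shift E i = h Solid i x"
    proof (rule strict_mono_bij_unique[where A = ?A and B = ?B and f = "\<lambda>x. h Ghost i (x + shift U i) - shift E i"])
      have b1: "bij_betw (\<lambda>x. x + shift U i) ?A {x. (x, Ghost, i) \<in> strands U}"
        by (rule bij_betw_byWitness[where f' = "\<lambda>x. x - shift U i"]) auto
      have b2: "bij_betw (\<lambda>x. x - shift E i) {x. (x, Ghost, i) \<in> strands E} ?B"
        by (rule bij_betw_byWitness[where f' = "\<lambda>x. x + shift E i"]) auto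
      show "bij_betw (\<lambda>x. h Ghost i (x + shift U i) - shift E i) ?A ?B"
        using bij_betw_trans[OF bij_betw_trans[OF b1 bij] b2] by (simp add: comp_def)
      show "bij_betw (h Solid i) ?A ?B" using bij[of Solid i] by simp
      show "finite ?A" by (rule finU)
      show "x \<in> ?A" using that by simp
      show "x < x' \<longleftrightarrow> h Solid i x < h Solid i x'" if "x \<in> ?A" "x' \<in> ?A" for x x'
        using hmono[of x Solid i x' Solid i] that by simp
      show "x < x' \<longleftrightarrow> h Ghost i (x + shift U i) - shift E i < h Ghost i (x' + shift U i) - shift E i"
        if "x \<in> ?A" "x' \<in> ?A" for x x'
        using hmono[of "x + shift U i" Ghost i "x' + shift U i" Ghost i] that by simp
    qed
    then show ?thesis by simp
  qed
  have finR: "finite {x. (x, i) \<in> reds U}" for i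
  proof -
    have "{x. (x, i) \<in> reds U} \<subseteq> fst ` reds E" unfolding reds by force
    then show ?thesis using E unfolding idempotent_diagram_def by (auto intro: finite_subset)
  qed
  have red: "h Red i z = z" if "(z, i) \<in> reds U" for z i
  proof (rule strict_mono_bij_unique[where A = "{x. (x, i) \<in> reds U}" and B = "{x. (x, i) \<in> reds U}" and g = "\<lambda>x. x"])
    show "bij_betw (h Red i) {x. (x, i) \<in> reds U} {x. (x, i) \<in> reds U}"
      using bij[of Red i] reds by simp
    show "finite {x. (x, i) \<in> reds U}" by (rule finR)
    show "z \<in> {x. (x, i) \<in> reds U}" using that by simp
    show "x < x' \<longleftrightarrow> h Red i x < h Red i x'"
      if "x \<in> {x. (x, i) \<in> reds U}" "x' \<in> {x. (x, i) \<in> reds U}" for x x'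
      using hmono[of x Red i x' Red i] that by simp
  qed (auto simp: bij_betw_def)
  show ?thesis
  proof (rule that[of y])
    show "solids E = (\<lambda>N. (y N, res N)) ` X"
    proof (intro equalityI subsetI)
      fix s assume s: "s \<in> solids E"
      obtain z i where zi: "s = (z, i)" by (cases s)
      have "z \<in> h Solid i ` {x. (x, Solid, i) \<in> strands U}"
        using bij[of Solid i] s zi by (simp add: bij_betw_def)
      then obtain x where "z = h Solid i x" "(x, i) \<in> solids U" by auto
      then show "s \<in> (\<lambda>N. (y N, res N)) ` X" using zi by (auto simp: sU y_def)
    next
      fix s assume "s \<in> (\<lambda>N. (y N, res N)) ` X"
      then obtain N where N: "N \<in> X" "s = (y N, res N)" by auto
      have "y N \<in> {x. (x, Solid, res N) \<in> strands E}"
        using bij[of Solid "res N"] sol[OF N(1)] unfolding bij_betw_def y_def by auto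
      then show "s \<in> solids E" using N by simp
    qed
    show "inj_on (\<lambda>N. (y N, res N)) X"
    proof (rule inj_onI)
      fix N N' assume *: "N \<in> X" "N' \<in> X" "(y N, res N) = (y N', res N')"
      have r: "res N' = res N" and "y N = y N'" using *(3) by simp_all
      then have "h Solid (res N) (u N) = h Solid (res N) (u N')" unfolding y_def r by (simp only:)
      moreover have "u N \<in> {x. (x, Solid, res N) \<in> strands U}" "u N' \<in> {x. (x, Solid, res N) \<in> strands U}"
        using sol[OF *(1)] sol[OF *(2)] * by simp_all
      ultimately have "u N = u N'" using bij[of Solid "res N"] unfolding bij_betw_def by (auto dest: inj_onD)
      then show "N = N'" using injU * by (auto dest: inj_onD)
    qed
    show "u N < u N' \<longleftrightarrow> y N < y N'" if "N \<in> X" "N' \<in> X" for N N'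
      unfolding y_def using sol[OF that(1)] sol[OF that(2)] by (intro hmono) simp_all
    show "u N + shift U (res N) < u N' \<longleftrightarrow> y N + shift E (res N) < y N'" if "N \<in> X" "N' \<in> X" for N N'
      unfolding y_def ghost[OF sol[OF that(1)], symmetric]
      using sol[OF that(1)] sol[OF that(2)] by (intro hmono) simp_all
    show "u N < z \<longleftrightarrow> y N < z" if "N \<in> X" "(z, i) \<in> reds U" for N z i
      using hmono[of "u N" Solid "res N" z Red i] sol[OF that(1)] that(2) red[OF that(2)]
      by (simp add: y_def)
  qed
qed

text \<open>
  Order isomorphisms are obtained by indexing both sets of strings by the same set.
\<close>

lemma same_order_indexed:
  assumes U: "strands U = f ` J" and E: "strands E = g ` J"
    and injU: "inj_on f J" and injE: "inj_on g J"
    and snd: "\<And>j. j \<in> J \<Longrightarrow> snd (f j) = snd (g j)"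
    and mono: "\<And>j k. j \<in> J \<Longrightarrow> k \<in> J \<Longrightarrow> fst (f j) < fst (f k) \<longleftrightarrow> fst (g j) < fst (g k)"
  shows "same_order U E"
proof -
  define h where "h s = g (inv_into J f s)" for s
  have h: "h (f j) = g j" if "j \<in> J" for j
    unfolding h_def using inv_into_f_f[OF injU that] by simp
  have "bij_betw (g \<circ> inv_into J f) (strands U) (strands E)"
    unfolding U E
    by (rule bij_betw_trans[OF bij_betw_inv_into[OF inj_on_imp_bij_betw[OF injU]] inj_on_imp_bij_betw[OF injE]])
  then have "bij_betw h (strands U) (strands E)" by (simp add: h_def[abs_def] comp_def)
  then show ?thesis unfolding same_order_def
    by (intro exI[of _ h]) (auto simp: U h snd mono)
qed

section \<open>Sizes of multipartitions\<close>

lemma card_boxes: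
  assumes "partition mu"
  shows "card (boxes mu) = (\<Sum>r | mu r \<noteq> 0. mu r)"
proof -
  have "boxes mu = (SIGMA r:{r. mu r \<noteq> 0}. {1..mu r})"
  proof -
    have "mu 0 = 0" using assms by (simp add: partition_def)
    then have "(r, c) \<in> boxes mu \<longleftrightarrow> (r, c) \<in> (SIGMA r:{r. mu r \<noteq> 0}. {1..mu r})" for r c
      by (cases "r = 0") (auto simp: boxes_def)
    then show ?thesis by auto
  qed
  moreover have "finite {r. mu r \<noteq> 0}" using assms by (simp add: partition_def)
  ultimately show ?thesis by simp
qed

lemma msize_card_boxes:
  assumes "multipartition l mu"
  shows "msize l mu = (\<Sum>m = 1..l. card (boxes (mu m)))"
  unfolding msize_def
proof (rule sum.cong[OF refl])
  fix m assume "m \<in> {1..l}"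
  then have "partition (mu m)" using assms by (simp add: multipartition_def)
  then show "(\<Sum>r | mu m r \<noteq> 0. mu m r) = card (boxes (mu m))" by (simp add: card_boxes)
qed

text \<open>
  The arm and the leg of the hook from \<open>(1, 1)\<close> to \<open>(1, c)\<close> and \<open>(r, 1)\<close> lie in the diagram.
\<close>

lemma hook_le_card_boxes:
  assumes mu: "partition mu" and rc: "(r, c) \<in> boxes mu"
  shows "r + c \<le> card (boxes mu) + 1"
proof -
  let ?arm = "(\<lambda>j. (1 :: nat, j)) ` {1..c}" and ?leg = "(\<lambda>i. (i, 1 :: nat)) ` {2..r}"
  have pos: "1 \<le> r" "1 \<le> c" using rc by (auto simp: boxes_def)
  have sub: "?arm \<union> ?leg \<subseteq> boxes mu"
    using boxes_down_closed[OF mu rc] pos by auto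
  have "card (?arm \<union> ?leg) = card ?arm + card ?leg"
    by (intro card_Un_disjoint) auto
  moreover have "card ?arm = c" by (simp add: card_image inj_on_def)
  moreover have "card ?leg = r - 1" by (simp add: card_image inj_on_def)
  ultimately show ?thesis using card_mono[OF finite_boxes[OF mu] sub] pos by linarith
qed

lemma multipartition_component: "multipartition l mu \<Longrightarrow> 1 \<le> m \<Longrightarrow> m \<le> l \<Longrightarrow> partition (mu m)"
  by (simp add: multipartition_def)

lemma node_size:
  assumes "multipartition l mu" "(m, r, c) \<in> nodes l mu"
  shows "1 \<le> m" "m \<le> l" "1 \<le> r" "1 \<le> c" "r + c \<le> msize l mu + 1" "(r, c) \<in> boxes (mu m)"
proof -
  show m: "1 \<le> m" "m \<le> l" and rc: "(r, c) \<in> boxes (mu m)"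
    using assms(2) by (auto simp: nodes_def)
  show "1 \<le> r" "1 \<le> c" using rc by (auto simp: boxes_def)
  have "card (boxes (mu m)) \<le> msize l mu"
    unfolding msize_card_boxes[OF assms(1)] using m by (intro member_le_sum) auto
  then show "r + c \<le> msize l mu + 1"
    using hook_le_card_boxes[OF multipartition_component[OF assms(1) m] rc] by linarith
qed

lemma finite_nodes:
  assumes "multipartition l mu"
  shows "finite (nodes l mu)"
proof -
  have "nodes l mu = (SIGMA m:{1..l}. boxes (mu m))" by (auto simp: nodes_def)
  moreover have "finite (boxes (mu m))" if "m \<in> {1..l}" for m
    using that multipartition_component[OF assms] by (intro finite_boxes) auto
  ultimately show ?thesis by (simp only: finite_SigmaI finite_atLeastAtMost)
qed

section \<open>Diagrams whose strings gather in columns\<close>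

definition node_res :: "nat \<Rightarrow> (nat \<Rightarrow> int) \<Rightarrow> nat \<times> nat \<times> nat \<Rightarrow> int" where
  "node_res p \<rho> = (\<lambda>(m, A). box_res p (\<rho> m) A)"

text \<open>
  Red strings are indexed by \<open>(m, 0, 0)\<close>, which is no node, so that the index determines a sort key
  in the same way for all three kinds of strings.
\<close>

definition string_index :: "nat \<Rightarrow> (nat \<Rightarrow> nat \<Rightarrow> nat) \<Rightarrow> (kind \<times> nat \<times> nat \<times> nat) set" where
  "string_index l mu = {Solid, Ghost} \<times> nodes l mu \<union> {Red} \<times> (\<lambda>m. (m, 0, 0)) ` {1..l}"

text \<open>
  Component, column and depth.  Columns are counted in steps of 2, since the red string sits between
  column 0 and column 1; the ghost of a node belongs to the column to the right of that of the node.
  The sign in the last entry reflects that positions decrease with \<open>r + c\<close>.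
\<close>

definition string_key :: "kind \<times> nat \<times> nat \<times> nat \<Rightarrow> int \<times> int \<times> int" where
  "string_key = (\<lambda>(k, m, r, c).
     (int m, if k = Red then 1 else 2 * (int c - int r + (if k = Ghost then 1 else 0)), - int (r + c)))"

definition lex_less :: "int \<times> int \<times> int \<Rightarrow> int \<times> int \<times> int \<Rightarrow> bool" where
  "lex_less = (\<lambda>(a, b, c) (a', b', c'). a < a' \<or> a = a' \<and> (b < b' \<or> b = b' \<and> c < c'))"

lemma lex_less_cases: "lex_less x y \<or> x = y \<or> lex_less y x"
  by (cases x; cases y) (auto simp: lex_less_def)

text \<open>
  A solid and a ghost string of the same column have contents of different parity, so they differ in
  the parity of \<open>r + c\<close>.
\<close>

lemma inj_string_key: "inj_on string_key (string_index l mu)"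
proof (rule inj_onI)
  fix i j assume i: "i \<in> string_index l mu" and j: "j \<in> string_index l mu"
    and eq: "string_key i = string_key j"
  obtain k m r c where ik: "i = (k, m, r, c)" by (cases i) auto
  obtain k' m' r' c' where jk: "j = (k', m', r', c')" by (cases j) auto
  have red0: "r = 0 \<and> c = 0" if "k = Red" using i that by (auto simp: string_index_def ik)
  have red0': "r' = 0 \<and> c' = 0" if "k' = Red" using j that by (auto simp: string_index_def jk)
  have m: "m = m'" and s: "r + c = r' + c'"
    using eq by (auto simp: ik jk string_key_def)
  have lev: "(if k = Red then 1 else 2 * (int c - int r + (if k = Ghost then 1 else 0))) =
      (if k' = Red then 1 else 2 * (int c' - int r' + (if k' = Ghost then 1 else 0)))"
    using eq by (simp add: ik jk string_key_def)
  have red: "k = Red \<longleftrightarrow> k' = Red"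
  proof (rule ccontr)
    assume "(k = Red) \<noteq> (k' = Red)"
    then obtain z :: int where "1 = 2 * z" using lev by (metis (full_types))
    then show False by presburger
  qed
  show "i = j"
  proof (cases "k = Red")
    case True
    then show ?thesis using red red0 red0' m by (simp add: ik jk)
  next
    case False
    then have "int c - int r + (if k = Ghost then 1 else 0) = int c' - int r' + (if k' = Ghost then 1 else 0)"
      using lev red by simp
    moreover from this have "(k = Ghost) = (k' = Ghost)" using s by (auto split: if_splits) presburger+
    moreover from this have "k = k'" using False red by (cases k; cases k') auto
    ultimately show ?thesis using s m by (auto simp: ik jk)
  qed
qed

text \<open>
  Column \<open>k\<close> of component \<open>m\<close> ends at \<open>\<kappa> m + base m k\<close>, and inside a column the strings are at
  distances that are multiples of \<open>\<zeta>\<close>.  The axiom \<open>shift_base\<close> says that the ghost shift carries a column to the next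
  one; the two diagrams needed differ in their column positions and ghost shifts only.  The axioms
  leave a margin of \<open>2 * \<zeta>\<close> between columns, which absorbs the displacement of new strings after
  subdivision.
\<close>

locale layout =
  fixes p l N :: nat and \<kappa> \<rho> :: "nat \<Rightarrow> int" and mu :: "nat \<Rightarrow> nat \<Rightarrow> nat"
    and base :: "nat \<Rightarrow> int \<Rightarrow> real" and \<zeta> :: real and sh :: "int \<Rightarrow> real"
  assumes p2: "2 \<le> p"
    and rho: "\<And>m. 1 \<le> m \<Longrightarrow> m \<le> l \<Longrightarrow> \<rho> m \<in> {0..<int p}"
    and mu: "multipartition l mu" and size: "msize l mu \<le> N"
    and gap: "\<And>m m'. 1 \<le> m \<Longrightarrow> m < m' \<Longrightarrow> m' \<le> l \<Longrightarrow> \<kappa> m + 2 * int N + 2 \<le> \<kappa> m'"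
    and zeta: "0 < \<zeta>"
    and level_step: "\<And>m k. 1 \<le> m \<Longrightarrow> m \<le> l \<Longrightarrow> base m k + real (N + 3) * \<zeta> < base m (k + 1)"
    and base0: "\<And>m. 1 \<le> m \<Longrightarrow> m \<le> l \<Longrightarrow> base m 0 \<le> 0"
    and base1: "\<And>m. 1 \<le> m \<Longrightarrow> m \<le> l \<Longrightarrow> real (N + 1) * \<zeta> < base m 1"
    and bounds: "\<And>m k. 1 \<le> m \<Longrightarrow> m \<le> l \<Longrightarrow> - int N \<le> k \<Longrightarrow> k \<le> int N \<Longrightarrow>
      base m k \<le> real N \<and> - real N - 1 \<le> base m k - real (N + 1) * \<zeta>"
    and shift_base: "\<And>m k. 1 \<le> m \<Longrightarrow> m \<le> l \<Longrightarrow> base m k + sh ((k + \<rho> m) mod int p) = base m (k + 1)"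
    and shift_pos: "\<And>i. 0 \<le> i \<Longrightarrow> i < int p \<Longrightarrow> 0 < sh i"
begin

definition place :: "nat \<Rightarrow> int \<Rightarrow> nat \<Rightarrow> real" where
  "place m k s = real_of_int (\<kappa> m) + base m k - real s * \<zeta>"

definition pos :: "nat \<times> nat \<times> nat \<Rightarrow> real" where
  "pos = (\<lambda>(m, r, c). place m (int c - int r) (r + c))"

definition diagram_of :: diagram where
  "diagram_of = \<lparr> modulus = p, shift = sh, solids = (\<lambda>A. (pos A, node_res p \<rho> A)) ` nodes l mu,
     reds = (\<lambda>m. (real_of_int (\<kappa> m), \<rho> m)) ` {1..l} \<rparr>"

definition string :: "kind \<times> nat \<times> nat \<times> nat \<Rightarrow> real \<times> kind \<times> int" where
  "string = (\<lambda>(k, A). case k of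
      Solid \<Rightarrow> (pos A, Solid, node_res p \<rho> A)
    | Ghost \<Rightarrow> (pos A + sh (node_res p \<rho> A), Ghost, node_res p \<rho> A)
    | Red \<Rightarrow> (real_of_int (\<kappa> (fst A)), Red, \<rho> (fst A)))"

lemma base_mono:
  assumes m: "1 \<le> m" "m \<le> l" and "k \<le> k'"
  shows "base m k \<le> base m k'"
  using assms(3)
proof (induction rule: int_ge_induct)
  case (step j)
  have "0 \<le> real (N + 3) * \<zeta>" using zeta by simp
  then show ?case using step.IH level_step[OF m, of j] by linarith
qed simp

lemma place_less_level:
  assumes m: "1 \<le> m" "m \<le> l" and k: "k < k'" and s: "s' \<le> N + 1"
  shows "place m k s + 2 * \<zeta> < place m k' s'"
proof -
  have 1: "base m k + real (N + 3) * \<zeta> < base m k'"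
    using level_step[OF m, of k] base_mono[OF m, of "k + 1" k'] k by linarith
  have 2: "real s' * \<zeta> \<le> real (N + 1) * \<zeta>" using s zeta by (intro mult_right_mono) auto
  have 3: "0 \<le> real s * \<zeta>" using zeta by simp
  have "real (N + 3) * \<zeta> = real (N + 1) * \<zeta> + 2 * \<zeta>" by (simp add: algebra_simps)
  then show ?thesis using 1 2 3 unfolding place_def by linarith
qed

lemma place_less_depth: "s' < s \<Longrightarrow> place m k s < place m k s'"
  using zeta by (simp add: place_def)

lemma place_diff: "place m k s' - place m k s = (real s - real s') * \<zeta>"
  by (simp add: place_def algebra_simps)

lemma place_bounds:
  assumes m: "1 \<le> m" "m \<le> l" and k: "- int N \<le> k" "k \<le> int N" and s: "s \<le> N + 1"
  shows "real_of_int (\<kappa> m) - real N - 1 \<le> place m k s" "place m k s \<le> real_of_int (\<kappa> m) + real N"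
proof -
  have "0 \<le> real s * \<zeta>" using zeta by simp
  moreover have "real s * \<zeta> \<le> real (N + 1) * \<zeta>" using s zeta by (intro mult_right_mono) auto
  ultimately show "real_of_int (\<kappa> m) - real N - 1 \<le> place m k s" "place m k s \<le> real_of_int (\<kappa> m) + real N"
    using bounds[OF m k] unfolding place_def by linarith+
qed

lemma gap_real:
  assumes "1 \<le> m" "m < m'" "m' \<le> l"
  shows "real_of_int (\<kappa> m) + 2 * real N + 2 \<le> real_of_int (\<kappa> m')"
  using gap[OF assms] by linarith

lemma place_less_component:
  assumes "1 \<le> m" "m < m'" "m' \<le> l" "- int N \<le> k" "k \<le> int N" "- int N \<le> k'" "k' \<le> int N"
    and "s \<le> N + 1" "s' \<le> N + 1"
  shows "place m k s < place m' k' s'"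
proof -
  have "m \<le> l" "1 \<le> m'" using assms by auto
  then show ?thesis
    using gap_real[OF assms(1-3)] place_bounds(2)[of m k s] place_bounds(1)[of m' k' s'] assms by linarith
qed

lemma place_red:
  assumes m: "1 \<le> m" "m \<le> l" and s: "1 \<le> s" "s \<le> N + 1"
  shows "k \<le> 0 \<Longrightarrow> place m k s < real_of_int (\<kappa> m)"
    and "1 \<le> k \<Longrightarrow> real_of_int (\<kappa> m) < place m k s"
proof -
  have "0 < real s * \<zeta>" using zeta s by simp
  then show "place m k s < real_of_int (\<kappa> m)" if "k \<le> 0"
    using base_mono[OF m that] base0[OF m] unfolding place_def by linarith
  have "real s * \<zeta> \<le> real (N + 1) * \<zeta>" using s zeta by (intro mult_right_mono) auto
  then show "real_of_int (\<kappa> m) < place m k s" if "1 \<le> k"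
    using base_mono[OF m that] base1[OF m] unfolding place_def by linarith
qed

lemma place_red_component:
  assumes "- int N \<le> k" "k \<le> int N" "s \<le> N + 1" "1 \<le> m" "m < m'" "m' \<le> l"
  shows "place m k s < real_of_int (\<kappa> m')"
    and "real_of_int (\<kappa> m) < place m' k s"
proof -
  have "m \<le> l" "1 \<le> m'" using assms by auto
  then show "place m k s < real_of_int (\<kappa> m')" "real_of_int (\<kappa> m) < place m' k s"
    using gap_real[OF assms(4-6)] place_bounds(2)[of m k s] place_bounds(1)[of m' k s] assms by linarith+
qed

lemma node_bounds:
  assumes "(m, r, c) \<in> nodes l mu"
  shows "1 \<le> m" "m \<le> l" "1 \<le> r" "1 \<le> c" "r + c \<le> N + 1"
    "- int N \<le> int c - int r" "int c - int r + 1 \<le> int N"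
  using node_size[OF mu assms] size by linarith+

lemma ghost_place:
  assumes "(m, r, c) \<in> nodes l mu"
  shows "pos (m, r, c) + sh (node_res p \<rho> (m, r, c)) = place m (int c - int r + 1) (r + c)"
  using shift_base[OF node_bounds(1,2)[OF assms], of "int c - int r"]
  by (simp add: pos_def place_def node_res_def box_res_def)

lemma strands_diagram_of: "strands diagram_of = string ` string_index l mu"
proof -
  have "strands diagram_of = (\<lambda>A. string (Solid, A)) ` nodes l mu \<union> (\<lambda>A. string (Ghost, A)) ` nodes l mu
      \<union> (\<lambda>m. string (Red, m, 0, 0)) ` {1..l}"
  proof -
    have "{(x, Solid, i) |x i. (x, i) \<in> solids diagram_of} = (\<lambda>A. string (Solid, A)) ` nodes l mu"
      "{(x + shift diagram_of i, Ghost, i) |x i. (x, i) \<in> solids diagram_of} =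
        (\<lambda>A. string (Ghost, A)) ` nodes l mu"
      "{(x, Red, i) |x i. (x, i) \<in> reds diagram_of} = (\<lambda>m. string (Red, m, 0, 0)) ` {1..l}"
      by (auto simp: diagram_of_def string_def)
    then show ?thesis unfolding strands_def by (simp only:)
  qed
  also have "\<dots> = string ` string_index l mu"
    unfolding string_index_def by (auto simp: image_iff)
  finally show ?thesis .
qed

lemma fst_string:
  assumes "(k, m, r, c) \<in> string_index l mu" "k \<noteq> Red"
  shows "fst (string (k, m, r, c)) = place m (int c - int r + (if k = Ghost then 1 else 0)) (r + c)"
    and "(m, r, c) \<in> nodes l mu"
proof -
  show A: "(m, r, c) \<in> nodes l mu" using assms by (auto simp: string_index_def)
  show "fst (string (k, m, r, c)) = place m (int c - int r + (if k = Ghost then 1 else 0)) (r + c)"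
  proof (cases k)
    case Solid then show ?thesis by (simp add: string_def pos_def)
  next
    case Ghost then show ?thesis using ghost_place[OF A] by (simp add: string_def)
  qed (use assms in simp)
qed

text \<open>
  Components are separated by \<open>gap\<close>, columns by \<open>level_step\<close>, and strings of one column by \<open>\<zeta>\<close>.
\<close>

lemma string_mono:
  assumes i: "i \<in> string_index l mu" and j: "j \<in> string_index l mu"
    and less: "lex_less (string_key i) (string_key j)"
  shows "fst (string i) < fst (string j)"
proof -
  obtain k m r c where ik: "i = (k, m, r, c)" by (cases i) auto
  obtain k' m' r' c' where jk: "j = (k', m', r', c')" by (cases j) auto
  define v where "v = int c - int r + (if k = Ghost then 1 else 0)"
  define v' where "v' = int c' - int r' + (if k' = Ghost then 1 else 0)"
  have L: "m < m' \<or> m = m' \<and> ((if k = Red then 1 else 2 * v) < (if k' = Red then 1 else 2 * v') \<or>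
      (if k = Red then 1 else 2 * v) = (if k' = Red then 1 else 2 * v') \<and> r' + c' < r + c)"
    using less unfolding ik jk string_key_def lex_less_def v_def v'_def by auto
  have i': "1 \<le> m" "m \<le> l" and j': "1 \<le> m'" "m' \<le> l"
    using i j by (auto simp: ik jk string_index_def nodes_def)
  have fi: "fst (string i) = place m v (r + c)" "- int N \<le> v" "v \<le> int N" "r + c \<le> N + 1" "1 \<le> r + c"
    if "k \<noteq> Red"
    using fst_string[OF i[unfolded ik] that] node_bounds[of m r c] by (auto simp: ik v_def)
  have fj: "fst (string j) = place m' v' (r' + c')" "- int N \<le> v'" "v' \<le> int N" "r' + c' \<le> N + 1" "1 \<le> r' + c'"
    if "k' \<noteq> Red"
    using fst_string[OF j[unfolded jk] that] node_bounds[of m' r' c'] by (auto simp: jk v'_def)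
  have ri: "fst (string i) = real_of_int (\<kappa> m)" "r + c = 0" if "k = Red"
    using that i by (auto simp: ik string_def string_index_def)
  have rj: "fst (string j) = real_of_int (\<kappa> m')" "r' + c' = 0" if "k' = Red"
    using that j by (auto simp: jk string_def string_index_def)
  consider "m < m'" | "m = m'" using L by blast
  then show ?thesis
  proof cases
    case 1
    note comp = i'(1) 1 j'(2)
    show ?thesis
    proof (cases "k = Red"; cases "k' = Red")
      assume "k = Red" "k' = Red"
      then show ?thesis using ri rj gap_real[OF comp] by simp
    next
      assume "k = Red" "k' \<noteq> Red"
      then show ?thesis using ri fj place_red_component(2)[OF _ _ _ comp] by simp
    next
      assume "k \<noteq> Red" "k' = Red"
      then show ?thesis using fi rj place_red_component(1)[OF _ _ _ comp] by simp
    next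
      assume "k \<noteq> Red" "k' \<noteq> Red"
      then show ?thesis using fi fj place_less_component[OF comp] by simp
    qed
  next
    case 2
    show ?thesis
    proof (cases "k = Red"; cases "k' = Red")
      assume "k = Red" "k' = Red"
      then show ?thesis using L 2 ri rj by simp
    next
      assume *: "k = Red" "k' \<noteq> Red"
      then have "1 \<le> v'" using L 2 ri(2) by auto
      then show ?thesis using * 2 ri(1) fj place_red(2)[OF i'] by simp
    next
      assume *: "k \<noteq> Red" "k' = Red"
      have "1 \<noteq> 2 * v" by presburger
      then have "v \<le> 0" using L 2 * by auto
      then show ?thesis using * 2 rj(1) fi place_red(1)[OF i'] by simp
    next
      assume *: "k \<noteq> Red" "k' \<noteq> Red"
      then consider "v < v'" | "v = v'" "r' + c' < r + c" using L 2 by auto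
      then show ?thesis
      proof cases
        case 1
        then show ?thesis using place_less_level[OF i' 1, of "r' + c'" "r + c"] fi fj * 2 zeta by simp
      next
        case b: 2
        then show ?thesis using place_less_depth[OF b(2), of m v] fi fj * 2 by simp
      qed
    qed
  qed
qed

lemma string_less_iff:
  assumes i: "i \<in> string_index l mu" and j: "j \<in> string_index l mu"
  shows "fst (string i) < fst (string j) \<longleftrightarrow> lex_less (string_key i) (string_key j)"
proof -
  consider "lex_less (string_key i) (string_key j)" | "i = j" | "lex_less (string_key j) (string_key i)"
    using lex_less_cases inj_onD[OF inj_string_key _ i j] by metis
  then show ?thesis
  proof cases
    case 1 then show ?thesis using string_mono[OF i j] by simp
  next
    case 2 then show ?thesis by (auto simp: lex_less_def split: prod.splits)
  next
    case 3
    then have "\<not> lex_less (string_key i) (string_key j)" by (auto simp: lex_less_def split: prod.splits)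
    then show ?thesis using string_mono[OF j i 3] by simp
  qed
qed

lemma inj_fst_string: "inj_on (\<lambda>j. fst (string j)) (string_index l mu)"
proof (rule inj_onI)
  fix i j assume *: "i \<in> string_index l mu" "j \<in> string_index l mu" "fst (string i) = fst (string j)"
  then have "\<not> lex_less (string_key i) (string_key j)" "\<not> lex_less (string_key j) (string_key i)"
    using string_mono[of i j] string_mono[of j i] by auto
  then have "string_key i = string_key j" using lex_less_cases by blast
  then show "i = j" using inj_onD[OF inj_string_key] * by blast
qed

lemma inj_string: "inj_on string (string_index l mu)"
  by (rule inj_onI) (metis inj_fst_string inj_onD)

lemma node_res_range: "node_res p \<rho> A \<in> {0..<int p}"
  using p2 by (cases A) (simp add: node_res_def box_res_def)

lemma idempotent_diagram_of: "idempotent_diagram diagram_of"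
  unfolding idempotent_diagram_def
proof (intro conjI)
  show "inj_on fst (strands diagram_of)"
    unfolding strands_diagram_of
    using inj_fst_string by (intro inj_on_imageI) (simp add: comp_def)
  show "2 \<le> modulus diagram_of" using p2 by (simp add: diagram_of_def)
  show "\<forall>i\<in>{0..<int (modulus diagram_of)}. 0 < shift diagram_of i"
    using shift_pos by (simp add: diagram_of_def)
  show "finite (solids diagram_of)" "finite (reds diagram_of)"
    using finite_nodes[OF mu] by (simp_all add: diagram_of_def)
  show "snd ` solids diagram_of \<subseteq> {0..<int (modulus diagram_of)}"
    using node_res_range by (auto simp: diagram_of_def)
  show "snd ` reds diagram_of \<subseteq> {0..<int (modulus diagram_of)}"
    using rho by (auto simp: diagram_of_def)
qed

lemma inj_node_string: "inj_on (\<lambda>A. (pos A, node_res p \<rho> A)) (nodes l mu)"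
proof (rule inj_onI)
  fix A B assume *: "A \<in> nodes l mu" "B \<in> nodes l mu" "(pos A, node_res p \<rho> A) = (pos B, node_res p \<rho> B)"
  then have "string (Solid, A) = string (Solid, B)" by (simp add: string_def)
  moreover have "(Solid, A) \<in> string_index l mu" "(Solid, B) \<in> string_index l mu"
    using * by (simp_all add: string_index_def)
  ultimately have "(Solid, A) = (Solid, B)" using inj_string by (blast dest: inj_onD)
  then show "A = B" by simp
qed

end

text \<open>
  The sort keys do not depend on the positions of the columns.
\<close>

lemma layouts_same_order:
  assumes "layout p l N \<kappa> \<rho> mu base \<zeta> sh" and "layout p l N' \<kappa> \<rho> mu base' \<zeta>' sh'"
  shows "same_order (layout.diagram_of p l \<kappa> \<rho> mu base \<zeta> sh)
    (layout.diagram_of p l \<kappa> \<rho> mu base' \<zeta>' sh')"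
proof -
  interpret L: layout p l N \<kappa> \<rho> mu base \<zeta> sh by fact
  interpret L': layout p l N' \<kappa> \<rho> mu base' \<zeta>' sh' by fact
  show ?thesis
  proof (rule same_order_indexed[OF L.strands_diagram_of L'.strands_diagram_of L.inj_string L'.inj_string])
    fix i assume "i \<in> string_index l mu"
    show "snd (L.string i) = snd (L'.string i)"
      by (cases i) (auto simp: L.string_def L'.string_def split: kind.splits)
  next
    fix i j assume "i \<in> string_index l mu" "j \<in> string_index l mu"
    then show "fst (L.string i) < fst (L.string j) \<longleftrightarrow> fst (L'.string i) < fst (L'.string j)"
      by (simp add: L.string_less_iff L'.string_less_iff)
  qed
qed

text \<open>
  The bound on \<open>\<delta>\<close> makes the offsets inside a column smaller than \<open>1 / lhat\<close>, so that together with
  \<open>m / lhat\<close> they stay below 1 and the column does not reach back to the preceding integer, where for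
  column 1 the red string is.
\<close>

lemma unit_layout:
  assumes p: "2 \<le> p" and l: "1 \<le> l" and rho: "\<And>m. 1 \<le> m \<Longrightarrow> m \<le> l \<Longrightarrow> \<rho> m \<in> {0..<int p}"
    and mu: "multipartition l mu" and N: "1 \<le> msize l mu"
    and gap: "\<And>m m'. 1 \<le> m \<Longrightarrow> m < m' \<Longrightarrow> m' \<le> l \<Longrightarrow> \<kappa> m + 2 * int (msize l mu) + 2 \<le> \<kappa> m'"
    and small: "small_delta p l mu \<delta>"
  shows "layout p l (msize l mu) \<kappa> \<rho> mu (\<lambda>m k. real_of_int k - real m / real (lhat p l mu)) \<delta> (\<lambda>_. 1)"
    and "unit_diagram p l \<kappa> \<rho> \<delta> mu =
      layout.diagram_of p l \<kappa> \<rho> mu (\<lambda>m k. real_of_int k - real m / real (lhat p l mu)) \<delta> (\<lambda>_. 1)"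
proof -
  define n where "n = msize l mu"
  define h where "h = real (lhat p l mu)"
  have n: "1 \<le> real n" using N by (simp add: n_def)
  have "l + 2 \<le> lhat p l mu" using mult_le_mono[of 1 n 2 p] p N by (simp add: lhat_def n_def)
  then have h: "real l + 2 \<le> h" unfolding h_def by (metis of_nat_add of_nat_le_iff of_nat_numeral)
  have h3: "3 \<le> h" using h l by linarith
  have d0: "0 < \<delta>" using small by (simp add: small_delta_def)
  have "\<delta> < 1 / (2 * real n * h)" using small by (simp add: small_delta_def n_def h_def)
  then have d1: "2 * real n * \<delta> < 1 / h" using n h3 by (simp add: field_simps)
  have nd: "\<delta> \<le> real n * \<delta>" using n d0 by simp
  have h13: "1 / h \<le> 1 / 3" using h3 by (simp add: field_simps)
  \<comment> \<open>From \<open>n + 3 \<le> 4 n\<close> and \<open>1 / h \<le> 1 / 3\<close>.\<close>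
  have d2: "real (n + 3) * \<delta> < 1" using d1 nd h13 by (simp add: algebra_simps)
  have d3: "real (n + 1) * \<delta> < 1 / h" using d1 nd by (simp add: algebra_simps)
  have mh: "0 \<le> real m / h" "real m / h + 1 / h < 1" if "m \<le> l" for m
  proof -
    show "0 \<le> real m / h" using h3 by simp
    have "real m + 1 < h" using h that by linarith
    then show "real m / h + 1 / h < 1" using h3 by (simp add: field_simps)
  qed
  show L: "layout p l (msize l mu) \<kappa> \<rho> mu (\<lambda>m k. real_of_int k - real m / real (lhat p l mu)) \<delta> (\<lambda>_. 1)"
  proof (unfold_locales, unfold n_def[symmetric] h_def[symmetric])
    show "2 \<le> p" by fact
    show "\<rho> m \<in> {0..<int p}" if "1 \<le> m" "m \<le> l" for m using rho that by blast
    show "multipartition l mu" by fact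
    show "n \<le> n" by simp
    show "\<kappa> m + 2 * int n + 2 \<le> \<kappa> m'" if "1 \<le> m" "m < m'" "m' \<le> l" for m m'
      using gap[OF that] by (simp add: n_def)
    show "0 < \<delta>" by fact
    show "real_of_int k - real m / h + real (n + 3) * \<delta> < real_of_int (k + 1) - real m / h" for m k
      using d2 by simp
    show "real_of_int 0 - real m / h \<le> 0" if "m \<le> l" for m using mh(1)[OF that] by simp
    show "real (n + 1) * \<delta> < real_of_int 1 - real m / h" if "m \<le> l" for m
      using mh(2)[OF that] d3 by simp
    show "real_of_int k - real m / h \<le> real n \<and> - real n - 1 \<le> real_of_int k - real m / h - real (n + 1) * \<delta>"
      if "m \<le> l" "- int n \<le> k" "k \<le> int n" for m k
    proof -
      have "- real n \<le> real_of_int k" "real_of_int k \<le> real n" using that by linarith+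
      then show ?thesis using mh[OF that(1)] d3 by linarith
    qed
    show "real_of_int k - real m / h + 1 = real_of_int (k + 1) - real m / h" for m k by simp
    show "(0::real) < 1" by simp
  qed
  interpret L: layout p l "msize l mu" \<kappa> \<rho> mu "\<lambda>m k. real_of_int k - real m / real (lhat p l mu)" \<delta> "\<lambda>_. 1"
    by (rule L)
  have "node_pos p l \<kappa> \<delta> mu (m, r, c) = L.pos (m, r, c)" for m r c
    by (simp add: node_pos_def L.pos_def L.place_def algebra_simps)
  then show "unit_diagram p l \<kappa> \<rho> \<delta> mu = L.diagram_of"
    unfolding unit_diagram_def L.diagram_of_def node_res_def
    by (auto simp: case_prod_unfold intro!: image_cong)
qed

text \<open>
  The column positions: \<open>squeeze p (M - 1)\<close> stands still between the columns of residue 1 and 2 and has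
  slope 1 elsewhere, so the mixture \<open>f\<close> has slope \<open>\<epsilon>\<close> there and slope 1 elsewhere, which are the ghost
  shifts.
\<close>

lemma subdivided_layout:
  fixes \<epsilon> :: real
  defines "f \<equiv> \<lambda>p M. \<epsilon> * real_of_int M + (1 - \<epsilon>) * real_of_int (squeeze p (M - 1))"
  assumes p: "2 \<le> p" and rho: "\<And>m. 1 \<le> m \<Longrightarrow> m \<le> l \<Longrightarrow> \<rho> m \<in> {0..<int (p + 1)}"
    and mu: "multipartition l mu"
    and gap: "\<And>m m'. 1 \<le> m \<Longrightarrow> m < m' \<Longrightarrow> m' \<le> l \<Longrightarrow> \<kappa> m + 2 * int (msize l mu) + 2 \<le> \<kappa> m'"
    and eps: "0 < \<epsilon>" "\<epsilon> < 1"
  shows "layout (p + 1) l (msize l mu) \<kappa> \<rho> mu (\<lambda>m k. f p (k + \<rho> m) - f p (\<rho> m))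
    (\<epsilon> / (real (msize l mu) + 4)) (subdiv_shift \<epsilon>)"
proof -
  define n where "n = msize l mu"
  define z where "z = \<epsilon> / (real n + 4)"
  have z: "0 < z" using eps by (simp add: z_def)
  have "(real n + 4) * z = \<epsilon>" by (simp add: z_def)
  then have zz: "real (n + 3) * z < \<epsilon>" "real (n + 1) * z < \<epsilon>" using z by (simp_all add: algebra_simps)
  have f_Suc: "f p (M + 1) = f p M + subdiv_shift \<epsilon> (M mod int (p + 1))" for M
  proof -
    have "(M - 1) mod int (p + 1) = 0 \<longleftrightarrow> M mod int (p + 1) = 1"
    proof -
      have q: "0 < int (p + 1)" "int (p + 1) > 2" using p by auto
      show ?thesis using div_mod_Suc(2)[OF q(1), of "M - 1"] q pos_mod_sign[OF q(1), of "M - 1"]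
        by (auto split: if_splits)
    qed
    moreover have "squeeze p M = squeeze p (M - 1) + (if (M - 1) mod int (p + 1) = 0 then 0 else 1)"
      using squeeze_Suc[of p "M - 1"] p by simp
    ultimately show ?thesis by (simp add: f_def subdiv_shift_def algebra_simps)
  qed
  have sh: "\<epsilon> \<le> subdiv_shift \<epsilon> i" "subdiv_shift \<epsilon> i \<le> 1" for i
    using eps by (auto simp: subdiv_shift_def)
  define b where "b m k = f p (k + \<rho> m) - f p (\<rho> m)" for m k
  have b0: "b m 0 = 0" for m by (simp add: b_def)
  have b_Suc: "b m k + subdiv_shift \<epsilon> ((k + \<rho> m) mod int (p + 1)) = b m (k + 1)" for m k
    using f_Suc[of "k + \<rho> m"] by (simp add: b_def algebra_simps)
  have b_up: "0 \<le> b m k \<and> b m k \<le> real_of_int k" if "0 \<le> k" for m k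
    using that
  proof (induction rule: int_ge_induct)
    case (step k)
    then show ?case using b_Suc[of m k] sh[of "(k + \<rho> m) mod int (p + 1)"] eps by simp
  qed (simp add: b0)
  have b_down: "b m k \<le> 0 \<and> real_of_int k \<le> b m k" if "k \<le> 0" for m k
    using that
  proof (induction rule: int_le_induct)
    case (step k)
    then show ?case using b_Suc[of m "k - 1"] sh[of "(k - 1 + \<rho> m) mod int (p + 1)"] eps by simp
  qed (simp add: b0)
  show ?thesis
  proof (unfold_locales, unfold n_def[symmetric] z_def[symmetric] b_def[symmetric])
    show "2 \<le> p + 1" using p by simp
    show "\<rho> m \<in> {0..<int (p + 1)}" if "1 \<le> m" "m \<le> l" for m using rho that by blast
    show "multipartition l mu" by fact
    show "n \<le> n" by simp
    show "\<kappa> m + 2 * int n + 2 \<le> \<kappa> m'" if "1 \<le> m" "m < m'" "m' \<le> l" for m m'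
      using gap[OF that] by (simp add: n_def)
    show "0 < z" by fact
    show "b m k + real (n + 3) * z < b m (k + 1)" for m k
      using b_Suc[of m k] sh(1)[of "(k + \<rho> m) mod int (p + 1)"] zz by linarith
    show "b m 0 \<le> 0" for m by (simp add: b0)
    show "real (n + 1) * z < b m 1" for m
      using b_Suc[of m 0] sh(1)[of "(0 + \<rho> m) mod int (p + 1)"] zz b0[of m] by simp
    show "b m k \<le> real n \<and> - real n - 1 \<le> b m k - real (n + 1) * z"
      if "- int n \<le> k" "k \<le> int n" for m k
      using b_up[of k m] b_down[of k m] that zz eps by (cases "0 \<le> k") linarith+
    show "b m k + subdiv_shift \<epsilon> ((k + \<rho> m) mod int (p + 1)) = b m (k + 1)" for m k
      by (rule b_Suc)
    show "0 < subdiv_shift \<epsilon> i" for i using sh(1)[of i] eps by linarith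
  qed
qed

lemma coords_sum: "fst A + snd A = 2 * min (fst A) (snd A) + nat \<bar>content A\<bar>"
  by (cases A) (auto simp: content_def min_def)

section \<open>Distances in the diagram before subdivision\<close>

locale subdivision =
  fixes p l n :: nat and \<rho> \<kappa> :: "nat \<Rightarrow> int" and lam :: "nat \<Rightarrow> nat \<Rightarrow> nat" and \<delta> t \<epsilon> :: real
  assumes p2: "2 \<le> p" and l1: "1 \<le> l" and n1: "1 \<le> n"
    and rho: "\<And>m. 1 \<le> m \<Longrightarrow> m \<le> l \<Longrightarrow> \<rho> m \<in> {0..<int p}"
    and asym: "asymptotic n l \<kappa>"
    and multi: "multipartition l lam" and size: "msize l lam = n"
    and small: "small_delta p l lam \<delta>"
    and eps: "0 < \<epsilon>" "\<epsilon> < t"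
    and sep: "\<And>s s'. s \<in> strands (unit_diagram p l \<kappa> \<rho> \<delta> lam) \<Longrightarrow>
      s' \<in> strands (unit_diagram p l \<kappa> \<rho> \<delta> lam) \<Longrightarrow> s \<noteq> s' \<Longrightarrow> t + \<epsilon> < \<bar>fst s - fst s'\<bar>"
begin

abbreviation "D \<equiv> unit_diagram p l \<kappa> \<rho> \<delta> lam"
abbreviation "\<rho>' \<equiv> (\<lambda>m. raise_res (\<rho> m))"
abbreviation "nu \<equiv> lam_plus p \<rho> lam"
abbreviation "old_nodes \<equiv> nodes l lam"
abbreviation "new_nodes \<equiv> nodes l nu"
abbreviation "old_res \<equiv> node_res p \<rho>"
abbreviation "subdivided \<equiv> subdivide \<delta> t \<epsilon> D"

lemma comp: "1 \<le> m \<Longrightarrow> m \<le> l \<Longrightarrow> component p (\<rho> m)"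
  using rho p2 by unfold_locales auto

lemma kappa_gap:
  assumes "1 \<le> m" "m < m'" "m' \<le> l"
  shows "\<kappa> m + 4 * int n + 3 \<le> \<kappa> m'"
proof -
  have one: "\<kappa> j + 4 * int n + 3 \<le> \<kappa> (Suc j)" if "1 \<le> j" "j < l" for j
    using asym that unfolding asymptotic_def by force
  have "Suc m \<le> m'" using assms by simp
  then show ?thesis using assms(3)
  proof (induction rule: dec_induct)
    case base then show ?case using one[of m] assms by simp
  next
    case (step j) then show ?case using one[of j] assms by simp
  qed
qed

lemma old_layout: "layout p l n \<kappa> \<rho> lam (\<lambda>m k. real_of_int k - real m / real (lhat p l lam)) \<delta> (\<lambda>_. 1)"
  and old_diagram: "D = layout.diagram_of p l \<kappa> \<rho> lam (\<lambda>m k. real_of_int k - real m / real (lhat p l lam)) \<delta> (\<lambda>_. 1)"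
proof -
  have g: "\<kappa> m + 2 * int (msize l lam) + 2 \<le> \<kappa> m'" if "1 \<le> m" "m < m'" "m' \<le> l" for m m'
    using kappa_gap[OF that] size by simp
  have s: "1 \<le> msize l lam" using size n1 by simp
  show "layout p l n \<kappa> \<rho> lam (\<lambda>m k. real_of_int k - real m / real (lhat p l lam)) \<delta> (\<lambda>_. 1)"
    using unit_layout(1)[OF p2 l1 rho multi s g small] size by simp
  show "D = layout.diagram_of p l \<kappa> \<rho> lam (\<lambda>m k. real_of_int k - real m / real (lhat p l lam)) \<delta> (\<lambda>_. 1)"
    by (rule unit_layout(2)[OF p2 l1 rho multi s g small])
qed

sublocale old: layout p l n \<kappa> \<rho> lam "\<lambda>m k. real_of_int k - real m / real (lhat p l lam)" \<delta> "\<lambda>_. 1"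
  by (rule old_layout)

lemma D_simps:
  "modulus D = p" "shift D = (\<lambda>_. 1)"
  "solids D = (\<lambda>N. (old.pos N, old_res N)) ` old_nodes"
  "reds D = (\<lambda>m. (real_of_int (\<kappa> m), \<rho> m)) ` {1..l}"
  unfolding old_diagram old.diagram_of_def by simp_all

lemma old_strands:
  assumes "N \<in> old_nodes"
  shows "(old.pos N, Solid, old_res N) \<in> strands D"
    and "(old.pos N + 1, Ghost, old_res N) \<in> strands D"
  using assms by (auto simp: D_simps)

lemma old_node:
  assumes "(m, A) \<in> old_nodes"
  shows "1 \<le> m" "m \<le> l" "A \<in> boxes (lam m)" "2 \<le> fst A + snd A" "fst A + snd A \<le> n + 1"
    "- int n \<le> content A" "content A + 1 \<le> int n"
    "old.pos (m, A) = old.place m (content A) (fst A + snd A)"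
    "old.pos (m, A) + 1 = old.place m (content A + 1) (fst A + snd A)"
    "old_res (m, A) = box_res p (\<rho> m) A"
proof -
  obtain r c where A: "A = (r, c)" by (cases A)
  note b = old.node_bounds[OF assms[unfolded A]]
  show "1 \<le> m" "m \<le> l" by (rule b)+
  show "A \<in> boxes (lam m)" using assms by (simp add: nodes_def A)
  show "2 \<le> fst A + snd A" "fst A + snd A \<le> n + 1" "- int n \<le> content A" "content A + 1 \<le> int n"
    using b by (simp_all add: A content_def)
  show "old.pos (m, A) = old.place m (content A) (fst A + snd A)"
    by (simp add: old.pos_def A content_def)
  show "old.pos (m, A) + 1 = old.place m (content A + 1) (fst A + snd A)"
    by (simp add: old.pos_def A content_def old.place_def)
  show "old_res (m, A) = box_res p (\<rho> m) A" by (simp add: node_res_def)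
qed

lemma old_node_iff: "(m, A) \<in> old_nodes \<longleftrightarrow> 1 \<le> m \<and> m \<le> l \<and> A \<in> boxes (lam m)"
  by (cases A) (simp add: nodes_def)

lemma old_pos_inj: "N \<in> old_nodes \<Longrightarrow> N' \<in> old_nodes \<Longrightarrow> old.pos N = old.pos N' \<Longrightarrow> N = N'"
  using inj_onD[OF old.inj_fst_string, of "(Solid, N)" "(Solid, N')"]
  by (simp add: string_index_def old.string_def)

lemma delta_small: "0 < \<delta>" "\<delta> < 1"
proof -
  show d: "0 < \<delta>" by (rule old.zeta)
  have "real (n + 3) * \<delta> < 1" using old.level_step[of 1 0] l1 by simp
  moreover have "1 * \<delta> \<le> real (n + 3) * \<delta>" using d by (intro mult_right_mono) auto
  ultimately show "\<delta> < 1" by simp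
qed

text \<open>
  A solid string and its ghost are at distance 1.
\<close>

lemma t_less_1: "t + \<epsilon> < 1"
proof -
  have "(\<Sum>m = 1..l. card (boxes (lam m))) = n" using msize_card_boxes[OF multi] size by simp
  then have "\<exists>m\<in>{1..l}. card (boxes (lam m)) \<noteq> 0" using n1 by (metis not_one_le_zero sum.neutral)
  then obtain m where m: "1 \<le> m" "m \<le> l" "boxes (lam m) \<noteq> {}" by fastforce
  then obtain A where "A \<in> boxes (lam m)" by blast
  then have "(m, A) \<in> old_nodes" using m by (simp add: old_node_iff)
  from sep[OF old_strands[OF this]] show ?thesis by simp
qed

text \<open>
  A component with two boxes contains \<open>(1, 2)\<close> or \<open>(2, 1)\<close>, and one of these boxes gives together
  with \<open>(1, 1)\<close> a solid and a ghost string at distance \<open>\<delta>\<close>.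
\<close>

lemma t_less_delta:
  assumes "(m, A) \<in> old_nodes" "(m, B) \<in> old_nodes" "A \<noteq> B"
  shows "t + \<epsilon> < \<delta>"
proof -
  have m: "1 \<le> m" "m \<le> l" using old_node[OF assms(1)] by auto
  have mu: "partition (lam m)" using multi m by (rule multipartition_component)
  obtain r c where rc: "(r, c) \<in> boxes (lam m)" "(r, c) \<noteq> (1, 1)"
    using assms old_node(3)[OF assms(1)] old_node(3)[OF assms(2)]
    by (metis (no_types, lifting) prod.exhaust)
  have pos: "1 \<le> r" "1 \<le> c" using rc by (auto simp: boxes_def)
  have "(1, 1) \<in> boxes (lam m)" using boxes_down_closed[OF mu rc(1)] pos by simp
  then have 1: "(m, 1, 1) \<in> old_nodes" using m by (simp add: old_node_iff)
  \<comment> \<open>A diagram with a second box contains one of the neighbours of \<open>(1, 1)\<close>.\<close>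
  consider "2 \<le> c" | "2 \<le> r" using rc(2) pos by (metis One_nat_def Suc_1 Suc_leI le_neq_implies_less)
  then show ?thesis
  proof cases
    case 1: 1
    then have "(1, 2) \<in> boxes (lam m)" using boxes_down_closed[OF mu rc(1), of 1 2] pos by simp
    then have 2: "(m, 1, 2) \<in> old_nodes" using m by (simp add: old_node_iff)
    have "old.pos (m, 1, 1) + 1 - old.pos (m, 1, 2) = \<delta>"
      by (simp add: old.pos_def old.place_def)
    then show ?thesis using sep[OF old_strands(2)[OF \<open>(m, 1, 1) \<in> old_nodes\<close>] old_strands(1)[OF 2]] delta_small by simp
  next
    case 2: 2
    then have "(2, 1) \<in> boxes (lam m)" using boxes_down_closed[OF mu rc(1), of 2 1] pos by simp
    then have 2: "(m, 2, 1) \<in> old_nodes" using m by (simp add: old_node_iff)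
    have "old.pos (m, 1, 1) - (old.pos (m, 2, 1) + 1) = \<delta>"
      by (simp add: old.pos_def old.place_def)
    then show ?thesis using sep[OF old_strands(1)[OF \<open>(m, 1, 1) \<in> old_nodes\<close>] old_strands(2)[OF 2]] delta_small by simp
  qed
qed

section \<open>Close tuples and strips\<close>

text \<open>
  From right to left, as close tuples are listed.
\<close>

definition link :: "real \<times> kind \<times> int \<Rightarrow> real \<times> kind \<times> int \<Rightarrow> bool" where
  "link s s' \<longleftrightarrow> snd s' \<noteq> snd s \<and> fst s - fst s' = \<delta>"

definition strands01 :: "(real \<times> kind \<times> int) set" where
  "strands01 = {s \<in> strands D. snd s = (Ghost, 0) \<or> snd s = (Solid, 1)}"

lemma maximal_close_tuple_chain: "maximal_close_tuple \<delta> D ss \<longleftrightarrow> maximal_chain link strands01 ss"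
proof -
  have "close_tuple \<delta> D ss \<longleftrightarrow> chain link strands01 ss" for ss
    unfolding close_tuple_def chain_def link_def strands01_def by blast
  then show ?thesis unfolding maximal_close_tuple_def maximal_chain_def by simp
qed

definition strand01 :: "nat \<times> nat \<times> nat \<Rightarrow> real \<times> kind \<times> int" where
  "strand01 N = (if old_res N = 0 then (old.pos N + 1, Ghost, 0) else (old.pos N, Solid, 1))"

text \<open>
  The invariant of a strip.  The strings of its nodes all lie in the column with the next number.
\<close>

definition strip_level :: "nat \<times> nat \<times> nat \<Rightarrow> int" where
  "strip_level = (\<lambda>(m, A). content A - box_res p (\<rho> m) A)"

lemma strands01_iff:
  "s \<in> strands01 \<longleftrightarrow> (\<exists>N\<in>old_nodes. old_res N \<in> {0, 1} \<and> s = strand01 N)"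
proof
  assume s: "s \<in> strands01"
  obtain x k i where xki: "s = (x, k, i)" by (cases s)
  consider "k = Ghost" "i = 0" | "k = Solid" "i = 1" using s by (auto simp: strands01_def xki)
  then show "\<exists>N\<in>old_nodes. old_res N \<in> {0, 1} \<and> s = strand01 N"
  proof cases
    case 1
    then have "(x - 1, 0) \<in> solids D" using s by (simp add: strands01_def xki D_simps(2))
    then obtain N where "N \<in> old_nodes" "x - 1 = old.pos N" "old_res N = 0"
      unfolding D_simps by auto
    then show ?thesis using 1 by (intro bexI[of _ N]) (simp_all add: strand01_def xki)
  next
    case 2
    then have "(x, 1) \<in> solids D" using s by (simp add: strands01_def xki)
    then obtain N where "N \<in> old_nodes" "x = old.pos N" "old_res N = 1"
      unfolding D_simps by auto
    then show ?thesis using 2 by (intro bexI[of _ N]) (simp_all add: strand01_def xki)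
  qed
next
  assume "\<exists>N\<in>old_nodes. old_res N \<in> {0, 1} \<and> s = strand01 N"
  then obtain N where N: "N \<in> old_nodes" "old_res N \<in> {0, 1}" "s = strand01 N" by blast
  then show "s \<in> strands01"
    using old_strands[OF N(1)] by (auto simp: strands01_def strand01_def)
qed

lemma fst_strand01:
  assumes "(m, A) \<in> old_nodes" "old_res (m, A) \<in> {0, 1}"
  shows "fst (strand01 (m, A)) = old.place m (strip_level (m, A) + 1) (fst A + snd A)"
    and "- int n \<le> strip_level (m, A) + 1" "strip_level (m, A) + 1 \<le> int n"
  using assms(2) old_node[OF assms(1)] by (auto simp: strand01_def strip_level_def)

text \<open>
  A distance as small as \<open>\<delta>\<close> occurs only inside a column.
\<close>

lemma linked_nodes:
  assumes A: "(m, A) \<in> old_nodes" "old_res (m, A) \<in> {0, 1}"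
    and B: "(m', B) \<in> old_nodes" "old_res (m', B) \<in> {0, 1}"
    and link: "link (strand01 (m, A)) (strand01 (m', B))"
  shows "m = m'" "strip_level (m, A) = strip_level (m', B)"
proof -
  note a = old_node[OF A(1)] fst_strand01[OF A]
  note b = old_node[OF B(1)] fst_strand01[OF B]
  define k where "k = strip_level (m, A) + 1"
  define k' where "k' = strip_level (m', B) + 1"
  define s where "s = fst A + snd A"
  define s' where "s' = fst B + snd B"
  have k: "- int n \<le> k" "k \<le> int n" "s \<le> n + 1" using a by (simp_all add: k_def s_def)
  have k': "- int n \<le> k'" "k' \<le> int n" "s' \<le> n + 1" using b by (simp_all add: k'_def s'_def)
  have d: "old.place m k s - old.place m' k' s' = \<delta>"
    using link a(11) b(11) unfolding link_def k_def k'_def s_def s'_def by simp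
  have "\<not> m < m'"
    using old.place_less_component[of m m' k k' s s'] a(1) b(2) k k' d delta_small by auto
  moreover have "\<not> m' < m"
  proof
    assume "m' < m"
    from kappa_gap[OF b(1) this a(2)] have "real_of_int (\<kappa> m') + 4 * real n + 3 \<le> real_of_int (\<kappa> m)"
      by linarith
    then show False
      using old.place_bounds(1)[OF a(1,2) k] old.place_bounds(2)[OF b(1,2) k'] d delta_small n1 by linarith
  qed
  ultimately show m: "m = m'" by simp
  have "\<not> k < k'" using old.place_less_level[OF a(1,2), of k k' s' s] k' d m delta_small by auto
  moreover have "\<not> k' < k" using old.place_less_level[OF a(1,2), of k' k s s'] k d m delta_small by auto
  ultimately show "strip_level (m, A) = strip_level (m', B)" by (simp add: k_def k'_def)
qed

definition in_right_strip :: "real \<times> kind \<times> int \<Rightarrow> bool" where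
  "in_right_strip s \<longleftrightarrow>
    (\<exists>N\<in>old_nodes. old_res N \<in> {0, 1} \<and> s = strand01 N \<and> 0 \<le> strip_level N)"

text \<open>
  The string of the node above a 0-node, or to the left of a 1-node, lies at distance \<open>\<delta>\<close> to the right;
  so the node of the rightmost string of a maximal close tuple is in row 1 or in column 1, respectively.
\<close>

lemma first_strand01:
  assumes N: "(m, A) \<in> old_nodes" "old_res (m, A) \<in> {0, 1}"
    and first: "\<And>s. s \<in> strands01 \<Longrightarrow> \<not> link s (strand01 (m, A))"
  shows "0 \<le> strip_level (m, A) \<longleftrightarrow> old_res (m, A) = 0"
proof -
  obtain r c where A: "A = (r, c)" by (cases A)
  note a = old_node[OF N(1)]
  have mu: "partition (lam m)" using multi a(1,2) by (rule multipartition_component)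
  have pos: "1 \<le> r" "1 \<le> c" using a(3) by (auto simp: A boxes_def)
  interpret component p "\<rho> m" using a(1,2) by (rule comp)
  consider "old_res (m, A) = 0" | "old_res (m, A) = 1" using N(2) by auto
  then show ?thesis
  proof cases
    case 1
    have "r = 1"
    proof (rule ccontr)
      assume "r \<noteq> 1"
      then obtain r' where r': "r = Suc r'" "1 \<le> r'" using pos by (cases r) auto
      have B: "(m, r', c) \<in> old_nodes"
        using boxes_down_closed[OF mu a(3)[unfolded A], of r' c] r' pos a(1,2) by (simp add: old_node_iff)
      have res: "old_res (m, r', c) = 1" using res_next(1)[of "content A"] 1
        by (simp add: A r' node_res_def box_res_content content_def algebra_simps)
      have "strand01 (m, r', c) \<in> strands01" using B res by (auto simp: strands01_iff)
      moreover have "link (strand01 (m, r', c)) (strand01 (m, A))"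
        using 1 res by (simp add: link_def strand01_def A r' old.pos_def old.place_def algebra_simps)
      ultimately show False using first by blast
    qed
    then show ?thesis using 1 pos by (simp add: strip_level_def node_res_def A content_def)
  next
    case 2
    have "c = 1"
    proof (rule ccontr)
      assume "c \<noteq> 1"
      then obtain c' where c': "c = Suc c'" "1 \<le> c'" using pos by (cases c) auto
      have B: "(m, r, c') \<in> old_nodes"
        using boxes_down_closed[OF mu a(3)[unfolded A], of r c'] c' pos a(1,2) by (simp add: old_node_iff)
      have res: "old_res (m, r, c') = 0" using res_next(2)[of "content A"] 2
        by (simp add: A c' node_res_def box_res_content content_def algebra_simps)
      have "strand01 (m, r, c') \<in> strands01" using B res by (auto simp: strands01_iff)
      moreover have "link (strand01 (m, r, c')) (strand01 (m, A))"
        using 2 res by (simp add: link_def strand01_def A c' old.pos_def old.place_def algebra_simps)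
      ultimately show False using first by blast
    qed
    then show ?thesis using 2 pos by (simp add: strip_level_def node_res_def A content_def)
  qed
qed

lemma maximal_close_tuple_start:
  assumes "s \<in> strands01"
  shows "(\<exists>ss. maximal_chain link strands01 ss \<and> s \<in> set ss \<and> (snd (snd (hd ss)) = 0 \<longleftrightarrow> b)) \<longleftrightarrow>
    (in_right_strip s \<longleftrightarrow> b)"
proof (rule start_of_maximal_chain[where f = "\<lambda>s. - fst s" and T = "\<lambda>s. snd (snd s) = 0"])
  show "finite strands01"
  proof (rule finite_surj[OF finite_nodes[OF multi]])
    show "strands01 \<subseteq> strand01 ` old_nodes" by (auto simp: strands01_iff)
  qed
  show "- fst s < - fst s'" if "link s s'" for s s' using that delta_small by (simp add: link_def)
  show "in_right_strip s \<longleftrightarrow> in_right_strip s'"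
    if s: "s \<in> strands01" "s' \<in> strands01" and link: "link s s'" for s s'
  proof
    assume "in_right_strip s"
    then obtain N where N: "N \<in> old_nodes" "old_res N \<in> {0, 1}" "s = strand01 N" "0 \<le> strip_level N"
      unfolding in_right_strip_def by blast
    obtain N' where N': "N' \<in> old_nodes" "old_res N' \<in> {0, 1}" "s' = strand01 N'"
      using s(2) unfolding strands01_iff by blast
    have "strip_level N = strip_level N'"
      using linked_nodes(2)[of "fst N" "snd N" "fst N'" "snd N'"] N N' link by simp
    then show "in_right_strip s'" using N N' unfolding in_right_strip_def by auto
  next
    assume "in_right_strip s'"
    then obtain N' where N': "N' \<in> old_nodes" "old_res N' \<in> {0, 1}" "s' = strand01 N'" "0 \<le> strip_level N'"
      unfolding in_right_strip_def by blast
    obtain N where N: "N \<in> old_nodes" "old_res N \<in> {0, 1}" "s = strand01 N"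
      using s(1) unfolding strands01_iff by blast
    have "strip_level N = strip_level N'"
      using linked_nodes(2)[of "fst N" "snd N" "fst N'" "snd N'"] N N' link by simp
    then show "in_right_strip s" using N N' unfolding in_right_strip_def by auto
  qed
  show "in_right_strip s \<longleftrightarrow> snd (snd s) = 0"
    if s: "s \<in> strands01" and first: "\<And>s'. s' \<in> strands01 \<Longrightarrow> \<not> link s' s" for s
  proof -
    have start: "0 \<le> strip_level N \<longleftrightarrow> old_res N = 0"
      if "N \<in> old_nodes" "old_res N \<in> {0, 1}" "s = strand01 N" for N
      using first_strand01[of "fst N" "snd N"] that first by simp
    obtain N where N: "N \<in> old_nodes" "old_res N \<in> {0, 1}" "s = strand01 N"
      using s unfolding strands01_iff by blast
    have res: "snd (snd (strand01 N)) = 0 \<longleftrightarrow> old_res N = 0" for N by (simp add: strand01_def)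
    show ?thesis
    proof
      assume "in_right_strip s"
      then obtain M where "M \<in> old_nodes" "old_res M \<in> {0, 1}" "s = strand01 M" "0 \<le> strip_level M"
        unfolding in_right_strip_def by blast
      then show "snd (snd s) = 0" using start[of M] res[of M] by simp
    next
      assume "snd (snd s) = 0"
      then have "old_res N = 0" using res[of N] N(3) by simp
      then show "in_right_strip s" using start[OF N] N unfolding in_right_strip_def by blast
    qed
  qed
  show "s \<in> strands01" by fact
qed

text \<open>
  Maximal close tuples start as the corresponding maximal strips do, so the side on which the new
  string is added is decided by the content of the 0-node.
\<close>

lemma ghosts0_iff:
  "x \<in> ghosts0 \<delta> D 0 \<longleftrightarrow> (\<exists>N\<in>old_nodes. old_res N = 0 \<and> 0 \<le> content (snd N) \<and> x = old.pos N + 1)"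
  "x \<in> ghosts0 \<delta> D 1 \<longleftrightarrow> (\<exists>N\<in>old_nodes. old_res N = 0 \<and> content (snd N) < 0 \<and> x = old.pos N + 1)"
proof -
  have ghost: "(x, Ghost, 0) \<in> strands D \<longleftrightarrow> (\<exists>N\<in>old_nodes. old_res N = 0 \<and> x = old.pos N + 1)"
    by (auto simp: D_simps image_iff algebra_simps)
  have level: "strip_level N = content (snd N)" if "old_res N = 0" for N
    using that by (cases N) (simp add: strip_level_def node_res_def)
  have right: "in_right_strip (old.pos N + 1, Ghost, 0) \<longleftrightarrow> 0 \<le> content (snd N)"
    if N: "N \<in> old_nodes" "old_res N = 0" for N
  proof
    assume "in_right_strip (old.pos N + 1, Ghost, 0)"
    then obtain M where M: "M \<in> old_nodes" "(old.pos N + 1, Ghost, 0) = strand01 M" "0 \<le> strip_level M"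
      unfolding in_right_strip_def by blast
    then have "old_res M = 0" "old.pos N = old.pos M"
      by (auto simp: strand01_def split: if_splits)
    then show "0 \<le> content (snd N)" using old_pos_inj[OF N(1) M(1)] M(3) level[of M] by simp
  next
    assume "0 \<le> content (snd N)"
    then have "0 \<le> strip_level N" using level[OF N(2)] by simp
    then show "in_right_strip (old.pos N + 1, Ghost, 0)"
      unfolding in_right_strip_def using N by (intro bexI[of _ N]) (simp_all add: strand01_def)
  qed
  have S: "(x, Ghost, 0) \<in> strands01 \<longleftrightarrow> (x, Ghost, 0) \<in> strands D" by (simp add: strands01_def)
  have hd1: "snd (snd (hd ss)) = 1 \<longleftrightarrow> (snd (snd (hd ss)) = 0 \<longleftrightarrow> False)"
    if "maximal_chain link strands01 ss" for ss
  proof -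
    have "ss \<noteq> []" "set ss \<subseteq> strands01" using that by (simp_all add: maximal_chain_def chain_def)
    then have "hd ss \<in> strands01" using hd_in_set by blast
    then show ?thesis by (auto simp: strands01_def)
  qed
  have g: "x \<in> ghosts0 \<delta> D i \<longleftrightarrow> (x, Ghost, 0) \<in> strands D \<and>
      (\<exists>ss. maximal_chain link strands01 ss \<and> (x, Ghost, 0) \<in> set ss \<and> snd (snd (hd ss)) = i)" for i
    by (simp only: ghosts0_def maximal_close_tuple_chain mem_Collect_eq)
  have g0: "x \<in> ghosts0 \<delta> D 0 \<longleftrightarrow> (x, Ghost, 0) \<in> strands D \<and> in_right_strip (x, Ghost, 0)"
    unfolding g using maximal_close_tuple_start[of "(x, Ghost, 0)" True] S by auto
  have g1: "x \<in> ghosts0 \<delta> D 1 \<longleftrightarrow> (x, Ghost, 0) \<in> strands D \<and> \<not> in_right_strip (x, Ghost, 0)"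
    unfolding g using maximal_close_tuple_start[of "(x, Ghost, 0)" False] S hd1 by (metis (no_types, lifting))
  show "x \<in> ghosts0 \<delta> D 0 \<longleftrightarrow> (\<exists>N\<in>old_nodes. old_res N = 0 \<and> 0 \<le> content (snd N) \<and> x = old.pos N + 1)"
    unfolding g0 ghost using right by auto
  show "x \<in> ghosts0 \<delta> D 1 \<longleftrightarrow> (\<exists>N\<in>old_nodes. old_res N = 0 \<and> content (snd N) < 0 \<and> x = old.pos N + 1)"
    unfolding g1 ghost using right by (auto simp: not_le)
qed

end

context subdivision
begin

section \<open>The strings of the subdivided diagram\<close>

lemma nu_component: "nu m = (\<lambda>r. card {c. (r, c) \<in> plus_boxes p (\<rho> m) (lam m)})"
  by (rule ext) (simp add: lam_plus_def)

lemma nu_boxes: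
  assumes "1 \<le> m" "m \<le> l"
  shows "partition (nu m)" "boxes (nu m) = plus_boxes p (\<rho> m) (lam m)"
    "B \<in> boxes (nu m) \<longleftrightarrow> source_box p (\<rho> m) B \<in> boxes (lam m)"
proof -
  interpret component p "\<rho> m" using assms by (rule comp)
  have mu: "partition (lam m)" using multi assms by (rule multipartition_component)
  show "partition (nu m)" and *: "boxes (nu m) = plus_boxes p (\<rho> m) (lam m)"
    unfolding nu_component using plus_boxes_partition[OF mu] by simp_all
  show "B \<in> boxes (nu m) \<longleftrightarrow> source_box p (\<rho> m) B \<in> boxes (lam m)"
    unfolding * plus_boxes_source[OF mu] by simp
qed

lemma nu_multipartition: "multipartition l nu"
  unfolding multipartition_def
proof (intro conjI ballI allI impI)
  show "partition (nu m)" if "m \<in> {1..l}" for m using nu_boxes(1)[of m] that by simp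
  show "nu m = (\<lambda>_. 0)" if "m \<notin> {1..l}" for m
  proof -
    have "lam m = (\<lambda>_. 0)" using multi that by (simp add: multipartition_def)
    then have b: "boxes (lam m) = {}" by (auto simp: boxes_def)
    have "zero_nodes p (\<rho> m) (lam m) i = {}" for i
      unfolding zero_nodes_def maximal_strip_def strip_def b by auto
    then have "plus_boxes p (\<rho> m) (lam m) = {}" by (simp add: plus_boxes_def b)
    then show ?thesis unfolding nu_component by simp
  qed
qed

lemma nu_size: "1 \<le> msize l nu" "msize l nu \<le> 2 * n"
proof -
  have c: "card (boxes (nu m)) \<le> 2 * card (boxes (lam m))" "card (boxes (lam m)) \<le> card (boxes (nu m))"
    if "m \<in> {1..l}" for m
  proof -
    have m: "1 \<le> m" "m \<le> l" using that by auto
    interpret component p "\<rho> m" using m by (rule comp)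
    have mu: "partition (lam m)" using multi m by (rule multipartition_component)
    show "card (boxes (nu m)) \<le> 2 * card (boxes (lam m))" "card (boxes (lam m)) \<le> card (boxes (nu m))"
      unfolding nu_boxes(2)[OF m] using finite_card_plus_boxes[OF mu] by simp_all
  qed
  have n: "n = (\<Sum>m = 1..l. card (boxes (lam m)))" using msize_card_boxes[OF multi] size by simp
  have "n \<le> msize l nu" unfolding n msize_card_boxes[OF nu_multipartition] by (rule sum_mono) (rule c)
  then show "1 \<le> msize l nu" using n1 by simp
  show "msize l nu \<le> 2 * n"
    unfolding n msize_card_boxes[OF nu_multipartition] sum_distrib_left by (rule sum_mono) (rule c)
qed

lemma new_node_iff: "(m, B) \<in> new_nodes \<longleftrightarrow> 1 \<le> m \<and> m \<le> l \<and> (m, source_box p (\<rho> m) B) \<in> old_nodes"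
  unfolding old_node_iff by (cases B) (auto simp: nodes_def nu_boxes(3))

text \<open>
  The strings of the subdivided diagram, indexed by the nodes of the enlarged multipartition: a new
  box has residue 1 and stands for the solid string added next to the ghost of its 0-node.
\<close>

definition new_pos :: "nat \<times> nat \<times> nat \<Rightarrow> real" where
  "new_pos = (\<lambda>(m, B).
     if box_res (p + 1) (\<rho>' m) B = 1
     then old.pos (m, source_box p (\<rho> m) B) + 1 + (if 0 \<le> content B then - t else t)
     else old.pos (m, source_box p (\<rho> m) B))"

lemma subdivide_simps:
  "modulus subdivided = p + 1"
  "shift subdivided = subdiv_shift \<epsilon>"
  "reds subdivided = (\<lambda>m. (real_of_int (\<kappa> m), \<rho>' m)) ` {1..l}"
  by (auto simp: subdivide_def D_simps)

lemma source_content_nonneg: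
  assumes "1 \<le> m" "m \<le> l"
  shows "0 \<le> content (source_box p (\<rho> m) B) \<longleftrightarrow> 0 \<le> content B"
proof -
  interpret component p "\<rho> m" using assms by (rule comp)
  show ?thesis by (simp add: source_box_coords old_content_nonneg)
qed

lemma solids_subdivide:
  "solids subdivided = (\<lambda>N. (new_pos N, node_res (p + 1) \<rho>' N)) ` new_nodes"
proof (intro equalityI subsetI)
  fix s assume "s \<in> solids subdivided"
  then have "s \<in> (\<lambda>(x, i). (x, raise_res i)) ` solids D \<union> (\<lambda>x. (x - t, 1)) ` ghosts0 \<delta> D 0 \<union>
      (\<lambda>x. (x + t, 1)) ` ghosts0 \<delta> D 1"
    by (simp only: subdivide_def diagram.select_convs)
  then consider (kept) "s \<in> (\<lambda>(x, i). (x, raise_res i)) ` solids D"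
    | (right) "s \<in> (\<lambda>x. (x - t, 1)) ` ghosts0 \<delta> D 0" | (left) "s \<in> (\<lambda>x. (x + t, 1)) ` ghosts0 \<delta> D 1"
    by (elim UnE)
  then show "s \<in> (\<lambda>N. (new_pos N, node_res (p + 1) \<rho>' N)) ` new_nodes"
  proof cases
    case kept
    then obtain m A where A: "(m, A) \<in> old_nodes" "s = (old.pos (m, A), raise_res (box_res p (\<rho> m) A))"
      unfolding D_simps by (auto simp: node_res_def)
    note a = old_node[OF A(1)]
    interpret component p "\<rho> m" using a(1,2) by (rule comp)
    have "box_res p (\<rho> m) A \<ge> 0" using p2 by (simp add: box_res_content)
    then have "raise_res (box_res p (\<rho> m) A) \<noteq> 1" by (simp add: raise_res_def)
    then have "s = (new_pos (m, kept_box p (\<rho> m) A), node_res (p + 1) \<rho>' (m, kept_box p (\<rho> m) A))"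
      using A(2) kept_box_res[of A] by (simp add: new_pos_def node_res_def)
    moreover have "(m, kept_box p (\<rho> m) A) \<in> new_nodes" using A(1) a(1,2) by (simp add: new_node_iff)
    ultimately show ?thesis by (rule image_eqI)
  next
    case right
    then obtain m A where A: "(m, A) \<in> old_nodes" "box_res p (\<rho> m) A = 0" "0 \<le> content A"
        "s = (old.pos (m, A) + 1 - t, 1)"
      by (auto simp: ghosts0_iff node_res_def)
    note a = old_node[OF A(1)]
    interpret component p "\<rho> m" using a(1,2) by (rule comp)
    have src: "source_box p (\<rho> m) (added_box p (\<rho> m) A) = A" by (rule source_added_box) fact
    have "0 \<le> content (added_box p (\<rho> m) A)"
      using source_content_nonneg[OF a(1,2), of "added_box p (\<rho> m) A"] A(3) src by simp
    then have "s = (new_pos (m, added_box p (\<rho> m) A), node_res (p + 1) \<rho>' (m, added_box p (\<rho> m) A))"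
      using A(4) added_box_res[OF A(2)] by (simp add: new_pos_def node_res_def src)
    moreover have "(m, added_box p (\<rho> m) A) \<in> new_nodes" using A(1) a(1,2) by (simp add: new_node_iff src)
    ultimately show ?thesis by (rule image_eqI)
  next
    case left
    then obtain m A where A: "(m, A) \<in> old_nodes" "box_res p (\<rho> m) A = 0" "content A < 0"
        "s = (old.pos (m, A) + 1 + t, 1)"
      by (auto simp: ghosts0_iff node_res_def)
    note a = old_node[OF A(1)]
    interpret component p "\<rho> m" using a(1,2) by (rule comp)
    have src: "source_box p (\<rho> m) (added_box p (\<rho> m) A) = A" by (rule source_added_box) fact
    have "\<not> 0 \<le> content (added_box p (\<rho> m) A)"
      using source_content_nonneg[OF a(1,2), of "added_box p (\<rho> m) A"] A(3) src by simp
    then have "s = (new_pos (m, added_box p (\<rho> m) A), node_res (p + 1) \<rho>' (m, added_box p (\<rho> m) A))"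
      using A(4) added_box_res[OF A(2)] by (simp add: new_pos_def node_res_def src)
    moreover have "(m, added_box p (\<rho> m) A) \<in> new_nodes" using A(1) a(1,2) by (simp add: new_node_iff src)
    ultimately show ?thesis by (rule image_eqI)
  qed
next
  fix s assume "s \<in> (\<lambda>N. (new_pos N, node_res (p + 1) \<rho>' N)) ` new_nodes"
  then obtain m B where B: "(m, B) \<in> new_nodes" "s = (new_pos (m, B), node_res (p + 1) \<rho>' (m, B))" by auto
  then have m: "1 \<le> m" "m \<le> l" and A: "(m, source_box p (\<rho> m) B) \<in> old_nodes" by (auto simp: new_node_iff)
  interpret component p "\<rho> m" using m by (rule comp)
  let ?A = "source_box p (\<rho> m) B"
  have res: "box_res p (\<rho> m) ?A = max 0 (box_res (p + 1) (\<rho>' m) B - 1)" by (rule source_box_res)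
  show "s \<in> solids subdivided"
  proof (cases "box_res (p + 1) (\<rho>' m) B = 1")
    case False
    have "0 \<le> box_res (p + 1) (\<rho>' m) B" by (simp add: box_res_content)
    then have "raise_res (box_res p (\<rho> m) ?A) = box_res (p + 1) (\<rho>' m) B"
      using False res by (auto simp: raise_res_def max_def)
    then have "s = (old.pos (m, ?A), raise_res (old_res (m, ?A)))"
      using B(2) False by (simp add: new_pos_def node_res_def)
    moreover have "(old.pos (m, ?A), old_res (m, ?A)) \<in> solids D" using A by (auto simp: D_simps)
    ultimately have "s \<in> (\<lambda>(x, i). (x, raise_res i)) ` solids D" by force
    then show ?thesis by (simp add: subdivide_def)
  next
    case True
    then have r0: "old_res (m, ?A) = 0" using res by (simp add: node_res_def)
    show ?thesis
    proof (cases "0 \<le> content B")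
      case c: True
      then have "0 \<le> content ?A" by (simp add: source_content_nonneg[OF m])
      then have "old.pos (m, ?A) + 1 \<in> ghosts0 \<delta> D 0" using A r0 unfolding ghosts0_iff by force
      moreover have "s = (old.pos (m, ?A) + 1 - t, 1)"
        using True c B(2) by (simp add: new_pos_def node_res_def)
      ultimately have "s \<in> (\<lambda>x. (x - t, 1)) ` ghosts0 \<delta> D 0" by blast
      then show ?thesis by (simp add: subdivide_def)
    next
      case c: False
      then have "content ?A < 0" using source_content_nonneg[OF m, of B] by linarith
      then have "old.pos (m, ?A) + 1 \<in> ghosts0 \<delta> D 1" using A r0 unfolding ghosts0_iff by force
      moreover have "s = (old.pos (m, ?A) + 1 + t, 1)"
        using True c B(2) by (simp add: new_pos_def node_res_def)
      ultimately have "s \<in> (\<lambda>x. (x + t, 1)) ` ghosts0 \<delta> D 1" by blast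
      then show ?thesis by (simp add: subdivide_def)
    qed
  qed
qed

section \<open>The order of the strings after subdivision\<close>

text \<open>
  The order of solid strings of equal residue and, below, of a ghost and a solid string of the next
  residue, in terms of diagonal coordinates.  In the second case the strings of one column alternate, and which of two strings with
  the same \<open>q\<close> comes first depends on the side of the main diagonal.
\<close>

definition solid_before :: "nat \<times> nat \<times> nat \<Rightarrow> nat \<times> nat \<times> nat \<Rightarrow> bool" where
  "solid_before = (\<lambda>(m, B) (m', B'). m < m' \<or> m = m' \<and>
     (content B < content B' \<or> content B = content B' \<and> min (fst B') (snd B') < min (fst B) (snd B)))"

definition ghost_before :: "nat \<times> nat \<times> nat \<Rightarrow> nat \<times> nat \<times> nat \<Rightarrow> bool" where
  "ghost_before = (\<lambda>(m, B) (m', B'). m < m' \<or> m = m' \<and>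
     (content B + 1 < content B' \<or> content B + 1 = content B' \<and>
       (if 0 \<le> content B then min (fst B') (snd B') < min (fst B) (snd B)
        else min (fst B') (snd B') \<le> min (fst B) (snd B))))"

text \<open>
  The comparison of \<open>r + c\<close> for boxes on neighbouring diagonals.
\<close>

lemma depth_compare:
  fixes q q' :: nat and d :: int
  shows "2 * q' + nat \<bar>d + 1\<bar> < 2 * q + nat \<bar>d\<bar> \<longleftrightarrow> (if 0 \<le> d then q' < q else q' \<le> q)"
    and "2 * q' + nat \<bar>d + 1\<bar> \<noteq> 2 * q + nat \<bar>d\<bar>"
proof -
  show "2 * q' + nat \<bar>d + 1\<bar> < 2 * q + nat \<bar>d\<bar> \<longleftrightarrow> (if 0 \<le> d then q' < q else q' \<le> q)"
    by (cases "0 \<le> d") (simp_all, linarith+)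
  show "2 * q' + nat \<bar>d + 1\<bar> \<noteq> 2 * q + nat \<bar>d\<bar>"
  proof (cases "0 \<le> d")
    case True
    then have "nat \<bar>d + 1\<bar> = nat \<bar>d\<bar> + 1" by simp
    moreover have "2 * q' + 1 \<noteq> 2 * q" by presburger
    ultimately show ?thesis by linarith
  next
    case False
    then have "nat \<bar>d\<bar> = nat \<bar>d + 1\<bar> + 1" by simp
    moreover have "2 * q' \<noteq> 2 * q + 1" by presburger
    ultimately show ?thesis by linarith
  qed
qed

lemma layout_order:
  fixes base :: "nat \<Rightarrow> int \<Rightarrow> real"
  assumes "layout p' l N \<kappa> rr mu base \<zeta> sh" and "(m, B) \<in> nodes l mu" "(m', B') \<in> nodes l mu"
  defines "ps \<equiv> layout.pos \<kappa> base \<zeta>"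
  shows "ps (m, B) < ps (m', B') \<longleftrightarrow> solid_before (m, B) (m', B')"
    and "ps (m, B) + sh (node_res p' rr (m, B)) < ps (m', B') \<longleftrightarrow> ghost_before (m, B) (m', B')"
    and "1 \<le> j \<Longrightarrow> j \<le> l \<Longrightarrow> ps (m, B) < real_of_int (\<kappa> j) \<longleftrightarrow> m < j \<or> m = j \<and> content B \<le> 0"
proof -
  interpret L: layout p' l N \<kappa> rr mu base \<zeta> sh by fact
  have ps: "ps = L.pos" by (simp add: ps_def)
  have idx: "(Solid, m, B) \<in> string_index l mu" "(Ghost, m, B) \<in> string_index l mu"
      "(Solid, m', B') \<in> string_index l mu"
    using assms(2,3) by (simp_all add: string_index_def)
  obtain r c where B: "B = (r, c)" by (cases B)
  obtain r' c' where B': "B' = (r', c')" by (cases B')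
  have sums: "r + c = 2 * min r c + nat \<bar>content B\<bar>" "r' + c' = 2 * min r' c' + nat \<bar>content B'\<bar>"
    using coords_sum[of B] coords_sum[of B'] by (simp_all add: B B')
  have "ps (m, B) < ps (m', B') \<longleftrightarrow> lex_less (string_key (Solid, m, B)) (string_key (Solid, m', B'))"
    using L.string_less_iff[OF idx(1,3)] by (simp add: L.string_def ps)
  also have "\<dots> \<longleftrightarrow> m < m' \<or> m = m' \<and> (content B < content B' \<or> content B = content B' \<and> r' + c' < r + c)"
    by (auto simp: string_key_def lex_less_def B B' content_def)
  also have "\<dots> \<longleftrightarrow> solid_before (m, B) (m', B')"
    unfolding solid_before_def sums by (auto simp: B B')
  finally show "ps (m, B) < ps (m', B') \<longleftrightarrow> solid_before (m, B) (m', B')" .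
  have "ps (m, B) + sh (node_res p' rr (m, B)) < ps (m', B') \<longleftrightarrow>
      lex_less (string_key (Ghost, m, B)) (string_key (Solid, m', B'))"
    using L.string_less_iff[OF idx(2,3)] by (simp add: L.string_def ps)
  also have "\<dots> \<longleftrightarrow> m < m' \<or> m = m' \<and>
      (content B + 1 < content B' \<or> content B + 1 = content B' \<and> r' + c' < r + c)"
    by (auto simp: string_key_def lex_less_def B B' content_def)
  also have "\<dots> \<longleftrightarrow> ghost_before (m, B) (m', B')"
    unfolding ghost_before_def sums using depth_compare(1)[of "min r' c'" "content B" "min r c"]
    by (auto simp: B B')
  finally show "ps (m, B) + sh (node_res p' rr (m, B)) < ps (m', B') \<longleftrightarrow> ghost_before (m, B) (m', B')" .
  show "ps (m, B) < real_of_int (\<kappa> j) \<longleftrightarrow> m < j \<or> m = j \<and> content B \<le> 0" if j: "1 \<le> j" "j \<le> l"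
  proof -
    have idxj: "(Red, j, 0, 0) \<in> string_index l mu" using j by (auto simp: string_index_def)
    have "ps (m, B) < real_of_int (\<kappa> j) \<longleftrightarrow> lex_less (string_key (Solid, m, B)) (string_key (Red, j, 0, 0))"
      using L.string_less_iff[OF idx(1) idxj] by (simp add: L.string_def ps)
    also have "\<dots> \<longleftrightarrow> m < j \<or> m = j \<and> content B \<le> 0"
    proof -
      have "2 * (int c - int r) \<noteq> 1" by presburger
      then show ?thesis by (auto simp: string_key_def lex_less_def B content_def)
    qed
    finally show ?thesis .
  qed
qed

end

text \<open>
  Used for \<open>M = p + 1\<close>: distinct contents of one residue are at least \<open>p + 1\<close> apart, which leaves room for the collapsed
  diagonals.
\<close>

lemma congruent_gap:
  fixes x y M c :: int
  assumes "(x + c) mod M = (y + c) mod M" "x < y"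
  shows "x + M \<le> y"
proof -
  have "M dvd (y + c) - (x + c)" using assms(1)[symmetric] by (simp only: mod_eq_dvd_iff)
  then have "M dvd y - x" by simp
  then have "M \<le> y - x" using assms(2) by (intro zdvd_imp_le) auto
  then show ?thesis by simp
qed

context component
begin

lemma old_content_gap:
  assumes "(D + raise_res a) mod int (p + 1) = (D' + raise_res a) mod int (p + 1)" "D < D'"
  shows "old_content p a D + int p \<le> old_content p a D'"
  using old_content_period[of D 1] old_content_mono[OF congruent_gap[OF assms]] by simp

end

context subdivision
begin

abbreviation "new_res \<equiv> node_res (p + 1) \<rho>'"

abbreviation old_level :: "nat \<Rightarrow> nat \<times> nat \<Rightarrow> int" where
  "old_level m B \<equiv> old_content p (\<rho> m) (content B)"

abbreviation old_depth :: "nat \<Rightarrow> nat \<times> nat \<Rightarrow> nat" where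
  "old_depth m B \<equiv> 2 * min (fst B) (snd B) + nat \<bar>old_level m B\<bar>"

lemma place_depth_margin:
  assumes "s' + j \<le> s"
  shows "old.place m k s + real j * \<delta> \<le> old.place m k s'"
proof -
  have "real j * \<delta> \<le> (real s - real s') * \<delta>"
    using assms delta_small by (intro mult_right_mono) auto
  then show ?thesis using old.place_diff[of m k s' s] by linarith
qed

lemma new_node:
  assumes "(m, B) \<in> new_nodes"
  shows "1 \<le> m" "m \<le> l" "(m, source_box p (\<rho> m) B) \<in> old_nodes"
    "old_depth m B \<le> n + 1" "- int n \<le> old_level m B" "old_level m B + 1 \<le> int n"
    "new_res (m, B) = (content B + \<rho>' m) mod int (p + 1)"
    "new_res (m, B) \<noteq> 1 \<Longrightarrow> new_pos (m, B) = old.place m (old_level m B) (old_depth m B)"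
    "new_res (m, B) = 1 \<Longrightarrow> new_pos (m, B) =
      old.place m (old_level m B + 1) (old_depth m B) + (if 0 \<le> content B then - t else t)"
proof -
  let ?A = "source_box p (\<rho> m) B"
  show m: "1 \<le> m" "m \<le> l" and A: "(m, ?A) \<in> old_nodes" using assms by (auto simp: new_node_iff)
  interpret component p "\<rho> m" using m by (rule comp)
  note a = old_node[OF A]
  have depth: "fst ?A + snd ?A = old_depth m B"
    using coords_sum[of ?A] by (simp add: source_box_coords)
  show "old_depth m B \<le> n + 1" "- int n \<le> old_level m B" "old_level m B + 1 \<le> int n"
    using a(5,6,7) depth by (simp_all add: source_box_coords)
  show "new_res (m, B) = (content B + \<rho>' m) mod int (p + 1)"
    by (simp add: node_res_def box_res_content)
  show "new_res (m, B) \<noteq> 1 \<Longrightarrow> new_pos (m, B) = old.place m (old_level m B) (old_depth m B)"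
    using a(8) depth by (simp add: new_pos_def node_res_def source_box_coords)
  show "new_res (m, B) = 1 \<Longrightarrow> new_pos (m, B) =
      old.place m (old_level m B + 1) (old_depth m B) + (if 0 \<le> content B then - t else t)"
    using a(9) depth by (simp add: new_pos_def node_res_def source_box_coords)
qed

text \<open>
  Rough, but enough to keep components apart, even after adding a ghost shift.
\<close>

lemma new_pos_bounds:
  assumes "(m, B) \<in> new_nodes"
  shows "real_of_int (\<kappa> m) - real n - 2 < new_pos (m, B)" "new_pos (m, B) < real_of_int (\<kappa> m) + real n + 1"
proof -
  note b = new_node[OF assms]
  have "real_of_int (\<kappa> m) - real n - 2 < new_pos (m, B) \<and> new_pos (m, B) < real_of_int (\<kappa> m) + real n + 1"
  proof (cases "new_res (m, B) = 1")
    case True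
    then show ?thesis
      using b(9) t_less_1 eps old.place_bounds[OF b(1,2), of "old_level m B + 1" "old_depth m B"] b(4,5,6)
      by (simp split: if_splits)
  next
    case False
    then show ?thesis
      using b(8) old.place_bounds[OF b(1,2), of "old_level m B" "old_depth m B"] b(4,5,6) by simp
  qed
  then show "real_of_int (\<kappa> m) - real n - 2 < new_pos (m, B)" "new_pos (m, B) < real_of_int (\<kappa> m) + real n + 1"
    by simp_all
qed

lemma kappa_gap_real:
  assumes "1 \<le> m" "m < m'" "m' \<le> l"
  shows "real_of_int (\<kappa> m) + 4 * real n + 3 \<le> real_of_int (\<kappa> m')"
  using kappa_gap[OF assms] by linarith

lemma new_pos_component:
  assumes "(m, B) \<in> new_nodes" "(m', B') \<in> new_nodes" "m < m'"
  shows "new_pos (m, B) + 1 < new_pos (m', B')"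
proof -
  have "1 \<le> real n" using n1 by simp
  then show ?thesis
    using new_pos_bounds(2)[OF assms(1)] new_pos_bounds(1)[OF assms(2)]
      kappa_gap_real[OF new_node(1)[OF assms(1)] assms(3) new_node(2)[OF assms(2)]] by linarith
qed

lemma sources_differ:
  assumes "(m, B) \<in> new_nodes" "(m, B') \<in> new_nodes"
    and "old_level m B \<noteq> old_level m B' \<or> min (fst B) (snd B) \<noteq> min (fst B') (snd B')"
  shows "t + \<epsilon> < \<delta>"
proof (rule t_less_delta)
  show "(m, source_box p (\<rho> m) B) \<in> old_nodes" "(m, source_box p (\<rho> m) B') \<in> old_nodes"
    using assms new_node(3) by blast+
  interpret component p "\<rho> m" using new_node(1,2)[OF assms(1)] by (rule comp)
  show "source_box p (\<rho> m) B \<noteq> source_box p (\<rho> m) B'"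
    using assms(3) source_box_coords[of B] source_box_coords[of B'] by metis
qed

text \<open>
  On one diagonal all strings are displaced equally; on different diagonals of one residue the
  strings are in different columns, also before subdivision, and the margin between columns exceeds twice the displacement.
\<close>

lemma new_solid_less:
  assumes N: "(m, B) \<in> new_nodes" "(m', B') \<in> new_nodes" and res: "new_res (m, B) = new_res (m', B')"
    and before: "solid_before (m, B) (m', B')"
  shows "new_pos (m, B) < new_pos (m', B')"
proof (cases "m = m'")
  case False
  then have "m < m'" using before by (simp add: solid_before_def)
  then show ?thesis using new_pos_component[OF N] by simp
next
  case m: True
  note b = new_node[OF N(1)] and b' = new_node[OF N(2), folded m]
  interpret component p "\<rho> m" using b(1,2) by (rule comp)
  have N': "(m, B') \<in> new_nodes" using N(2) m by simp
  have cong: "(content B + \<rho>' m) mod int (p + 1) = (content B' + \<rho>' m) mod int (p + 1)"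
    using res b(7) b'(7) m by simp
  consider "content B < content B'" | "content B = content B'" "min (fst B') (snd B') < min (fst B) (snd B)"
    using before m by (auto simp: solid_before_def)
  then show ?thesis
  proof cases
    case 1
    have lev: "old_level m B < old_level m B'" using old_content_gap[OF cong 1] p2 by linarith
    show ?thesis
    proof (cases "new_res (m, B) = 1")
      case True
      have "t < \<delta>" using sources_differ[OF N(1) N'] lev eps by simp
      moreover have "old_level m B + 1 < old_level m B' + 1" using lev by simp
      ultimately show ?thesis
        using old.place_less_level[OF b(1,2) _ b'(4), of "old_level m B + 1" "old_level m B' + 1" "old_depth m B"]
          b(9) b'(9) True res m eps by (simp split: if_splits)
    next
      case False
      then show ?thesis
        using old.place_less_level[OF b(1,2) lev b'(4), of "old_depth m B"] b(8) b'(8) res m delta_small by simp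
    qed
  next
    case 2
    then have depth: "old_depth m B' < old_depth m B" by simp
    show ?thesis
      using old.place_less_depth[OF depth, of m "old_level m B"] old.place_less_depth[OF depth, of m "old_level m B + 1"]
        b(8,9) b'(8,9) res m 2(1) by (cases "new_res (m, B) = 1") simp_all
  qed
qed

lemma solid_before_cases: "solid_before N N' \<or> N = N' \<or> solid_before N' N"
proof -
  obtain m B m' B' where N: "N = (m, B)" "N' = (m', B')" by (cases N; cases N')
  have "B = B'" if "content B = content B'" "min (fst B) (snd B) = min (fst B') (snd B')"
    using that by (metis diag_box_coords)
  then show ?thesis unfolding N solid_before_def prod.case by (metis linorder_less_linear)
qed

lemma new_solid_order:
  assumes "N \<in> new_nodes" "N' \<in> new_nodes" "new_res N = new_res N'"
  shows "new_pos N < new_pos N' \<longleftrightarrow> solid_before N N'"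
    and "new_pos N = new_pos N' \<Longrightarrow> N = N'"
proof -
  have less: "new_pos N < new_pos N'"
    if "N \<in> new_nodes" "N' \<in> new_nodes" "new_res N = new_res N'" "solid_before N N'" for N N'
    using new_solid_less[of "fst N" "snd N" "fst N'" "snd N'"] that by simp
  have "\<not> solid_before N N" by (cases N) (simp add: solid_before_def)
  then show "new_pos N < new_pos N' \<longleftrightarrow> solid_before N N'" "new_pos N = new_pos N' \<Longrightarrow> N = N'"
    using solid_before_cases[of N N'] less[OF assms] less[OF assms(2,1)] assms(3) by fastforce+
qed

text \<open>
  For residues other than 0 and 1, this is the old order: contents of neighbouring diagonals stay
  neighbours and keep their signs.  For residue 0, the solid string is a new one: attached to the same node, its side decides;
  otherwise the order is that of the two ghosts next to which the strings are, at distance at least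
  \<open>2 * \<delta>\<close>.  For residue 1, the ghost is a new one and the solid string belongs to a 1-node; the old
  ghost of the 0-node and this string are at distance at least \<open>\<delta>\<close>, more than the new ghost is
  displaced.
\<close>

lemma new_ghost_less:
  assumes N: "(m, B) \<in> new_nodes" "(m, B') \<in> new_nodes"
    and res: "new_res (m, B') = (new_res (m, B) + 1) mod int (p + 1)"
  shows "if ghost_before (m, B) (m, B')
    then new_pos (m, B) + subdiv_shift \<epsilon> (new_res (m, B)) < new_pos (m, B')
    else new_pos (m, B') < new_pos (m, B) + subdiv_shift \<epsilon> (new_res (m, B))"
proof -
  note b = new_node[OF N(1)] and b' = new_node[OF N(2)]
  interpret component p "\<rho> m" using b(1,2) by (rule comp)
  define i where "i = new_res (m, B)"
  define d where "d = old_level m B"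
  define d' where "d' = old_level m B'"
  define q where "q = min (fst B) (snd B)"
  define q' where "q' = min (fst B') (snd B')"
  define s where "s = old_depth m B"
  define s' where "s' = old_depth m B'"
  define x where "x = old.place m (d + 1) s"
  define e where "e = old_content p (\<rho> m) (content B + 1)"
  have s: "s = 2 * q + nat \<bar>d\<bar>" "s' = 2 * q' + nat \<bar>d'\<bar>" "s \<le> n + 1" "s' \<le> n + 1"
    using b(4) b'(4) by (simp_all add: s_def s'_def q_def q'_def d_def d'_def)
  have i: "0 \<le> i" "i < int (p + 1)" unfolding i_def b(7) by simp_all
  have cong: "(content B + 1 + \<rho>' m) mod int (p + 1) = (content B' + \<rho>' m) mod int (p + 1)"
  proof -
    have "(content B' + \<rho>' m) mod int (p + 1) = ((content B + \<rho>' m) mod int (p + 1) + 1) mod int (p + 1)"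
      using res b(7) b'(7) by simp
    also have "\<dots> = (content B + \<rho>' m + 1) mod int (p + 1)" by (rule mod_add_left_eq)
    finally show ?thesis by (simp add: ac_simps)
  qed
  have right: "e < d'" if "content B + 1 < content B'"
    using old_content_gap[OF cong that] p2 by (simp add: e_def d'_def)
  have here: "d' = e" if "content B + 1 = content B'"
    by (simp add: e_def d'_def that)
  have left: "d' < e" if "content B' < content B + 1"
    using old_content_gap[OF cong[symmetric] that] p2 by (simp add: e_def d'_def)
  have e: "e = (if i = 0 then d else d + 1)"
    using old_content_Suc[of "content B"] b(7) by (simp add: e_def d_def i_def)
  have sgn: "0 \<le> d \<longleftrightarrow> 0 \<le> content B" "0 \<le> d' \<longleftrightarrow> 0 \<le> content B'"
    by (simp_all add: d_def d'_def old_content_nonneg)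
  have before: "ghost_before (m, B) (m, B') \<longleftrightarrow> content B + 1 < content B' \<or>
      content B + 1 = content B' \<and> (if 0 \<le> d then q' < q else q' \<le> q)"
    by (simp add: ghost_before_def sgn q_def q'_def)
  have depth: "s' < s \<longleftrightarrow> (if 0 \<le> d then q' < q else q' \<le> q)" "s \<noteq> s'" if "d' = d + 1"
    unfolding s(1,2) that by (rule depth_compare, rule depth_compare(2)[symmetric])
  have lev: "old.place m j s + 2 * \<delta> < old.place m k s'" if "j < k" for j k
    using old.place_less_level[OF b(1,2) that s(4)] .
  have lev': "old.place m k s' + 2 * \<delta> < old.place m j s" if "k < j" for j k
    using old.place_less_level[OF b(1,2) that s(3)] .
  note marg = place_depth_margin[where m = m]
  have td: "t + \<epsilon> < \<delta>" if "d \<noteq> d' \<or> q \<noteq> q'"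
    using sources_differ[OF N] that by (simp add: d_def d'_def q_def q'_def)
  have step: "old.place m k s + 1 = old.place m (k + 1) s" for k
    by (simp add: old.place_def)
  let ?goal = "if ghost_before (m, B) (m, B')
    then new_pos (m, B) + subdiv_shift \<epsilon> i < new_pos (m, B')
    else new_pos (m, B') < new_pos (m, B) + subdiv_shift \<epsilon> i"
  consider (other) "i \<noteq> 0" "i \<noteq> 1" | (zero) "i = 0" | (one) "i = 1" by blast
  then have ?goal
  proof cases
    case other
    have "new_res (m, B') \<noteq> 1"
    proof (cases "i = int p")
      case True
      then have "i + 1 = int (p + 1)" by simp
      then have "new_res (m, B') = 0" unfolding res i_def[symmetric] by (simp only: mod_self)
      then show ?thesis by simp
    next
      case False
      then have "(i + 1) mod int (p + 1) = i + 1" using i by (intro mod_pos_pos_trivial) auto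
      then have "new_res (m, B') = i + 1" unfolding res i_def[symmetric] .
      then show ?thesis using other by simp
    qed
    then have x': "new_pos (m, B') = old.place m d' s'" using b'(8) by (simp add: d'_def s'_def)
    have "new_pos (m, B) = old.place m d s" using b(8) other(2) unfolding i_def d_def s_def by blast
    then have g: "new_pos (m, B) + subdiv_shift \<epsilon> i = x"
      using step[of d] other(2) by (simp add: subdiv_shift_def x_def)
    consider "content B + 1 < content B'" | "content B + 1 = content B'" | "content B' < content B + 1" by linarith
    then show ?goal
    proof cases
      case 1
      then show ?goal using lev[OF right[OF 1]] e other delta_small g x' before by (simp add: x_def)
    next
      case 2
      then have dd: "d' = d + 1" using here e other by simp
      show ?goal
        using depth[OF dd] old.place_less_depth[of s' s m "d + 1"] old.place_less_depth[of s s' m "d + 1"] g x' 2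
        by (cases s s' rule: linorder_cases) (auto simp: x_def dd before)
    next
      case 3
      then show ?goal using lev'[OF left[OF 3]] e other delta_small g x' before by (simp add: x_def)
    qed
  next
    case zero
    have r1: "new_res (m, B') = 1" using res zero p2 by (simp add: i_def)
    define \<tau> where "\<tau> = (if 0 \<le> d' then - t else t)"
    have x': "new_pos (m, B') = old.place m (d' + 1) s' + \<tau>"
      using b'(9)[OF r1] by (simp add: d'_def[symmetric] s'_def \<tau>_def sgn)
    have "new_res (m, B) \<noteq> 1" using zero unfolding i_def by simp
    then have "new_pos (m, B) = old.place m d s" using b(8) unfolding d_def s_def by blast
    then have g: "new_pos (m, B) + subdiv_shift \<epsilon> i = x"
      using step[of d] zero by (simp add: subdiv_shift_def x_def)
    have \<tau>: "\<bar>\<tau>\<bar> = t" using eps by (simp add: \<tau>_def)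
    have ed: "e = d" using e zero by simp
    consider "content B + 1 < content B'" | "content B + 1 = content B'" | "content B' < content B + 1" by linarith
    then show ?goal
    proof cases
      case 1
      then have dd: "d < d'" using right ed by simp
      then show ?goal using lev[of "d + 1" "d' + 1"] td \<tau> eps g x' before 1
        by (simp add: x_def)
    next
      case 2
      then have dd: "d' = d" using here ed by simp
      consider "q' < q" | "q' = q" | "q < q'" by linarith
      then show ?goal
      proof cases
        case a: 1
        then have "s' + 2 \<le> s" by (simp add: s dd)
        from marg[OF this, of "d + 1"] show ?goal using td a \<tau> eps g x' before 2
          by (simp add: x_def dd)
      next
        case a: 2
        then have "s' = s" by (simp add: s dd)
        then show ?goal using a eps g x' before 2
          by (simp add: x_def dd \<tau>_def)
      next
        case a: 3
        then have "s + 2 \<le> s'" by (simp add: s dd)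
        from marg[OF this, of "d + 1"] show ?goal using td a \<tau> eps g x' before 2
          by (simp add: x_def dd)
      qed
    next
      case 3
      then have dd: "d' < d" using left ed by simp
      then show ?goal using lev'[of "d' + 1" "d + 1"] td \<tau> eps g x' before 3
        by (simp add: x_def)
    qed
  next
    case one
    have r2: "new_res (m, B') = 2" using res one p2 unfolding i_def by simp
    then have x': "new_pos (m, B') = old.place m d' s'" using b'(8) by (simp add: d'_def s'_def)
    define \<tau> where "\<tau> = (if 0 \<le> content B then - t else t) + \<epsilon>"
    have "new_pos (m, B) = x + (if 0 \<le> content B then - t else t)"
      using b(9) one unfolding i_def d_def s_def x_def by blast
    then have g: "new_pos (m, B) + subdiv_shift \<epsilon> i = x + \<tau>"
      using one by (simp add: subdiv_shift_def \<tau>_def)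
    have \<tau>: "\<bar>\<tau>\<bar> \<le> t + \<epsilon>" using eps by (simp add: \<tau>_def)
    \<comment> \<open>The residues of the two sources differ, so there are two boxes in this component.\<close>
    have "box_res p (\<rho> m) (source_box p (\<rho> m) B) = 0" "box_res p (\<rho> m) (source_box p (\<rho> m) B') = 1"
      using r2 one source_box_res[of B] source_box_res[of B'] by (simp_all add: i_def node_res_def)
    then have "source_box p (\<rho> m) B \<noteq> source_box p (\<rho> m) B'" by auto
    then have tde: "t + \<epsilon> < \<delta>" by (rule t_less_delta[OF b(3) b'(3)])
    have ed: "e = d + 1" using e one by simp
    consider "content B + 1 < content B'" | "content B + 1 = content B'" | "content B' < content B + 1" by linarith
    then show ?goal
    proof cases
      case 1
      then have "d + 1 < d'" using right ed by simp
      then show ?goal using lev[of "d + 1" d'] tde \<tau> delta_small g x' before 1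
        by (simp add: x_def)
    next
      case 2
      then have dd: "d' = d + 1" using here ed by simp
      consider "s' < s" | "s < s'" using depth(2)[OF dd] by linarith
      then show ?goal
      proof cases
        case a: 1
        then have "s' + 1 \<le> s" by simp
        from marg[OF this, of "d + 1"] show ?goal using tde \<tau> g x' before depth(1)[OF dd] a 2
          by (simp add: x_def dd)
      next
        case a: 2
        then have "s + 1 \<le> s'" by simp
        from marg[OF this, of "d + 1"] show ?goal using tde \<tau> g x' before depth(1)[OF dd] a 2
          by (simp add: x_def dd)
      qed
    next
      case 3
      then have "d' < d + 1" using left ed by simp
      then show ?goal using lev'[of d' "d + 1"] tde \<tau> delta_small g x' before 3
        by (simp add: x_def)
    qed
  qed
  then show ?thesis unfolding i_def .
qed

lemma new_ghost_order:
  assumes N: "N \<in> new_nodes" "N' \<in> new_nodes"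
    and res: "new_res N' = (new_res N + 1) mod int (p + 1)"
  shows "new_pos N + subdiv_shift \<epsilon> (new_res N) < new_pos N' \<longleftrightarrow> ghost_before N N'"
proof -
  obtain m B m' B' where NB: "N = (m, B)" "N' = (m', B')" by (cases N; cases N')
  have sh: "0 < subdiv_shift \<epsilon> i" "subdiv_shift \<epsilon> i \<le> 1" for i
    using eps t_less_1 by (auto simp: subdiv_shift_def)
  consider "m < m'" | "m = m'" | "m' < m" by linarith
  then show ?thesis
  proof cases
    case 1
    then have "ghost_before N N'" by (simp add: NB ghost_before_def)
    then show ?thesis using new_pos_component[of m B m' B'] N 1 sh(2)[of "new_res N"] by (simp add: NB)
  next
    case 2
    then show ?thesis using new_ghost_less[of m B B'] N res by (auto simp: NB split: if_splits)
  next
    case 3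
    then have "\<not> ghost_before N N'" by (simp add: NB ghost_before_def)
    then show ?thesis using new_pos_component[of m' B' m B] N 3 sh(1)[of "new_res N"] by (simp add: NB)
  qed
qed

text \<open>
  Red strings never have residue 1, so only old strings are concerned.
\<close>

lemma new_red_order:
  assumes N: "(m, B) \<in> new_nodes" and j: "1 \<le> j" "j \<le> l" and res: "new_res (m, B) = \<rho>' j"
  shows "new_pos (m, B) < real_of_int (\<kappa> j) \<longleftrightarrow> m < j \<or> m = j \<and> content B \<le> 0"
proof -
  note b = new_node[OF N]
  interpret component p "\<rho> m" using b(1,2) by (rule comp)
  consider "m < j" | "j < m" | "m = j" by linarith
  then show ?thesis
  proof cases
    case 1
    then show ?thesis using new_pos_bounds(2)[OF N] kappa_gap_real[OF b(1) 1 j(2)] by simp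
  next
    case 2
    then show ?thesis using new_pos_bounds(1)[OF N] kappa_gap_real[OF j(1) 2 b(2)] by simp
  next
    case 3
    have r: "new_res (m, B) \<noteq> 1" using res raise_res_range 3 by simp
    have s: "1 \<le> old_depth m B"
    proof -
      have "1 \<le> fst (source_box p (\<rho> m) B)" "1 \<le> snd (source_box p (\<rho> m) B)"
        using old_node(3)[OF b(3)] by (auto simp: boxes_def)
      then have "1 \<le> min (fst B) (snd B)" using source_box_coords(2)[of B] by linarith
      then show ?thesis by linarith
    qed
    have cong: "(0 + \<rho>' m) mod int (p + 1) = (content B + \<rho>' m) mod int (p + 1)"
      using res b(7) 3 raise_res_range by simp
    show ?thesis
    proof (cases "content B \<le> 0")
      case True
      then have "old_level m B \<le> 0" using old_content_mono[of "content B" 0] by simp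
      then show ?thesis using old.place_red(1)[OF b(1,2) s b(4)] b(8)[OF r] 3 True by simp
    next
      case False
      then have "1 \<le> old_level m B" using old_content_gap[OF cong] p2 by simp
      then show ?thesis using old.place_red(2)[OF b(1,2) s b(4), of "old_level m B"] b(8)[OF r] 3 False by simp
    qed
  qed
qed

section \<open>Positions after subdivision are distinct\<close>

text \<open>
  Each new string stays within \<open>t + \<epsilon>\<close> of a ghost 0-string.  That strings are more than \<open>t + \<epsilon>\<close>
  apart does not by itself keep the new strings of two such ghosts apart; but those in one column are at distance at least
  \<open>2 * \<delta>\<close>, as the values of \<open>r + c\<close> on a diagonal have the same parity.
\<close>

lemma zero_ghosts_far:
  assumes "N \<in> old_nodes" "N' \<in> old_nodes" "old_res N = 0" "old_res N' = 0" "N \<noteq> N'"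
  shows "2 * (t + \<epsilon>) < \<bar>old.pos N - old.pos N'\<bar>"
proof -
  obtain m A m' B where NB: "N = (m, A)" "N' = (m', B)" by (cases N; cases N')
  note a = old_node[OF assms(1)[unfolded NB]] and b = old_node[OF assms(2)[unfolded NB]]
  define s where "s = fst A + snd A"
  define s' where "s' = fst B + snd B"
  have ab: "- int n \<le> content A" "content A \<le> int n" "s \<le> n + 1" "- int n \<le> content B" "content B \<le> int n" "s' \<le> n + 1"
    using a(5-7) b(5-7) by (simp_all add: s_def s'_def)
  have pos: "old.pos N = old.place m (content A) s" "old.pos N' = old.place m' (content B) s'"
    using a(8) b(8) by (simp_all add: NB s_def s'_def)
  have n0: "0 \<le> real n" by simp
  consider "m < m'" | "m' < m" | "m = m'" by linarith
  then show ?thesis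
  proof cases
    case 1
    have "old.place m (content A) s + 2 \<le> old.place m' (content B) s'"
      using kappa_gap_real[OF a(1) 1 b(2)] old.place_bounds(2)[OF a(1,2) ab(1-3)]
        old.place_bounds(1)[OF b(1,2) ab(4-6)] n0 by linarith
    then show ?thesis using t_less_1 unfolding pos by simp
  next
    case 2
    have "old.place m' (content B) s' + 2 \<le> old.place m (content A) s"
      using kappa_gap_real[OF b(1) 2 a(2)] old.place_bounds(1)[OF a(1,2) ab(1-3)]
        old.place_bounds(2)[OF b(1,2) ab(4-6)] n0 by linarith
    then show ?thesis using t_less_1 unfolding pos by simp
  next
    case 3
    have "A \<noteq> B" using assms(5) 3 by (simp add: NB)
    then have td: "t + \<epsilon> < \<delta>" using t_less_delta assms(1,2) 3 by (simp add: NB)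
    consider "content A < content B" | "content B < content A" | "content A = content B" by linarith
    then show ?thesis
    proof cases
      case 1
      then show ?thesis using old.place_less_level[OF a(1,2) 1 ab(6), of s] td 3 unfolding pos by simp
    next
      case 2
      then show ?thesis using old.place_less_level[OF a(1,2) 2 ab(3), of s'] td 3 unfolding pos by simp
    next
      case c: 3
      have sums: "s = 2 * min (fst A) (snd A) + nat \<bar>content A\<bar>" "s' = 2 * min (fst B) (snd B) + nat \<bar>content A\<bar>"
        using coords_sum[of A] coords_sum[of B] c by (simp_all add: s_def s'_def)
      have "min (fst A) (snd A) \<noteq> min (fst B) (snd B)" using \<open>A \<noteq> B\<close> c by (metis diag_box_coords)
      then consider "s' + 2 \<le> s" | "s + 2 \<le> s'" using sums by linarith
      then show ?thesis
      proof cases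
        case 1
        then show ?thesis using place_depth_margin[OF 1, of m "content A"] td 3 c eps unfolding pos by simp
      next
        case 2
        then show ?thesis using place_depth_margin[OF 2, of m "content A"] td 3 c eps unfolding pos by simp
      qed
    qed
  qed
qed

text \<open>
  Ghost shifts of old strings are unchanged, because no old string has residue 1 after the
  relabelling.
\<close>

lemma strands_subdivide_cases:
  assumes "s \<in> strands subdivided"
  obtains (kept) x k i where "(x, k, i) \<in> strands D" "s = (x, k, raise_res i)"
  | (right) N where "N \<in> old_nodes" "old_res N = 0" "0 \<le> content (snd N)"
      "s = (old.pos N + 1 - t, Solid, 1) \<or> s = (old.pos N + 1 - t + \<epsilon>, Ghost, 1)"
  | (left) N where "N \<in> old_nodes" "old_res N = 0" "content (snd N) < 0"
      "s = (old.pos N + 1 + t, Solid, 1) \<or> s = (old.pos N + 1 + t + \<epsilon>, Ghost, 1)"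
proof -
  obtain x k i where s: "s = (x, k, i)" by (cases s) auto
  have sol: thesis if y: "(y, i) \<in> solids subdivided" and
    k: "k = Solid \<and> x = y \<or> k = Ghost \<and> x = y + subdiv_shift \<epsilon> i" for y
  proof -
    from y have "(y, i) \<in> (\<lambda>(x, i). (x, raise_res i)) ` solids D \<union> (\<lambda>x. (x - t, 1)) ` ghosts0 \<delta> D 0 \<union>
        (\<lambda>x. (x + t, 1)) ` ghosts0 \<delta> D 1"
      by (simp only: subdivide_def diagram.select_convs)
    then consider (1) "(y, i) \<in> (\<lambda>(x, i). (x, raise_res i)) ` solids D"
      | (2) "(y, i) \<in> (\<lambda>x. (x - t, 1)) ` ghosts0 \<delta> D 0" | (3) "(y, i) \<in> (\<lambda>x. (x + t, 1)) ` ghosts0 \<delta> D 1"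
      by (elim UnE)
    then show thesis
    proof cases
      case 1
      then obtain j where j: "(y, j) \<in> solids D" "i = raise_res j" by auto
      then have "0 \<le> j" using old.idempotent_diagram_of unfolding old_diagram[symmetric] idempotent_diagram_def by force
      then have "i \<noteq> 1" using j by (simp add: raise_res_def)
      then have "(x, k, j) \<in> strands D" using k j by (auto simp: D_simps(2) subdiv_shift_def)
      then show thesis using kept j(2) s by simp
    next
      case 2
      then obtain N where "N \<in> old_nodes" "old_res N = 0" "0 \<le> content (snd N)"
        "y = old.pos N + 1 - t" "i = 1" by (auto simp: ghosts0_iff)
      then show thesis using right[of N] k s by (auto simp: subdiv_shift_def)
    next
      case 3
      then obtain N where "N \<in> old_nodes" "old_res N = 0" "content (snd N) < 0"
        "y = old.pos N + 1 + t" "i = 1" by (auto simp: ghosts0_iff)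
      then show thesis using left[of N] k s by (auto simp: subdiv_shift_def)
    qed
  qed
  show thesis
  proof (cases k)
    case Solid
    then show thesis using assms s sol[of x] by simp
  next
    case Ghost
    then show thesis using assms s sol[of "x - subdiv_shift \<epsilon> i"] by (simp add: subdivide_simps)
  next
    case Red
    then obtain j where "1 \<le> j" "j \<le> l" "x = real_of_int (\<kappa> j)" "i = \<rho>' j"
      using assms s by (auto simp: subdivide_simps)
    then show thesis using kept[of x Red "\<rho> j"] s Red by (auto simp: D_simps)
  qed
qed

lemma subdivide_anchor:
  assumes "s \<in> strands subdivided"
  obtains s0 where "s0 \<in> strands D" "fst s = fst s0" "s = (fst s0, fst (snd s0), raise_res (snd (snd s0)))"
  | N \<tau> where "N \<in> old_nodes" "old_res N = 0" "fst s = old.pos N + 1 + \<tau>" "\<tau> \<noteq> 0" "\<bar>\<tau>\<bar> \<le> t + \<epsilon>"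
      "\<tau> = (if 0 \<le> content (snd N) then - t else t) + (if fst (snd s) = Ghost then \<epsilon> else 0)"
      "snd s = (Solid, 1) \<or> snd s = (Ghost, 1)"
  using assms
proof (cases rule: strands_subdivide_cases)
  case (kept x k i)
  then show ?thesis using that(1)[of "(x, k, i)"] by simp
next
  case (right N)
  define \<tau> where "\<tau> = - t + (if fst (snd s) = Ghost then \<epsilon> else 0)"
  show ?thesis
  proof (rule that(2)[of N \<tau>])
    show "N \<in> old_nodes" "old_res N = 0" by fact+
    show "\<tau> \<noteq> 0" "\<bar>\<tau>\<bar> \<le> t + \<epsilon>" using eps by (simp_all add: \<tau>_def)
    show "fst s = old.pos N + 1 + \<tau>" "snd s = (Solid, 1) \<or> snd s = (Ghost, 1)"
      using right(4) by (elim disjE; simp add: \<tau>_def)+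
    show "\<tau> = (if 0 \<le> content (snd N) then - t else t) + (if fst (snd s) = Ghost then \<epsilon> else 0)"
      using right(3) by (simp add: \<tau>_def)
  qed
next
  case (left N)
  define \<tau> where "\<tau> = t + (if fst (snd s) = Ghost then \<epsilon> else 0)"
  show ?thesis
  proof (rule that(2)[of N \<tau>])
    show "N \<in> old_nodes" "old_res N = 0" by fact+
    show "\<tau> \<noteq> 0" "\<bar>\<tau>\<bar> \<le> t + \<epsilon>" using eps by (simp_all add: \<tau>_def)
    show "fst s = old.pos N + 1 + \<tau>" "snd s = (Solid, 1) \<or> snd s = (Ghost, 1)"
      using left(4) by (elim disjE; simp add: \<tau>_def)+
    show "\<tau> = (if 0 \<le> content (snd N) then - t else t) + (if fst (snd s) = Ghost then \<epsilon> else 0)"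
      using left(3) by (simp add: \<tau>_def)
  qed
qed

text \<open>
  Every string is anchored at a string of the diagram before subdivision: at itself, or at the
  ghost next to which it was added.  Strings with different anchors are apart by the distances between
  anchors, and around one ghost the offsets are distinct because \<open>0 < \<epsilon> < t\<close>.
\<close>

lemma inj_strands_subdivide: "inj_on fst (strands subdivided)"
proof (rule inj_onI)
  have mixed: False if "s0 \<in> strands D" "N \<in> old_nodes" "old_res N = 0"
      "fst s0 = old.pos N + 1 + \<tau>" "\<tau> \<noteq> 0" "\<bar>\<tau>\<bar> \<le> t + \<epsilon>" for s0 N \<tau>
  proof -
    have "s0 \<noteq> (old.pos N + 1, Ghost, 0)" using that(4,5) by auto
    then have "t + \<epsilon> < \<bar>fst s0 - (old.pos N + 1)\<bar>"
      using sep[OF that(1), of "(old.pos N + 1, Ghost, 0)"] old_strands(2)[OF that(2)] that(3) by simp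
    then show False using that by simp
  qed
  fix s s' assume ss: "s \<in> strands subdivided" "s' \<in> strands subdivided" and eq: "fst s = fst s'"
  from ss(1) show "s = s'"
  proof (cases rule: subdivide_anchor)
    case (1 s0)
    from ss(2) show ?thesis
    proof (cases rule: subdivide_anchor)
      case b: (1 s0')
      have "s0 = s0'"
      proof (rule ccontr)
        assume "s0 \<noteq> s0'"
        from sep[OF 1(1) b(1) this] show False using 1(2) b(2) eq eps by simp
      qed
      then show ?thesis using 1(3) b(3) by simp
    next
      case b: (2 N \<tau>)
      then show ?thesis using mixed[OF 1(1) b(1,2) _ b(4,5)] 1(2) eq by simp
    qed
  next
    case a: (2 N \<tau>)
    from ss(2) show ?thesis
    proof (cases rule: subdivide_anchor)
      case b: (1 s0')
      then show ?thesis using mixed[OF b(1) a(1,2) _ a(4,5)] eq a(3) by simp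
    next
      case b: (2 N' \<tau>')
      have "N = N'"
      proof (rule ccontr)
        assume "N \<noteq> N'"
        have "old.pos N - old.pos N' = \<tau>' - \<tau>" using a(3) b(3) eq by simp
        then have "\<bar>old.pos N - old.pos N'\<bar> \<le> \<bar>\<tau>'\<bar> + \<bar>\<tau>\<bar>" by (simp add: abs_triangle_ineq4)
        then show False
          using zero_ghosts_far[OF a(1) b(1) a(2) b(2) \<open>N \<noteq> N'\<close>] a(5) b(5) by simp
      qed
      then have "\<tau> = \<tau>'" using a(3) b(3) eq by simp
      then have "(fst (snd s) = Ghost) = (fst (snd s') = Ghost)"
        using a(6) b(6) \<open>N = N'\<close> eps by (auto split: if_splits)
      then have "snd s = snd s'" using a(7) b(7) by auto
      then show ?thesis using eq by (simp add: prod_eq_iff)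
    qed
  qed
qed

lemma new_res_range: "new_res (m, B) \<in> {0..<int (p + 1)}"
  by (simp add: node_res_def box_res_content)

lemma idempotent_subdivide: "idempotent_diagram subdivided"
  unfolding idempotent_diagram_def
proof (intro conjI)
  show "2 \<le> modulus subdivided" using p2 by (simp add: subdivide_simps)
  show "\<forall>i\<in>{0..<int (modulus subdivided)}. 0 < shift subdivided i"
    using eps by (simp add: subdivide_simps subdiv_shift_def)
  show "finite (solids subdivided)"
    unfolding solids_subdivide using finite_nodes[OF nu_multipartition] by simp
  show "snd ` solids subdivided \<subseteq> {0..<int (modulus subdivided)}"
    unfolding solids_subdivide subdivide_simps using new_res_range by auto
  show "finite (reds subdivided)" by (simp add: subdivide_simps)
  show "snd ` reds subdivided \<subseteq> {0..<int (modulus subdivided)}"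
    unfolding subdivide_simps using component.raise_res_range[OF comp] by force
  show "inj_on fst (strands subdivided)" by (rule inj_strands_subdivide)
qed

section \<open>Comparison with the diagram of the enlarged multipartition\<close>

lemma new_gap:
  assumes "1 \<le> m" "m < m'" "m' \<le> l"
  shows "\<kappa> m + 2 * int (msize l nu) + 2 \<le> \<kappa> m'"
  using kappa_gap[OF assms] nu_size(2) by linarith

lemma new_rho: "1 \<le> m \<Longrightarrow> m \<le> l \<Longrightarrow> \<rho>' m \<in> {0..<int (p + 1)}"
  using component.raise_res_range[OF comp, of m] by simp

text \<open>
  The order in the given diagram is that of the unit diagram, by \<open>same_order_positions\<close>, and for the
  pairs that must not cross it agrees with the order after subdivision.
\<close>

lemma same_idempotent_subdivide:
  assumes small': "small_delta (p + 1) l nu \<delta>'"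
    and E: "subdivided_idempotent (p + 1) l \<kappa> \<rho>' \<epsilon> \<delta>' nu E"
  shows "same_idempotent subdivided E"
proof -
  let ?U = "unit_diagram (p + 1) l \<kappa> \<rho>' \<delta>' nu"
  let ?base = "\<lambda>m k. real_of_int k - real m / real (lhat (p + 1) l nu)"
  have p3: "2 \<le> p + 1" using p2 by simp
  have L: "layout (p + 1) l (msize l nu) \<kappa> \<rho>' nu ?base \<delta>' (\<lambda>_. 1)"
    by (rule unit_layout(1)[OF p3 l1 new_rho nu_multipartition nu_size(1) new_gap small'])
  interpret L: layout "p + 1" l "msize l nu" \<kappa> \<rho>' nu ?base \<delta>' "\<lambda>_. 1" by (rule L)
  have U: "?U = L.diagram_of"
    by (rule unit_layout(2)[OF p3 l1 new_rho nu_multipartition nu_size(1) new_gap small'])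
  have E': "idempotent_diagram E" "modulus E = p + 1" "shift E = subdiv_shift \<epsilon>" "reds E = reds ?U"
      "same_order ?U E"
    using E by (simp_all add: subdivided_idempotent_def)
  have redsU: "reds ?U = reds subdivided"
    unfolding U subdivide_simps L.diagram_of_def by simp
  have solU: "solids ?U = (\<lambda>N. (L.pos N, new_res N)) ` new_nodes"
    unfolding U L.diagram_of_def by simp
  obtain y where y: "solids E = (\<lambda>N. (y N, new_res N)) ` new_nodes" "inj_on (\<lambda>N. (y N, new_res N)) new_nodes"
    and solid: "\<And>N N'. N \<in> new_nodes \<Longrightarrow> N' \<in> new_nodes \<Longrightarrow> L.pos N < L.pos N' \<longleftrightarrow> y N < y N'"
    and ghost: "\<And>N N'. N \<in> new_nodes \<Longrightarrow> N' \<in> new_nodes \<Longrightarrow>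
        L.pos N + shift ?U (new_res N) < L.pos N' \<longleftrightarrow> y N + shift E (new_res N) < y N'"
    and red: "\<And>N z i. N \<in> new_nodes \<Longrightarrow> (z, i) \<in> reds ?U \<Longrightarrow> L.pos N < z \<longleftrightarrow> y N < z"
    using same_order_positions[OF E'(5,1,4) solU L.inj_node_string finite_nodes[OF nu_multipartition]] by blast
  have shU: "shift ?U i = 1" for i by (simp add: unit_diagram_def)
  show ?thesis
  proof (rule same_idempotent_by_interpolation[OF idempotent_subdivide E'(1) _ _ _ solids_subdivide _ y])
    show "modulus E = modulus subdivided" "shift E = shift subdivided"
      by (simp_all add: subdivide_simps E')
    show "reds E = reds subdivided" using E'(4) redsU by simp
    show "inj_on (\<lambda>N. (new_pos N, new_res N)) new_nodes"
      by (rule inj_onI) (simp add: new_solid_order(2))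
    fix N assume N: "N \<in> new_nodes"
    obtain m B where NB: "N = (m, B)" by (cases N)
    {
      fix N' assume N': "N' \<in> new_nodes"
      obtain m' B' where NB': "N' = (m', B')" by (cases N')
      note order = layout_order[OF L N[unfolded NB] N'[unfolded NB'], folded NB NB']
      show "new_pos N < new_pos N' \<longleftrightarrow> y N < y N'" if "new_res N = new_res N'"
        using new_solid_order(1)[OF N N' that] order(1) solid[OF N N'] by simp
      show "new_pos N + shift subdivided (new_res N) < new_pos N' \<longleftrightarrow>
          y N + shift subdivided (new_res N) < y N'"
        if "new_res N' = (new_res N + 1) mod int (modulus subdivided)"
        using new_ghost_order[OF N N' that[unfolded subdivide_simps]] order(2)
          ghost[OF N N', unfolded shU E'(3)] unfolding subdivide_simps by (simp only:)
    }
    fix z assume z: "(z, new_res N) \<in> reds subdivided"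
    then obtain j where j: "1 \<le> j" "j \<le> l" "z = real_of_int (\<kappa> j)" "new_res N = \<rho>' j"
      by (auto simp: subdivide_simps)
    have "(z, new_res N) \<in> reds ?U" using z redsU by simp
    then have "y N < z \<longleftrightarrow> L.pos N < z" using red[OF N] by simp
    also have "\<dots> \<longleftrightarrow> m < j \<or> m = j \<and> content B \<le> 0"
      using layout_order(3)[OF L N[unfolded NB] N[unfolded NB] j(1,2)] j(3) by (simp add: NB)
    also have "\<dots> \<longleftrightarrow> new_pos N < z"
      using new_red_order[OF N[unfolded NB] j(1,2)] j(3,4) by (simp add: NB)
    finally show "new_pos N < z \<longleftrightarrow> y N < z" by simp
  qed
qed

text \<open>
  Both the unit diagram and the one with squeezed columns are layouts of the same nodes.
\<close>

lemma subdivided_idempotent_exists: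
  assumes small': "small_delta (p + 1) l nu \<delta>'"
  shows "\<exists>E. subdivided_idempotent (p + 1) l \<kappa> \<rho>' \<epsilon> \<delta>' nu E"
proof -
  let ?f = "\<lambda>p M. \<epsilon> * real_of_int M + (1 - \<epsilon>) * real_of_int (squeeze p (M - 1))"
  let ?base = "\<lambda>m k. real_of_int k - real m / real (lhat (p + 1) l nu)"
  let ?base' = "\<lambda>m k. ?f p (k + \<rho>' m) - ?f p (\<rho>' m)"
  have p3: "2 \<le> p + 1" using p2 by simp
  have L: "layout (p + 1) l (msize l nu) \<kappa> \<rho>' nu ?base \<delta>' (\<lambda>_. 1)"
    by (rule unit_layout(1)[OF p3 l1 new_rho nu_multipartition nu_size(1) new_gap small'])
  interpret L: layout "p + 1" l "msize l nu" \<kappa> \<rho>' nu ?base \<delta>' "\<lambda>_. 1" by (rule L)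
  have U: "unit_diagram (p + 1) l \<kappa> \<rho>' \<delta>' nu = L.diagram_of"
    by (rule unit_layout(2)[OF p3 l1 new_rho nu_multipartition nu_size(1) new_gap small'])
  have e1: "\<epsilon> < 1" using eps t_less_1 by simp
  have L': "layout (p + 1) l (msize l nu) \<kappa> \<rho>' nu ?base' (\<epsilon> / (real (msize l nu) + 4)) (subdiv_shift \<epsilon>)"
    by (rule subdivided_layout[OF p2 new_rho nu_multipartition new_gap eps(1) e1])
  interpret L': layout "p + 1" l "msize l nu" \<kappa> \<rho>' nu ?base' "\<epsilon> / (real (msize l nu) + 4)" "subdiv_shift \<epsilon>"
    by (rule L')
  have "subdivided_idempotent (p + 1) l \<kappa> \<rho>' \<epsilon> \<delta>' nu L'.diagram_of"
    unfolding subdivided_idempotent_def U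
  proof (intro conjI)
    show "idempotent_diagram L'.diagram_of" by (rule L'.idempotent_diagram_of)
    show "same_order L.diagram_of L'.diagram_of" by (rule layouts_same_order[OF L L'])
    show "modulus L'.diagram_of = p + 1" "shift L'.diagram_of = subdiv_shift \<epsilon>"
      "reds L'.diagram_of = reds L.diagram_of"
      unfolding L'.diagram_of_def L.diagram_of_def by simp_all
  qed
  then show ?thesis by blast
qed

end

theorem proposition5p5p2:
  fixes e l n :: nat
    and \<rho> \<kappa> :: "nat \<Rightarrow> int"
    and lam :: "nat \<Rightarrow> nat \<Rightarrow> nat"
    and \<delta> \<delta>' t \<epsilon> :: real
  defines "D \<equiv> unit_diagram (e + 1) l \<kappa> \<rho> \<delta> lam"
    and "\<rho>' \<equiv> (\<lambda>m. raise_res (\<rho> m))"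
    and "nu \<equiv> lam_plus (e + 1) \<rho> lam"
  assumes "e \<ge> 1" and "l \<ge> 1" and "n \<ge> 1"
    and "\<forall>m\<in>{1..l}. \<rho> m \<in> {0..int e}"
    and "asymptotic n l \<kappa>"
    and "multipartition l lam" and "msize l lam = n"
    and "small_delta (e + 1) l lam \<delta>"
    and "0 < \<epsilon>" and "\<epsilon> < t"
    and "\<forall>s\<in>strands D. \<forall>s'\<in>strands D. s \<noteq> s' \<longrightarrow> t + \<epsilon> < \<bar>fst s - fst s'\<bar>"
    and "small_delta (e + 2) l nu \<delta>'"
  shows "multipartition l nu
       \<and> (\<forall>m\<in>{1..l}. boxes (nu m) = plus_boxes (e + 1) (\<rho> m) (lam m))
       \<and> (\<exists>E. subdivided_idempotent (e + 2) l \<kappa> \<rho>' \<epsilon> \<delta>' nu E)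
       \<and> (\<forall>E. subdivided_idempotent (e + 2) l \<kappa> \<rho>' \<epsilon> \<delta>' nu E
              \<longrightarrow> same_idempotent (subdivide \<delta> t \<epsilon> D) E)"
proof -
  interpret S: subdivision "e + 1" l n \<rho> \<kappa> lam \<delta> t \<epsilon>
  proof
    show "2 \<le> e + 1" "1 \<le> l" "1 \<le> n" using assms by auto
    show "\<rho> m \<in> {0..<int (e + 1)}" if "1 \<le> m" "m \<le> l" for m
      using assms(7) that by force
    show "asymptotic n l \<kappa>" "multipartition l lam" "msize l lam = n" "small_delta (e + 1) l lam \<delta>"
      "0 < \<epsilon>" "\<epsilon> < t" by fact+
    show "t + \<epsilon> < \<bar>fst s - fst s'\<bar>"
      if "s \<in> strands (unit_diagram (e + 1) l \<kappa> \<rho> \<delta> lam)" "s' \<in> strands (unit_diagram (e + 1) l \<kappa> \<rho> \<delta> lam)"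
        "s \<noteq> s'" for s s'
      using assms(14) that unfolding D_def by blast
  qed
  have e2: "e + 2 = (e + 1) + 1" by simp
  have small': "small_delta ((e + 1) + 1) l (lam_plus (e + 1) \<rho> lam) \<delta>'"
    using assms(15) unfolding nu_def e2 .
  show ?thesis
    unfolding nu_def \<rho>'_def D_def e2
  proof (intro conjI ballI allI impI)
    show "multipartition l (lam_plus (e + 1) \<rho> lam)" by (rule S.nu_multipartition)
    show "boxes (lam_plus (e + 1) \<rho> lam m) = plus_boxes (e + 1) (\<rho> m) (lam m)" if "m \<in> {1..l}" for m
      using S.nu_boxes(2)[of m] that by simp
    show "\<exists>E. subdivided_idempotent (e + 1 + 1) l \<kappa> (\<lambda>m. raise_res (\<rho> m)) \<epsilon> \<delta>' (lam_plus (e + 1) \<rho> lam) E"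
      by (rule S.subdivided_idempotent_exists[OF small'])
    show "same_idempotent (subdivide \<delta> t \<epsilon> (unit_diagram (e + 1) l \<kappa> \<rho> \<delta> lam)) E"
      if "subdivided_idempotent (e + 1 + 1) l \<kappa> (\<lambda>m. raise_res (\<rho> m)) \<epsilon> \<delta>' (lam_plus (e + 1) \<rho> lam) E" for E
      by (rule S.same_idempotent_subdivide[OF small' that])
  qed
qed

end
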